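(* Let $Z=(Z_t)_{t\in\mathbb{R}}$ be a centered square-integrable Lévy process with $Z_0=0$ and $\operatorname{Var}(Z_t)=|t|$. For $H\in(0,1)$, $r_0\ne0$ and $\delta\ge0$, let $f(t)=r_0(\delta\vee t)^{H-1/2}$ for $t\geq0$ and $f(t)=0$ for $t<0$, and $$N_t^{H,\delta}=\int_{\mathbb{R}}[f(t-s)-f(-s)]\,dZ_s,\qquad t\in\mathbb{R}.$$ Let $X^{H,\delta}$ be a QOU process driven by $N^{H,\delta}$ with parameter $\lambda>0$. Then, for $H\in(\frac12,1)$ and $t\to\infty$, $$\mathrm{R}_{X^{H,\delta}}(t)\sim\Big(\frac{r_0^2\,k_{H-3/2}\,(H-1/2)^2}{\lambda^2}\Big)t^{2H-2},\qquad\delta\ge0,$$ and for $H\in(0,1)$ and $t\to0$, $$\bar{\mathrm{R}}_{X^{H,\delta}}(t)\sim\begin{cases}(r_0^2\delta^{2H-1}/2)\,|t|,&\delta>0,\\(r_0^2j_{H-1/2}/2)\,|t|^{2H},&\delta=0.\end{cases}$$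
   Context: The integral defining $N^{H,\delta}$ is the integral of a deterministic square-integrable function with respect to the two-sided Lévy process $Z$ (a measurable modification is chosen). The value of $f$ at the single point $0$ is immaterial when $\delta=0$. A QOU process driven by $N$ with parameter $\lambda>0$ is a stationary process $X=(X_t)_{t\in\mathbb{R}}$ satisfying $X_t=X_0-\lambda\int_0^tX_s\,ds+N_t$ for all $t\in\mathbb{R}$, where the integral is a pathwise Lebesgue integral (with $\int_0^t=-\int_t^0$ for $t<0$). $\mathrm{R}_X(t)=\operatorname{Cov}(X_t,X_0)$ and $\bar{\mathrm{R}}_X(t)=\mathrm{R}_X(0)-\mathrm{R}_X(t)$. $f\sim g$ means $f/g\to1$. The constants are $$k_\alpha=\frac{\Gamma(1+\alpha)\Gamma(-1-2\alpha)}{\Gamma(-\alpha)},\quad\alpha\in(-1,-\tfrac12),\qquad j_\alpha=\frac{\Gamma(\alpha+1)^2}{(2\alpha+1)\sin(\pi(\alpha+\frac12))\Gamma(2\alpha+1)},\quad\alpha\in(-\tfrac12,\tfrac12).$$ *)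

theory Defs
  imports "HOL-Probability.Probability"
begin

text \<open>
  Processes are functions \<open>X :: real \<Rightarrow> 'a \<Rightarrow> real\<close> of time and outcome; the probability space
  is the measure \<open>M\<close>.
\<close>

definition cadlag :: "(real \<Rightarrow> real) \<Rightarrow> bool" where
  "cadlag x \<longleftrightarrow> (\<forall>t. (x \<longlongrightarrow> x t) (at_right t) \<and> (\<exists>l. (x \<longlongrightarrow> l) (at_left t)))"

definition two_sided_levy_process :: "'a measure \<Rightarrow> (real \<Rightarrow> 'a \<Rightarrow> real) \<Rightarrow> bool" where
  "two_sided_levy_process M Z \<longleftrightarrow>
     (\<forall>t. Z t \<in> borel_measurable M) \<and>
     (AE \<omega> in M. Z 0 \<omega> = 0) \<and>
     (\<forall>n (\<tau> :: nat \<Rightarrow> real). (\<forall>i<n. \<tau> i < \<tau> (Suc i)) \<longrightarrow>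
        prob_space.indep_vars M (\<lambda>_. borel) (\<lambda>i \<omega>. Z (\<tau> (Suc i)) \<omega> - Z (\<tau> i) \<omega>) {..<n}) \<and>
     (\<forall>s t h. s < t \<longrightarrow>
        distr M borel (\<lambda>\<omega>. Z (t + h) \<omega> - Z (s + h) \<omega>) = distr M borel (\<lambda>\<omega>. Z t \<omega> - Z s \<omega>)) \<and>
     (AE \<omega> in M. cadlag (\<lambda>t. Z t \<omega>))"

text \<open>
  A list of triples \<open>(a, u, v)\<close> with \<open>u \<le> v\<close> codes the step function with value \<open>a\<close> on
  \<open>(u, v]\<close>, overlapping pieces being added.
\<close>

definition step_fun :: "(real \<times> real \<times> real) list \<Rightarrow> real \<Rightarrow> real" where
  "step_fun c s = (\<Sum>(a, u, v)\<leftarrow>c. a * indicator {u<..v} s)"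

definition step_integral ::
    "(real \<Rightarrow> 'a \<Rightarrow> real) \<Rightarrow> (real \<times> real \<times> real) list \<Rightarrow> 'a \<Rightarrow> real" where
  "step_integral Z c \<omega> = (\<Sum>(a, u, v)\<leftarrow>c. a * (Z v \<omega> - Z u \<omega>))"

text \<open>
  \<open>is_levy_integral M Z g Y\<close>: the random variable \<open>Y\<close> is a version of \<open>\<integral> g dZ\<close>, the extension
  of \<open>step_integral\<close> from step functions to square-integrable \<open>g\<close> by \<open>L\<^sup>2\<close>-continuity. It is a
  relation because the integral is determined only up to almost sure equality. When \<open>Z\<close> is
  centered with \<open>Var (Z\<^sub>t) = \<bar>t\<bar>\<close>, the isometry makes the choice of the approximating sequence
  irrelevant.
\<close>

definition is_levy_integral ::
    "'a measure \<Rightarrow> (real \<Rightarrow> 'a \<Rightarrow> real) \<Rightarrow> (real \<Rightarrow> real) \<Rightarrow> ('a \<Rightarrow> real) \<Rightarrow> bool" where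
  "is_levy_integral M Z g Y \<longleftrightarrow>
     g \<in> borel_measurable lborel \<and> integrable lborel (\<lambda>s. (g s)\<^sup>2) \<and>
     Y \<in> borel_measurable M \<and> integrable M (\<lambda>\<omega>. (Y \<omega>)\<^sup>2) \<and>
     (\<exists>c :: nat \<Rightarrow> (real \<times> real \<times> real) list.
        (\<forall>n. \<forall>(a, u, v)\<in>set (c n). u \<le> v) \<and>
        (\<lambda>n. \<integral>s. (step_fun (c n) s - g s)\<^sup>2 \<partial>lborel) \<longlonglongrightarrow> 0 \<and>
        (\<lambda>n. \<integral>\<omega>. (step_integral Z (c n) \<omega> - Y \<omega>)\<^sup>2 \<partial>M) \<longlonglongrightarrow> 0)"

text \<open>
  The moving-average kernel. For \<open>\<delta> = 0\<close> the convention \<open>0 powr a = 0\<close> gives it the value \<open>0\<close>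
  at \<open>0\<close>, which does not matter for the integral.
\<close>

definition ma_kernel :: "real \<Rightarrow> real \<Rightarrow> real \<Rightarrow> real \<Rightarrow> real" where
  "ma_kernel r\<^sub>0 H \<delta> t = (if t \<ge> 0 then r\<^sub>0 * (max \<delta> t) powr (H - 1/2) else 0)"

definition measurable_process :: "'a measure \<Rightarrow> (real \<Rightarrow> 'a \<Rightarrow> real) \<Rightarrow> bool" where
  "measurable_process M X \<longleftrightarrow> (\<lambda>(t, \<omega>). X t \<omega>) \<in> borel_measurable (borel \<Otimes>\<^sub>M M)"

definition stationary_process :: "'a measure \<Rightarrow> (real \<Rightarrow> 'a \<Rightarrow> real) \<Rightarrow> bool" where
  "stationary_process M X \<longleftrightarrow>
     (\<forall>t. X t \<in> borel_measurable M) \<and>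
     (\<forall>J h. finite J \<longrightarrow>
        distr M (PiM J (\<lambda>_. borel)) (\<lambda>\<omega>. \<lambda>t\<in>J. X (t + h) \<omega>) =
        distr M (PiM J (\<lambda>_. borel)) (\<lambda>\<omega>. \<lambda>t\<in>J. X t \<omega>))"

text \<open>
  The equation is required almost surely for each \<open>t\<close>, the exceptional null set being allowed to
  depend on \<open>t\<close>. The interval integral is oriented, so it is \<open>- \<integral>\<^sub>t\<^sup>0\<close> for \<open>t < 0\<close>.
\<close>

definition qou_process ::
    "'a measure \<Rightarrow> (real \<Rightarrow> 'a \<Rightarrow> real) \<Rightarrow> real \<Rightarrow> (real \<Rightarrow> 'a \<Rightarrow> real) \<Rightarrow> bool" where
  "qou_process M N lam X \<longleftrightarrow>
     measurable_process M X \<and> stationary_process M X \<and>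
     (\<forall>t. AE \<omega> in M.
        interval_lebesgue_integrable lborel (ereal 0) (ereal t) (\<lambda>s. X s \<omega>) \<and>
        X t \<omega> = X 0 \<omega> - lam * (LBINT s=ereal 0..ereal t. X s \<omega>) + N t \<omega>)"

definition covariance :: "'a measure \<Rightarrow> ('a \<Rightarrow> real) \<Rightarrow> ('a \<Rightarrow> real) \<Rightarrow> real" where
  "covariance M U V = (\<integral>\<omega>. (U \<omega> - (\<integral>x. U x \<partial>M)) * (V \<omega> - (\<integral>x. V x \<partial>M)) \<partial>M)"

definition autocov :: "'a measure \<Rightarrow> (real \<Rightarrow> 'a \<Rightarrow> real) \<Rightarrow> real \<Rightarrow> real" where
  "autocov M X t = covariance M (X t) (X 0)"

definition autocov_bar :: "'a measure \<Rightarrow> (real \<Rightarrow> 'a \<Rightarrow> real) \<Rightarrow> real \<Rightarrow> real" where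
  "autocov_bar M X t = autocov M X 0 - autocov M X t"

definition k_const :: "real \<Rightarrow> real" where
  "k_const \<alpha> = Gamma (1 + \<alpha>) * Gamma (- 1 - 2 * \<alpha>) / Gamma (- \<alpha>)"

definition j_const :: "real \<Rightarrow> real" where
  "j_const \<alpha> = (Gamma (\<alpha> + 1))\<^sup>2 /
     ((2 * \<alpha> + 1) * sin (pi * (\<alpha> + 1/2)) * Gamma (2 * \<alpha> + 1))"

end

theory Submission
  imports Defs "HOL-Real_Asymp.Real_Asymp"
begin

text \<open>
  Everything is second-order. The isometry gives \<open>Var (N t) = r\<^sub>0\<^sup>2 * V t\<close> with
  \<open>V t = \<integral> (f (t + x) - f x)\<^sup>2 dx\<close>, where \<open>f\<close> is the kernel for \<open>r\<^sub>0 = 1\<close>. Integrating the equation against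
  \<open>exp (lam * s)\<close> over \<open>(-T, 0)\<close> expresses \<open>X 0\<close> through \<open>N\<close> up to \<open>exp (- lam * T) * X (- T)\<close>, which
  tends to 0 in law by stationarity; so \<open>X\<close> is square integrable. Taking second moments in
  \<open>N t = X t - X 0 + lam * \<integral>\<^sub>0\<^sup>t X\<close>, the cross term vanishes by stationarity, and the autocovariance \<open>r\<close>
  satisfies

    \<open>r\<^sub>0\<^sup>2 * V t = 2 * (r 0 - r t) + 2 * lam\<^sup>2 * \<integral>\<^sub>0\<^sup>t (t - h) * r h dh\<close>.

  As the last term is \<open>O(t\<^sup>2)\<close>, the behaviour at 0 is that of \<open>V / 2\<close>. For \<open>H > 1/2\<close>, \<open>V / 2\<close> is a linear
  function plus \<open>\<integral>\<^sub>0\<^sup>t (t - h) * \<rho> h dh\<close> with \<open>\<rho> h\<close> asymptotic to a multiple of \<open>h powr (2 * H - 2)\<close>, so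
  \<open>r\<close> is a bounded solution of \<open>r'' = lam\<^sup>2 * r - r\<^sub>0\<^sup>2 * \<rho>\<close> and hence asymptotic to \<open>r\<^sub>0\<^sup>2 * \<rho> / lam\<^sup>2\<close>.
\<close>

section \<open>The power-law kernel\<close>

text \<open>\<open>X\<close> is never represented as a moving average, and its square integrability
  has to be extracted from the equation. The kernel is not square integrable either; its increments
  are, and this is read off from the existence of the integrals \<open>N t\<close>. Near 0 the size
  of \<open>V\<close> has two sources. For \<delta> = 0 the kernel is homogeneous, so
  \<open>V\<close> is an exact power and only \<open>V 1\<close> must be computed, which gives
  \<open>j_const\<close>. For \<delta> > 0 the kernel jumps at 0 by \<delta> powr (H - 1/2), and the
  squared jump is the slope of \<open>V\<close> at 0. For large times, \<rho> is the density of
  \<open>V''/2\<close> and has two parts: jump times slope of the kernel, and slope times slope. The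
  first decays like h powr (H - 3/2) and is negligible; the second is a truncated Beta integral
  whose complete value is \<open>k_const\<close>. So \<delta> drops out of the limit. \<rho> may be
  singular at 0, so the equation for \<open>r\<close> is used in integrated form and differentiated
  only away from 0. Its operator factors as (D - lam)(D + lam). Boundedness of \<open>r\<close>
  excludes exp (lam * t) and the other homogeneous solution decays, so no initial values are
  needed.\<close>

lemma Beta_half_line:
  fixes x y :: real
  assumes "x > 0" "y > 0"
  shows "set_integrable lborel {0<..} (\<lambda>s. s powr (x - 1) * (1 + s) powr (- x - y))" (is ?I)
    and "(LBINT s:{0<..}. s powr (x - 1) * (1 + s) powr (- x - y)) = Beta x y" (is ?E)
proof -
  define f where "f = (\<lambda>s::real. s powr (x - 1) * (1 + s) powr (- x - y))"
  \<comment> \<open>The substitution s = t / (1 - t) carries (0, 1) to the half-line, with 1 + s = 1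
    / (1 - t). The integrands are nonnegative, so the substitution rule yields integrability along
    with the value.\<close>
  define g where "g = (\<lambda>t::real. t / (1 - t))"
  define g' where "g' = (\<lambda>t::real. 1 / (1 - t)\<^sup>2)"
  define b where "b = (\<lambda>t::real. t powr (x - 1) * (1 - t) powr (y - 1))"
  have fg: "f (g t) * g' t = b t" if "0 < t" "t < 1" for t
  proof -
    have "1 + t / (1 - t) = 1 / (1 - t)" using that by (simp add: field_simps)
    then have "f (g t) * g' t = (t / (1 - t)) powr (x - 1) * (1 / (1 - t)) powr (- x - y) * (1 - t) powr (-2)"
      using that unfolding f_def g_def g'_def by (simp add: powr_minus divide_simps powr_numeral)
    also have "\<dots> = t powr (x - 1) * ((1 - t) powr (- (x - 1)) * (1 - t) powr (x + y) * (1 - t) powr (-2))"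
      using that by (simp add: powr_divide powr_minus_divide powr_diff powr_add divide_simps)
    also have "\<dots> = b t"
      unfolding b_def powr_add[symmetric] by (simp add: algebra_simps)
    finally show ?thesis .
  qed
  have bi: "set_integrable lborel {0<..<1} b" and bv: "(LBINT t:{0<..<1}. b t) = Beta x y"
  proof -
    have 1: "set_integrable lborel {0..1} b" unfolding b_def by (rule integrable_Beta[OF assms])
    show 2: "set_integrable lborel {0<..<1} b" by (rule set_integrable_subset[OF 1]) auto
    have "(b has_integral Beta x y) {0<..<1}" using has_integral_Beta_real[OF assms]
      unfolding b_def by (simp add: has_integral_Icc_iff_Ioo)
    then show "(LBINT t:{0<..<1}. b t) = Beta x y"
      using set_borel_integral_eq_integral(2)[OF 2] by (simp add: integral_unique)
  qed
  have e1: "einterval 0 1 = {0<..<1::real}" by (auto simp: einterval_def)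
  have e2: "einterval 0 \<infinity> = {0<..}" by (auto simp: einterval_def)
  have bi': "set_integrable lborel (einterval 0 1) (\<lambda>t. f (g t) * g' t)"
    using bi unfolding e1 by (subst set_integrable_cong[OF refl refl fg]) (auto simp: fg)
  have lim0: "((ereal \<circ> g \<circ> real_of_ereal) \<longlongrightarrow> 0) (at_right 0)"
  proof -
    have "(g \<longlongrightarrow> 0) (at_right 0)" unfolding g_def by real_asymp
    then have "((\<lambda>t. ereal (g t)) \<longlongrightarrow> ereal 0) (at_right 0)" by (rule tendsto_ereal)
    then show ?thesis unfolding zero_ereal_def
      by (subst at_right_ereal) (simp add: filterlim_filtermap comp_def)
  qed
  have lim1: "((ereal \<circ> g \<circ> real_of_ereal) \<longlongrightarrow> \<infinity>) (at_left 1)"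
  proof -
    have "filterlim g at_top (at_left 1)" unfolding g_def by real_asymp
    then have "((\<lambda>t. ereal (g t)) \<longlongrightarrow> \<infinity>) (at_left 1)" by (simp add: tendsto_PInfty_eq_at_top)
    then show ?thesis unfolding one_ereal_def
      by (subst at_left_ereal) (simp add: filterlim_filtermap comp_def)
  qed
  have der: "(g has_real_derivative g' t) (at t)" if "0 < ereal t" "ereal t < 1" for t
    unfolding g_def g'_def using that by (auto intro!: derivative_eq_intros simp: field_simps power2_eq_square)
  have pos: "0 < g t" if "0 < ereal t" "ereal t < 1" for t using that by (simp add: g_def)
  have c1: "isCont f (g t)" if "0 < ereal t" "ereal t < 1" for t
    using pos[OF that] unfolding f_def by (intro continuous_intros) auto
  have c2: "isCont g' t" if "0 < ereal t" "ereal t < 1" for t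
    using that unfolding g'_def by (intro continuous_intros) auto
  have nn: "0 \<le> f s" for s by (simp add: f_def)
  have nn': "0 \<le> g' s" for s by (simp add: g'_def)
  note S = interval_integral_substitution_nonneg[where f=f and g=g and g'=g', OF _ der c1 c2 nn nn' lim0 lim1 bi']
  show ?I using S(1) unfolding e2 f_def by simp
  have "(LBINT s:{0<..}. f s) = (LBINT t:{0<..<1}. f (g t) * g' t)"
    using S(2) by (simp add: interval_lebesgue_integral_def e1 e2)
  also have "\<dots> = (LBINT t:{0<..<1}. b t)" by (rule set_lebesgue_integral_cong) (auto simp: fg)
  finally show ?E using bv unfolding f_def by simp
qed

lemma Gamma_reflection_real:
  fixes z :: real
  shows "Gamma z * Gamma (1 - z) = pi / sin (pi * z)"
proof -
  have "Gamma (complex_of_real z) * Gamma (complex_of_real (1 - z)) = of_real pi / sin (of_real (pi * z))"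
    unfolding of_real_diff of_real_1 of_real_mult by (rule Gamma_reflection_complex)
  then have "complex_of_real (Gamma z * Gamma (1 - z)) = of_real (pi / sin (pi * z))"
    by (simp only: Gamma_complex_of_real sin_of_real[symmetric] of_real_mult of_real_divide)
  then show ?thesis unfolding of_real_eq_iff .
qed

text \<open>By the isometry this is the variance at time \<open>t\<close> of the moving average with
  kernel \<open>f\<close>. It asks for square integrability of the increments of \<open>f\<close>,
  not of \<open>f\<close>.\<close>

definition incr_var :: "(real \<Rightarrow> real) \<Rightarrow> real \<Rightarrow> real" where
  "incr_var f t = (\<integral>x. (f (t + x) - f x)\<^sup>2 \<partial>lborel)"

lemma powr_double: "u powr (2 * b) = (u powr b)\<^sup>2" for u b :: real
  by (metis mult_2 powr_add power2_eq_square)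

text \<open>The terms of orders 2a+1 and 2a in \<open>s\<close> cancel, and what is left has order
  2a-1 < 0. To exhibit this, \<open>s powr (2*a-1)\<close> is factored out; the cofactor is built
  from quotients \<open>s * ((1 + 1/s) powr b - 1)\<close>, which converge to the derivative
  \<open>b\<close> of \<open>u powr b\<close> at 1.\<close>

lemma powr_primitive_limit:
  fixes a :: real
  assumes "a < 1/2"
  shows "((\<lambda>s. (1 + s) powr (2*a+1) + s powr (2*a+1) - 2 * s powr (a+1) * (1 + s) powr a
            - s powr (a+1) * (1 + s) powr (a-1)) \<longlongrightarrow> 0) at_top"
proof -
  have der: "((\<lambda>s::real. s * ((1 + 1/s) powr b - 1)) \<longlongrightarrow> b) at_top" for b :: real
  proof -
    have "((\<lambda>u. u powr b) has_real_derivative b * 1 powr (b-1)) (at (1::real))"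
      by (rule has_real_derivative_powr) simp
    then have "((\<lambda>h. ((1 + h) powr b - 1) / h) \<longlongrightarrow> b) (at 0)" by (simp add: DERIV_def)
    moreover have "filterlim (\<lambda>s::real. 1/s) (at 0) at_top" by real_asymp
    ultimately have "((\<lambda>s. ((1 + 1/s) powr b - 1) / (1/s)) \<longlongrightarrow> b) at_top"
      by (rule filterlim_compose)
    then show ?thesis by (simp add: mult.commute)
  qed
  have "((\<lambda>s. s powr (2*a-1) * (s * ((1 + 1/s) powr a - 1))\<^sup>2 +
           s powr (2*a-1) * (s * ((1 + 1/s) powr (2*a) - 1) - s * ((1 + 1/s) powr (a-1) - 1)))
          \<longlongrightarrow> 0 * a\<^sup>2 + 0 * (2*a - (a-1))) at_top"
  proof -
    have z: "((\<lambda>s. s powr (2*a-1)) \<longlongrightarrow> 0) at_top"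
      using assms by (intro tendsto_neg_powr filterlim_ident) auto
    show ?thesis
      by (rule tendsto_add[OF tendsto_mult[OF z tendsto_power[OF der]] tendsto_mult[OF z tendsto_diff[OF der der]]])
  qed
  then have "((\<lambda>s. s powr (2*a-1) * (s * ((1 + 1/s) powr a - 1))\<^sup>2 +
           s powr (2*a-1) * (s * ((1 + 1/s) powr (2*a) - 1) - s * ((1 + 1/s) powr (a-1) - 1)))
          \<longlongrightarrow> 0) at_top" by simp
  moreover have "\<forall>\<^sub>F s in at_top. s powr (2*a-1) * (s * ((1 + 1/s) powr a - 1))\<^sup>2 +
           s powr (2*a-1) * (s * ((1 + 1/s) powr (2*a) - 1) - s * ((1 + 1/s) powr (a-1) - 1))
        = (1 + s) powr (2*a+1) + s powr (2*a+1) - 2 * s powr (a+1) * (1 + s) powr a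
            - s powr (a+1) * (1 + s) powr (a-1)"
    using eventually_gt_at_top[of 0]
  proof eventually_elim
    case (elim s)
    define P Q where "P = s powr a" and "Q = (1+s) powr a"
    have 1: "(1 + 1/s) powr b = (1+s) powr b / s powr b" for b
    proof -
      have "1 + 1/s = (1+s)/s" using elim by (simp add: field_simps)
      then show ?thesis using elim by (simp add: powr_divide)
    qed
    have P: "s powr (2*a) = P\<^sup>2" "s powr (a+1) = P * s" "s powr (a-1) = P/s" "s powr (2*a+1) = P\<^sup>2 * s"
         "s powr (2*a-1) = P\<^sup>2/s"
      unfolding P_def using elim by (auto simp: powr_add powr_diff powr_double)
    have Q: "(1+s) powr (2*a) = Q\<^sup>2" "(1+s) powr (a-1) = Q/(1+s)" "(1+s) powr (2*a+1) = Q\<^sup>2 * (1+s)"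
      unfolding Q_def using elim by (auto simp: powr_add powr_diff powr_double)
    have "P > 0" "Q > 0" using elim by (auto simp: P_def Q_def)
    have a1: "P\<^sup>2/s * (s * (Q/P - 1))\<^sup>2 = s * (Q - P)\<^sup>2"
    proof -
      have "s * (Q/P - 1) = s/P * (Q - P)" using \<open>P > 0\<close> by (simp add: field_simps)
      then have "P\<^sup>2/s * (s * (Q/P - 1))\<^sup>2 = (P\<^sup>2/s * (s/P)\<^sup>2) * (Q - P)\<^sup>2" by (simp only: power_mult_distrib mult.assoc)
      also have "P\<^sup>2/s * (s/P)\<^sup>2 = s" using \<open>P > 0\<close> elim by (simp add: power2_eq_square)
      finally show ?thesis .
    qed
    have a2: "P\<^sup>2/s * (s * (Q\<^sup>2/P\<^sup>2 - 1) - s * (Q/(1+s)/(P/s) - 1)) = Q\<^sup>2 - Q/(1+s) * (P * s)"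
    proof -
      have "P\<^sup>2/s * (s * (Q\<^sup>2/P\<^sup>2 - 1) - s * (R/(P/s) - 1)) = Q\<^sup>2 - R * (P * s)" for R
        using \<open>P > 0\<close> elim by (simp add: right_diff_distrib power2_eq_square)
      then show ?thesis .
    qed
    show ?case
      unfolding 1 P Q P_def[symmetric] Q_def[symmetric] a1 a2
      by (simp add: algebra_simps power2_eq_square)
  qed
  ultimately show ?thesis by (rule Lim_transform_eventually)
qed

text \<open>
  Two integrations by parts turn \<open>s powr a * (1 + s) powr a\<close> into \<open>s powr a * (1 + s) powr (a - 2)\<close>,
  which is integrable on the half-line for every \<open>a\<close> between \<open>-1/2\<close> and \<open>1/2\<close>.
\<close>

lemma powr_primitive_deriv:
  fixes a s :: real
  assumes "2*a+1 > 0" "s > 0"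
  shows "((\<lambda>s. ((1 + s) powr (2*a+1) + s powr (2*a+1) - 2 * s powr (a+1) * (1 + s) powr a
            - s powr (a+1) * (1 + s) powr (a-1)) / (2*a+1)) has_real_derivative
          ((1 + s) powr a - s powr a)\<^sup>2 - (1-a)/(2*a+1) * (s powr a * (1 + s) powr (a-2))) (at s)"
proof -
  define P Q where "P = s powr a" and "Q = (1+s) powr a"
  have P: "s powr (2*a) = P\<^sup>2" "s powr (a+1) = P * s" "s powr (2*a+1) = P\<^sup>2 * s" "s powr a = P"
    unfolding P_def using assms(2) by (simp_all add: powr_add powr_double)
  have Q: "(1+s) powr (2*a) = Q\<^sup>2" "(1+s) powr (a-1) = Q/(1+s)" "(1+s) powr (a-2) = Q/(1+s)^2"
        "(1+s) powr (2*a+1) = Q\<^sup>2 * (1+s)" "(1+s) powr a = Q"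
    unfolding Q_def using assms(2) by (simp_all add: powr_add powr_diff powr_double)
  have d0: "((\<lambda>s. s powr b) has_real_derivative b * s powr (b-1)) (at s)" for b
    using assms by (auto intro!: derivative_eq_intros)
  have d1: "((\<lambda>s. (1+s) powr b) has_real_derivative b * (1+s) powr (b-1)) (at s)" for b
    using assms by (auto intro!: derivative_eq_intros)
  have "((\<lambda>s. ((1 + s) powr (2*a+1) + s powr (2*a+1) - 2 * s powr (a+1) * (1 + s) powr a
            - s powr (a+1) * (1 + s) powr (a-1)) / (2*a+1)) has_real_derivative
      ((2*a+1) * (1+s) powr (2*a+1-1) + (2*a+1) * s powr (2*a+1-1)
        - (2 * ((a+1) * s powr (a+1-1)) * (1+s) powr a + a * (1+s) powr (a-1) * (2 * s powr (a+1)))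
        - ((a+1) * s powr (a+1-1) * (1+s) powr (a-1) + (a-1) * (1+s) powr (a-1-1) * s powr (a+1))) / (2*a+1)) (at s)"
    by (rule DERIV_cdivide DERIV_diff DERIV_add DERIV_mult DERIV_cmult d0 d1)+
  note D = this
  have e: "2*a+1-1 = 2*a" "a+1-1 = a" "a-1-1 = a-2" by auto
  have alg: "((2*a+1) * Q\<^sup>2 + (2*a+1) * P\<^sup>2 - (2 * ((a+1) * P) * Q + a * (Q/(1+s)) * (2 * (P * s)))
       - ((a+1) * P * (Q/(1+s)) + (a-1) * (Q/(1+s)^2) * (P * s))) / (2*a+1)
      = (Q - P)\<^sup>2 - (1-a)/(2*a+1) * (P * (Q/(1+s)^2))"
  proof -
    \<comment> \<open>Pulling the negative powers of 1 + s into \<open>W\<close> makes the identity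
      polynomial in \<open>P\<close>, \<open>W\<close> and \<open>s\<close>.\<close>
    define W where "W = Q / (1+s)^2"
    have W: "Q = W * (1+s)^2" "Q / (1+s) = W * (1+s)" using assms by (auto simp: W_def power2_eq_square)
    have "(2*a+1) * Q\<^sup>2 + (2*a+1) * P\<^sup>2 - (2 * ((a+1) * P) * Q + a * (Q/(1+s)) * (2 * (P * s)))
       - ((a+1) * P * (Q/(1+s)) + (a-1) * W * (P * s)) =
        (2*a+1) * (Q - P)\<^sup>2 - (1-a) * (P * W)"
      unfolding W(2) unfolding W(1) by (simp add: power2_eq_square) (simp add: algebra_simps)
    then have "((2*a+1) * Q\<^sup>2 + (2*a+1) * P\<^sup>2 - (2 * ((a+1) * P) * Q + a * (Q/(1+s)) * (2 * (P * s)))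
       - ((a+1) * P * (Q/(1+s)) + (a-1) * W * (P * s))) / (2*a+1) =
        ((2*a+1) * (Q - P)\<^sup>2 - (1-a) * (P * W)) / (2*a+1)" by (simp only:)
    also have "\<dots> = (Q - P)\<^sup>2 - (1-a)/(2*a+1) * (P * W)"
      using assms by (subst diff_divide_distrib) simp
    finally show ?thesis unfolding W_def .
  qed
  show ?thesis
    using D unfolding e P Q alg .
qed

text \<open>On (-1, 0) only \<open>f (1 + x)\<close> survives and contributes 1 / (2a+1). On (0, T)
  the primitive \<open>F\<close> of \<open>powr_primitive_deriv\<close> applies, and
  \<open>F 0\<close> cancels exactly that contribution. As \<open>F T\<close> tends to 0, a multiple
  of a Beta integral remains.\<close>

lemma incr_var_pos_power:
  fixes a :: real
  defines "f \<equiv> \<lambda>x. if 0 \<le> x then x powr a else 0"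
  assumes a: "-1/2 < a" "a < 1/2"
    and int: "integrable lborel (\<lambda>x. (f (1 + x) - f x)\<^sup>2)"
  shows "incr_var f 1 = Gamma (1 + a) * Gamma (1 - 2*a) / ((2*a+1) * Gamma (1 - a))"
proof -
  let ?D = "\<lambda>x. (f (1 + x) - f x)\<^sup>2"
  define F where "F = (\<lambda>s. ((1 + s) powr (2*a+1) + s powr (2*a+1) - 2 * s powr (a+1) * (1 + s) powr a
            - s powr (a+1) * (1 + s) powr (a-1)) / (2*a+1))"
  define c where "c = (1-a)/(2*a+1)"
  define b where "b = (\<lambda>s::real. s powr a * (1 + s) powr (a-2))"
  have bi: "set_integrable lborel {0<..} b" and bv: "(LBINT s:{0<..}. b s) = Beta (a+1) (1-2*a)"
    using Beta_half_line[of "a+1" "1-2*a"] a by (simp_all add: b_def)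
  have bi': "integrable lborel (\<lambda>s. indicator {0<..} s * b s)"
    using bi by (simp add: set_integrable_def)
  have fin: "(LBINT x. indicator {..T} x *\<^sub>R ?D x) = F T + c * (LBINT x. indicator {..T} x *\<^sub>R (indicator {0<..} x * b x))"
    if T: "T > 0" for T
  proof -
    have D1: "(?D has_integral 1 / (2*a+1)) {-1..0}"
    proof -
      have "((\<lambda>x. (1 + x) powr (2*a)) has_integral ((1 + 0) powr (2*a+1) / (2*a+1) - (1 + (-1)) powr (2*a+1) / (2*a+1))) {-1..0}"
      proof (rule fundamental_theorem_of_calculus_interior)
        show "continuous_on {-1..0} (\<lambda>x. (1 + x) powr (2*a+1) / (2*a+1))"
          using a by (intro continuous_intros continuous_on_powr') auto
        fix x :: real assume x: "x \<in> {-1<..<0}"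
        have "((\<lambda>x. (1 + x) powr (2*a+1) / (2*a+1)) has_real_derivative (1 + x) powr (2*a)) (at x)"
          using x a by (auto intro!: derivative_eq_intros)
        then show "((\<lambda>x. (1 + x) powr (2*a+1) / (2*a+1)) has_vector_derivative (1 + x) powr (2*a)) (at x)"
          by (simp add: has_real_derivative_iff_has_vector_derivative)
      qed auto
      then have "((\<lambda>x. (1 + x) powr (2*a)) has_integral 1 / (2*a+1)) {-1..0}" by simp
      moreover have "?D x = (1 + x) powr (2*a)" if "x \<in> {-1..0}" for x
        using that by (auto simp: f_def powr_double)
      ultimately show ?thesis by (subst has_integral_cong) auto
    qed
    have D2: "((\<lambda>x. ?D x - c * b x) has_integral F T - F 0) {0..T}"
    proof (rule fundamental_theorem_of_calculus_interior)
      have k0: "continuous_on {0..T} (\<lambda>s. s powr e)" if "e > 0" for e :: real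
        using that by (intro continuous_on_powr' continuous_intros) auto
      have k1: "continuous_on {0..T} (\<lambda>s. (1 + s) powr e)" for e :: real
        by (intro continuous_on_powr continuous_intros) auto
      show "continuous_on {0..T} F" unfolding F_def using a
        by (intro continuous_on_divide continuous_on_diff continuous_on_add continuous_on_mult
              continuous_on_const k0 k1) auto
      fix x assume x: "x \<in> {0<..<T}"
      have eq: "?D x - c * b x = ((1 + x) powr a - x powr a)\<^sup>2 - (1-a)/(2*a+1) * (x powr a * (1 + x) powr (a-2))"
        using x by (auto simp: f_def c_def b_def)
      have "(F has_real_derivative ?D x - c * b x) (at x)"
        unfolding eq F_def by (rule powr_primitive_deriv) (use a x in auto)
      then show "(F has_vector_derivative ?D x - c * b x) (at x)"
        by (simp only: has_real_derivative_iff_has_vector_derivative)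
    qed (use T in auto)
    have si: "set_integrable lborel {0<..T} b"
      by (rule set_integrable_subset[OF bi]) auto
    have B: "(b has_integral (LBINT x:{0<..T}. b x)) {0..T}"
    proof -
      have "(b has_integral (LBINT x:{0<..T}. b x)) {0<..T}"
        using set_borel_integral_eq_integral[OF si] by (simp add: has_integral_integrable_integral)
      then show ?thesis
        by (rule has_integral_spike_set_eq[THEN iffD1, rotated 2])
           (auto intro: negligible_subset[of "{0}"] negligible_subset[of "{}"])
    qed
    have F0: "F 0 = 1 / (2*a+1)" using a by (simp add: F_def)
    have "(?D has_integral F T - F 0 + c * (LBINT x:{0<..T}. b x)) {0..T}"
      using has_integral_add[OF D2 has_integral_mult_right[OF B, of c]] by simp
    from has_integral_combine[OF _ _ D1 this] T
    have H: "(?D has_integral F T + c * (LBINT x:{0<..T}. b x)) {-1..T}" by (simp add: F0)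
    have si2: "set_integrable lborel {-1..T} ?D"
      using integrable_mult_indicator[OF _ int, of "{-1..T}"] by (simp add: set_integrable_def)
    have "(LBINT x. indicator {..T} x *\<^sub>R ?D x) = (LBINT x:{-1..T}. ?D x)"
      unfolding set_lebesgue_integral_def
      by (intro Bochner_Integration.integral_cong) (auto simp: indicator_def f_def)
    also have "\<dots> = F T + c * (LBINT x:{0<..T}. b x)"
      using set_borel_integral_eq_integral(2)[OF si2] H by (simp add: integral_unique)
    also have "(LBINT x:{0<..T}. b x) = (LBINT x. indicator {..T} x *\<^sub>R (indicator {0<..} x * b x))"
      unfolding set_lebesgue_integral_def
      by (intro Bochner_Integration.integral_cong) (auto simp: indicator_def)
    finally show ?thesis .
  qed
  have "(F \<longlongrightarrow> 0) at_top"
    unfolding F_def using tendsto_divide[OF powr_primitive_limit[of a] tendsto_const[of "2*a+1"]] a by simp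
  moreover have "((\<lambda>T. LBINT x. indicator {..T} x *\<^sub>R (indicator {0<..} x * b x)) \<longlongrightarrow> (LBINT x. indicator {0<..} x * b x)) at_top"
    by (rule tendsto_integral_at_top) (use bi' in auto)
  ultimately have "((\<lambda>T. F T + c * (LBINT x. indicator {..T} x *\<^sub>R (indicator {0<..} x * b x))) \<longlongrightarrow>
      0 + c * (LBINT x. indicator {0<..} x * b x)) at_top"
    by (intro tendsto_intros)
  then have "((\<lambda>T. LBINT x. indicator {..T} x *\<^sub>R ?D x) \<longlongrightarrow> 0 + c * (LBINT x. indicator {0<..} x * b x)) at_top"
    by (rule Lim_transform_eventually) (rule eventually_mono[OF eventually_gt_at_top[of 0] fin[symmetric]])
  moreover have "((\<lambda>T. LBINT x. indicator {..T} x *\<^sub>R ?D x) \<longlongrightarrow> (LBINT x. ?D x)) at_top"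
    by (rule tendsto_integral_at_top) (use int in auto)
  ultimately have "0 + c * (LBINT x. indicator {0<..} x * b x) = (LBINT x. ?D x)"
    by (rule tendsto_unique[OF trivial_limit_at_top_linorder])
  then have "(LBINT x. ?D x) = c * (LBINT x. indicator {0<..} x * b x)" by simp
  also have "(LBINT x. indicator {0<..} x * b x) = Beta (a+1) (1-2*a)"
    using bv by (simp add: set_lebesgue_integral_def)
  \<comment> \<open>The factor 1 - a of \<open>c\<close> is absorbed by Gamma (2 - a) = (1 - a) *
    Gamma (1 - a).\<close>
  also have "c * Beta (a+1) (1-2*a) = Gamma (1 + a) * Gamma (1 - 2*a) / ((2*a+1) * Gamma (1 - a))"
  proof -
    have pos: "0 < 1 - a" using a by simp
    then have "1 - a \<notin> \<int>\<^sub>\<le>\<^sub>0" by (auto elim!: nonpos_Ints_cases)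
    from Gamma_plus1[OF this] have G: "Gamma (2 - a) = (1 - a) * Gamma (1 - a)"
      by (simp add: add.commute)
    have e: "a + 1 + (1 - 2*a) = 2 - a" by simp
    have "u / v * (x * y / (u * z)) = x * y / (v * z)" if "u \<noteq> 0" for u v x y z :: real
      using that by simp
    from this[of "1-a" "2*a+1" "Gamma (1+a)" "Gamma (1-2*a)" "Gamma (1-a)"] pos
    show ?thesis unfolding Beta_def c_def e G by (simp only: add.commute less_imp_neq[symmetric] simp_thms)
  qed
  finally show ?thesis unfolding incr_var_def .
qed

text \<open>The sine in \<open>j_const\<close> is cos (pi * a). The reflection formula at
  \<open>a\<close> and at \<open>2 * a\<close>, combined with the double angle formula, gives Gamma
  (1 + 2a) * Gamma (1 - 2a) * cos (pi * a) = Gamma (1 + a) * Gamma (1 - a). The case a = 0 is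
  separate because sin (pi * a) is divided out.\<close>

lemma j_const_altdef:
  fixes a :: real
  assumes a: "-1/2 < a" "a < 1/2"
  shows "j_const a = Gamma (1 + a) * Gamma (1 - 2*a) / ((2*a+1) * Gamma (1 - a))"
proof (cases "a = 0")
  case True then show ?thesis by (simp add: j_const_def)
next
  case False
  have g: "Gamma x > 0" if "x > 0" for x :: real using that by (rule Gamma_real_pos)
  have s1: "sin (pi * a) \<noteq> 0"
  proof
    assume "sin (pi * a) = 0"
    then obtain i :: int where "pi * a = of_int i * pi" by (auto simp: sin_zero_iff_int2)
    then have "a = of_int i" by simp
    then show False using a False by (cases "i = 0") linarith+
  qed
  have c1: "cos (pi * a) > 0"
    using mult_strict_left_mono[OF a(1) pi_gt_zero] mult_strict_left_mono[OF a(2) pi_gt_zero]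
    by (intro cos_gt_zero_pi) auto
  have r: "Gamma (1 + z) * Gamma (1 - z) * sin (pi * z) = pi * z" if z: "z \<noteq> 0" "\<bar>z\<bar> < 1" "sin (pi * z) \<noteq> 0" for z
  proof -
    have "z \<notin> \<int>\<^sub>\<le>\<^sub>0" using z by (auto elim!: nonpos_Ints_cases)
    then have "Gamma (1 + z) = z * Gamma z" using Gamma_plus1[of z] by (simp add: add.commute)
    then have "Gamma (1 + z) * Gamma (1 - z) * sin (pi * z) = z * (Gamma z * Gamma (1 - z)) * sin (pi * z)" by simp
    also have "\<dots> = pi * z" unfolding Gamma_reflection_real using z by simp
    finally show ?thesis .
  qed
  have sd: "sin (pi * (2*a)) = 2 * sin (pi * a) * cos (pi * a)"
    using sin_double[of "pi*a"] by (simp only: mult.left_commute)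
  have "Gamma (1 + 2*a) * Gamma (1 - 2*a) * (2 * sin (pi * a) * cos (pi * a)) = pi * (2*a)"
    unfolding sd[symmetric] by (rule r) (use a False s1 c1 in \<open>auto simp: sd\<close>)
  also have "\<dots> = 2 * (Gamma (1 + a) * Gamma (1 - a) * sin (pi * a))"
    using r[of a] a False s1 by simp
  finally have "(2 * sin (pi * a)) * (Gamma (1 + 2*a) * Gamma (1 - 2*a) * cos (pi * a))
      = (2 * sin (pi * a)) * (Gamma (1 + a) * Gamma (1 - a))" by (simp only: mult_ac)
  then have eq: "Gamma (1 + 2*a) * Gamma (1 - 2*a) * cos (pi * a) = Gamma (1 + a) * Gamma (1 - a)"
    using s1 by simp
  have s2: "sin (pi * (a + 1/2)) = cos (pi * a)"
    using sin_add[of "pi*a" "pi/2"] by (simp add: algebra_simps)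
  have "j_const a = Gamma (1 + a) * (Gamma (1 + a) * Gamma (1 - a)) / ((2*a+1) * cos (pi*a) * Gamma (1 + 2*a) * Gamma (1 - a))"
  proof -
    have "0 < 1 - a" using a by simp
    from g[OF this] have "Gamma (1 - a) \<noteq> 0" by simp
    then show ?thesis by (simp add: j_const_def s2 power2_eq_square add.commute)
  qed
  also have "\<dots> = Gamma (1 + a) * Gamma (1 - 2*a) / ((2*a+1) * Gamma (1 - a))"
  proof -
    have X: "P * (G * U * C) / (T * C * G * V) = P * U / (T * V)" if "G \<noteq> 0" "C \<noteq> 0" for P G U C T V :: real
      using that by simp
    have "0 < 1 + 2 * a" using a by simp
    from g[OF this] c1 show ?thesis unfolding eq[symmetric] by (intro X) auto
  qed
  finally show ?thesis .
qed

lemma j_const_pos: "-1/2 < a \<Longrightarrow> a < 1/2 \<Longrightarrow> j_const a > 0"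
  unfolding j_const_altdef by (intro divide_pos_pos mult_pos_pos Gamma_real_pos) auto

section \<open>The isometry of the integral\<close>

definition sq_integrable :: "'a measure \<Rightarrow> ('a \<Rightarrow> real) \<Rightarrow> bool" where
  "sq_integrable M f \<longleftrightarrow> f \<in> borel_measurable M \<and> integrable M (\<lambda>x. (f x)\<^sup>2)"

lemma sq_integrable_square: "sq_integrable M f \<Longrightarrow> integrable M (\<lambda>x. (f x)\<^sup>2)"
  by (simp add: sq_integrable_def)

lemma sq_integrable_cong:
  "(\<And>x. x \<in> space M \<Longrightarrow> f x = g x) \<Longrightarrow> sq_integrable M f \<longleftrightarrow> sq_integrable M g"
  unfolding sq_integrable_def
  by (intro conj_cong measurable_cong Bochner_Integration.integrable_cong) auto

lemma sq_integrable_mult: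
  assumes "sq_integrable M f" "sq_integrable M g"
  shows "integrable M (\<lambda>x. f x * g x)"
proof (rule Bochner_Integration.integrable_bound)
  show "integrable M (\<lambda>x. (f x)\<^sup>2 + (g x)\<^sup>2)"
    using assms by (auto simp: sq_integrable_def)
  show "(\<lambda>x. f x * g x) \<in> borel_measurable M"
    using assms by (auto simp: sq_integrable_def)
  have "\<bar>u * v\<bar> \<le> u\<^sup>2 + v\<^sup>2" for u v :: real
  proof -
    have "2 * (\<bar>u\<bar> * \<bar>v\<bar>) \<le> u\<^sup>2 + v\<^sup>2" using sum_squares_bound[of "\<bar>u\<bar>" "\<bar>v\<bar>"] by (simp add: mult.assoc)
    moreover have "0 \<le> \<bar>u\<bar> * \<bar>v\<bar>" by simp
    ultimately show ?thesis unfolding abs_mult by linarith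
  qed
  then show "AE x in M. norm (f x * g x) \<le> norm ((f x)\<^sup>2 + (g x)\<^sup>2)"
    by simp
qed

lemma sq_integrable_cmult:
  assumes "sq_integrable M f" shows "sq_integrable M (\<lambda>x. c * f x)"
  using assms by (auto simp: sq_integrable_def power_mult_distrib)

lemma sq_integrable_add:
  assumes "sq_integrable M f" "sq_integrable M g"
  shows "sq_integrable M (\<lambda>x. f x + g x)"
  using assms sq_integrable_mult[OF assms]
  by (auto simp: sq_integrable_def power2_sum mult.assoc)

lemma sq_integrable_diff:
  assumes "sq_integrable M f" "sq_integrable M g"
  shows "sq_integrable M (\<lambda>x. f x - g x)"
  using sq_integrable_add[OF assms(1) sq_integrable_cmult[OF assms(2), of "-1"]] by simp

lemma sq_integrable_zero: "sq_integrable M (\<lambda>x. 0)"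
  by (simp add: sq_integrable_def)

lemma Cauchy_Schwarz_integral:
  assumes f: "sq_integrable M f" and g: "sq_integrable M g"
  shows "(\<integral>x. f x * g x \<partial>M)\<^sup>2 \<le> (\<integral>x. (f x)\<^sup>2 \<partial>M) * (\<integral>x. (g x)\<^sup>2 \<partial>M)"
proof -
  let ?A = "\<integral>x. (f x)\<^sup>2 \<partial>M" and ?B = "\<integral>x. (g x)\<^sup>2 \<partial>M" and ?C = "\<integral>x. f x * g x \<partial>M"
  have q: "0 \<le> t\<^sup>2 * ?A + 2 * t * ?C + ?B" for t
  proof -
    have "0 \<le> (\<integral>x. (t * f x + g x)\<^sup>2 \<partial>M)" by simp
    also have "\<dots> = (\<integral>x. t\<^sup>2 * (f x)\<^sup>2 + 2 * t * (f x * g x) + (g x)\<^sup>2 \<partial>M)"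
      by (rule Bochner_Integration.integral_cong) (auto simp: power2_sum power_mult_distrib)
    also have "\<dots> = t\<^sup>2 * ?A + 2 * t * ?C + ?B"
      using sq_integrable_mult[OF f g] sq_integrable_square[OF f] sq_integrable_square[OF g] by simp
    finally show ?thesis .
  qed
  show ?thesis
  proof (cases "?A = 0")
    case True
    then have "AE x in M. (f x)\<^sup>2 = 0"
      using integral_nonneg_eq_0_iff_AE[OF sq_integrable_square[OF f]] by simp
    then have "AE x in M. f x * g x = 0" by eventually_elim simp
    then have "?C = 0" by (rule integral_eq_zero_AE)
    then show ?thesis by simp
  next
    case False
    then have A: "?A > 0" by (simp add: order_less_le)
    have "0 \<le> ?A * ((- ?C / ?A)\<^sup>2 * ?A + 2 * (- ?C / ?A) * ?C + ?B)"
      using q[of "- ?C / ?A"] A by simp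
    also have "\<dots> = ?A * ?B - ?C\<^sup>2" using A by (simp add: field_simps power2_eq_square)
    finally show ?thesis by simp
  qed
qed

lemma L2_limit_inner:
  assumes f: "\<And>n. sq_integrable M (f n)" "sq_integrable M F" and g: "sq_integrable M G"
    and lim: "(\<lambda>n. \<integral>x. (f n x - F x)\<^sup>2 \<partial>M) \<longlonglongrightarrow> 0"
  shows "(\<lambda>n. \<integral>x. f n x * G x \<partial>M) \<longlonglongrightarrow> (\<integral>x. F x * G x \<partial>M)"
proof -
  have "(\<lambda>n. (\<integral>x. (f n x - F x) * G x \<partial>M)\<^sup>2) \<longlonglongrightarrow> 0"
  proof (rule tendsto_sandwich[OF _ _ tendsto_const])
    show "(\<lambda>n. (\<integral>x. (f n x - F x)\<^sup>2 \<partial>M) * (\<integral>x. (G x)\<^sup>2 \<partial>M)) \<longlonglongrightarrow> 0"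
      using tendsto_mult[OF lim tendsto_const] by simp
    show "\<forall>\<^sub>F n in sequentially. (\<integral>x. (f n x - F x) * G x \<partial>M)\<^sup>2 \<le>
        (\<integral>x. (f n x - F x)\<^sup>2 \<partial>M) * (\<integral>x. (G x)\<^sup>2 \<partial>M)"
      by (intro always_eventually allI Cauchy_Schwarz_integral sq_integrable_diff f g)
  qed simp
  then have "(\<lambda>n. \<integral>x. (f n x - F x) * G x \<partial>M) \<longlonglongrightarrow> 0" by simp
  moreover have "(\<integral>x. (f n x - F x) * G x \<partial>M) = (\<integral>x. f n x * G x \<partial>M) - (\<integral>x. F x * G x \<partial>M)" for n
    using sq_integrable_mult[OF f(1) g] sq_integrable_mult[OF f(2) g]
    by (simp add: left_diff_distrib)
  ultimately show ?thesis using Lim_null[of "\<lambda>n. \<integral>x. f n x * G x \<partial>M"] by simp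
qed

lemma L2_limit_norm:
  assumes f: "\<And>n. sq_integrable M (f n)" "sq_integrable M F"
    and lim: "(\<lambda>n. \<integral>x. (f n x - F x)\<^sup>2 \<partial>M) \<longlonglongrightarrow> 0"
  shows "(\<lambda>n. \<integral>x. (f n x)\<^sup>2 \<partial>M) \<longlonglongrightarrow> (\<integral>x. (F x)\<^sup>2 \<partial>M)"
proof -
  have e: "(\<integral>x. (f n x)\<^sup>2 \<partial>M) = (\<integral>x. (f n x - F x)\<^sup>2 \<partial>M) + 2 * (\<integral>x. f n x * F x \<partial>M) - (\<integral>x. F x * F x \<partial>M)" for n
  proof -
    have "(\<integral>x. (f n x)\<^sup>2 \<partial>M) = (\<integral>x. (f n x - F x)\<^sup>2 + 2 * (f n x * F x) - F x * F x \<partial>M)"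
      by (rule Bochner_Integration.integral_cong) (auto simp: power2_eq_square algebra_simps)
    also have "\<dots> = (\<integral>x. (f n x - F x)\<^sup>2 \<partial>M) + 2 * (\<integral>x. f n x * F x \<partial>M) - (\<integral>x. F x * F x \<partial>M)"
      using sq_integrable_square[OF sq_integrable_diff[OF f(1) f(2)]] sq_integrable_mult[OF f(1) f(2)]
        sq_integrable_mult[OF f(2) f(2)] by simp
    finally show ?thesis .
  qed
  have "(\<lambda>n. (\<integral>x. (f n x - F x)\<^sup>2 \<partial>M) + 2 * (\<integral>x. f n x * F x \<partial>M) - (\<integral>x. F x * F x \<partial>M)) \<longlonglongrightarrow>
      0 + 2 * (\<integral>x. F x * F x \<partial>M) - (\<integral>x. F x * F x \<partial>M)"
    by (intro tendsto_intros lim L2_limit_inner[OF f f(2) lim])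
  then show ?thesis unfolding e by (simp add: power2_eq_square)
qed

section \<open>The isometry on step functions\<close>

lemma step_fun_Cons: "step_fun ((a, u, v) # c) = (\<lambda>s. a * indicator {u<..v} s + step_fun c s)"
  by (auto simp: step_fun_def)

lemma step_integral_Cons: "step_integral Z ((a, u, v) # c) = (\<lambda>\<omega>. a * (Z v \<omega> - Z u \<omega>) + step_integral Z c \<omega>)"
  by (auto simp: step_integral_def)

lemma sq_integrable_indicator: "sq_integrable lborel (\<lambda>s. indicator {u<..v::real} s)"
proof -
  have "(\<lambda>s. (indicator {u<..v} s)\<^sup>2) = (\<lambda>s::real. indicator {u<..v} s :: real)"
    by (auto simp: indicator_def)
  then show ?thesis by (cases "u \<le> v") (auto simp: sq_integrable_def)
qed

lemma sq_integrable_step_fun: "sq_integrable lborel (step_fun c)"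
proof (induction c)
  case Nil then show ?case by (simp add: step_fun_def[abs_def] sq_integrable_zero)
next
  case (Cons x c) then show ?case
    by (cases x) (auto simp: step_fun_Cons intro!: sq_integrable_add sq_integrable_cmult sq_integrable_indicator)
qed

text \<open>The second-order content of the Levy hypotheses: variances of increments proportional to
  their length determine all covariances of increments by polarisation.\<close>

locale orthogonal_increments = prob_space M for M :: "'a measure" +
  fixes Z :: "real \<Rightarrow> 'a \<Rightarrow> real"
  assumes sq: "\<And>t. sq_integrable M (Z t)"
    and mean: "\<And>t. expectation (Z t) = 0"
    and incr: "\<And>s t. s < t \<Longrightarrow> expectation (\<lambda>\<omega>. (Z t \<omega> - Z s \<omega>)\<^sup>2) = t - s"
begin

lemma sq_integrable_imp_integrable: "sq_integrable M f \<Longrightarrow> integrable M f"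
  using square_integrable_imp_integrable by (auto simp: sq_integrable_def)

lemma increment_second_moment: "expectation (\<lambda>\<omega>. (Z t \<omega> - Z s \<omega>)\<^sup>2) = \<bar>t - s\<bar>"
proof (cases s t rule: linorder_cases)
  case greater then show ?thesis using incr[OF greater] by (simp add: power2_commute)
qed (use incr in auto)

text \<open>Polarisation writes the product of two increments through four squared increments. The
  resulting combination of distances is the length of the overlap of the two intervals.\<close>

lemma increment_inner:
  assumes "u \<le> v" "u' \<le> v'"
  shows "expectation (\<lambda>\<omega>. (Z v \<omega> - Z u \<omega>) * (Z v' \<omega> - Z u' \<omega>)) =
     (\<integral>s. indicator {u<..v} s * indicator {u'<..v'} s \<partial>lborel)"
proof -
  have i: "integrable M (\<lambda>\<omega>. (Z t \<omega> - Z s \<omega>)\<^sup>2)" for s t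
    by (intro sq_integrable_square sq_integrable_diff sq)
  have "expectation (\<lambda>\<omega>. (Z v \<omega> - Z u \<omega>) * (Z v' \<omega> - Z u' \<omega>)) =
     expectation (\<lambda>\<omega>. ((Z v \<omega> - Z u' \<omega>)\<^sup>2 + (Z u \<omega> - Z v' \<omega>)\<^sup>2 - (Z v \<omega> - Z v' \<omega>)\<^sup>2 - (Z u \<omega> - Z u' \<omega>)\<^sup>2) / 2)"
    by (rule Bochner_Integration.integral_cong) (auto simp: power2_eq_square algebra_simps)
  also have "\<dots> = (\<bar>v - u'\<bar> + \<bar>u - v'\<bar> - \<bar>v - v'\<bar> - \<bar>u - u'\<bar>) / 2"
    using i by (simp add: increment_second_moment)
  also have "\<dots> = max 0 (min v v' - max u u')"
    using assms by (auto simp: max_def min_def abs_if)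
  also have "\<dots> = measure lborel {max u u'<..min v v'}" by (auto simp: max_def)
  also have "\<dots> = (\<integral>s. indicator {max u u'<..min v v'} s \<partial>lborel)" by simp
  also have "\<dots> = (\<integral>s. indicator {u<..v} s * indicator {u'<..v'} s \<partial>lborel)"
    by (rule Bochner_Integration.integral_cong) (auto simp: indicator_def)
  finally show ?thesis .
qed

lemma sq_integrable_step_integral: "sq_integrable M (step_integral Z c)"
proof (induction c)
  case Nil then show ?case by (simp add: step_integral_def[abs_def] sq_integrable_zero)
next
  case (Cons x c) then show ?case
    by (cases x) (auto simp: step_integral_Cons intro!: sq_integrable_add sq_integrable_cmult sq_integrable_diff sq)
qed

text \<open>The isometry is bilinear in the coding lists and is proved by induction on one list at a
  time; here the second argument is a single interval.\<close>

lemma step_isometry_increment: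
  assumes "\<forall>(a, u, v)\<in>set c. u \<le> v" "u' \<le> v'"
  shows "expectation (\<lambda>\<omega>. step_integral Z c \<omega> * (Z v' \<omega> - Z u' \<omega>)) =
     (\<integral>s. step_fun c s * indicator {u'<..v'} s \<partial>lborel)"
  using assms(1)
proof (induction c)
  case Nil then show ?case by (simp add: step_fun_def step_integral_def)
next
  case (Cons x c)
  obtain a u v where x: "x = (a, u, v)" by (cases x)
  have 1: "integrable M (\<lambda>\<omega>. (Z v \<omega> - Z u \<omega>) * (Z v' \<omega> - Z u' \<omega>))"
    by (intro sq_integrable_mult sq_integrable_diff sq)
  have 2: "integrable M (\<lambda>\<omega>. step_integral Z c \<omega> * (Z v' \<omega> - Z u' \<omega>))"
    by (intro sq_integrable_mult sq_integrable_diff sq sq_integrable_step_integral)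
  have 3: "integrable lborel (\<lambda>s. indicator {u<..v} s * indicator {u'<..v'} s :: real)"
    by (intro sq_integrable_mult sq_integrable_indicator)
  have 4: "integrable lborel (\<lambda>s. step_fun c s * indicator {u'<..v'} s)"
    by (intro sq_integrable_mult sq_integrable_indicator sq_integrable_step_fun)
  show ?case
    using Cons increment_inner[of u v u' v'] assms(2) 1 2 3 4
    by (simp add: x step_fun_Cons step_integral_Cons distrib_right mult.assoc)
qed

lemma step_isometry:
  assumes c: "\<forall>(a, u, v)\<in>set c. u \<le> v" and d: "\<forall>(a, u, v)\<in>set d. u \<le> v"
  shows "expectation (\<lambda>\<omega>. step_integral Z c \<omega> * step_integral Z d \<omega>) =
     (\<integral>s. step_fun c s * step_fun d s \<partial>lborel)"
  using d
proof (induction d)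
  case Nil then show ?case by (simp add: step_fun_def step_integral_def)
next
  case (Cons x d)
  obtain a u v where x: "x = (a, u, v)" by (cases x)
  have 1: "integrable M (\<lambda>\<omega>. step_integral Z c \<omega> * (Z v \<omega> - Z u \<omega>))"
    by (intro sq_integrable_mult sq_integrable_diff sq sq_integrable_step_integral)
  have 2: "integrable M (\<lambda>\<omega>. step_integral Z c \<omega> * step_integral Z d \<omega>)"
    by (intro sq_integrable_mult sq_integrable_diff sq sq_integrable_step_integral)
  have 3: "integrable lborel (\<lambda>s. step_fun c s * indicator {u<..v} s :: real)"
    by (intro sq_integrable_mult sq_integrable_indicator sq_integrable_step_fun)
  have 4: "integrable lborel (\<lambda>s. step_fun c s * step_fun d s)"
    by (intro sq_integrable_mult sq_integrable_step_fun)
  show ?case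
    using Cons step_isometry_increment[OF c, of u v] 1 2 3 4
    by (simp add: x step_fun_Cons step_integral_Cons distrib_left mult.left_commute[of _ a])
qed

lemma expectation_step_integral: "expectation (step_integral Z c) = 0"
proof (induction c)
  case Nil then show ?case by (simp add: step_integral_def)
next
  case (Cons x c)
  show ?case using Cons mean sq_integrable_imp_integrable[OF sq] sq_integrable_imp_integrable[OF sq_integrable_step_integral]
    by (cases x) (simp add: step_integral_Cons)
qed

text \<open>Mean and norm of the step integrals are continuous in L2 along the approximating
  sequence; the isometry on step functions identifies the two limits of the norms.\<close>

lemma levy_integral_moments:
  assumes "is_levy_integral M Z g Y"
  shows "sq_integrable M Y" "expectation Y = 0" "expectation (\<lambda>\<omega>. (Y \<omega>)\<^sup>2) = (\<integral>s. (g s)\<^sup>2 \<partial>lborel)"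
proof -
  from assms obtain c where g: "sq_integrable lborel g" and Y: "sq_integrable M Y"
    and c: "\<And>n. \<forall>(a, u, v)\<in>set (c n). u \<le> v"
    and lim1: "(\<lambda>n. \<integral>s. (step_fun (c n) s - g s)\<^sup>2 \<partial>lborel) \<longlonglongrightarrow> 0"
    and lim2: "(\<lambda>n. \<integral>\<omega>. (step_integral Z (c n) \<omega> - Y \<omega>)\<^sup>2 \<partial>M) \<longlonglongrightarrow> 0"
    unfolding is_levy_integral_def sq_integrable_def by blast
  show "sq_integrable M Y" by fact
  have "(\<lambda>n. \<integral>\<omega>. step_integral Z (c n) \<omega> * 1 \<partial>M) \<longlonglongrightarrow> (\<integral>\<omega>. Y \<omega> * 1 \<partial>M)"
    by (rule L2_limit_inner[OF sq_integrable_step_integral Y _ lim2]) (simp add: sq_integrable_def)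
  then have "(\<lambda>n. 0) \<longlonglongrightarrow> expectation Y" by (simp add: expectation_step_integral)
  then show "expectation Y = 0" by (simp add: LIMSEQ_const_iff)
  have "(\<lambda>n. \<integral>\<omega>. (step_integral Z (c n) \<omega>)\<^sup>2 \<partial>M) \<longlonglongrightarrow> (\<integral>\<omega>. (Y \<omega>)\<^sup>2 \<partial>M)"
    by (rule L2_limit_norm[OF sq_integrable_step_integral Y lim2])
  moreover have "(\<lambda>n. \<integral>s. (step_fun (c n) s)\<^sup>2 \<partial>lborel) \<longlonglongrightarrow> (\<integral>s. (g s)\<^sup>2 \<partial>lborel)"
    by (rule L2_limit_norm[OF sq_integrable_step_fun g lim1])
  moreover have "(\<integral>\<omega>. (step_integral Z (c n) \<omega>)\<^sup>2 \<partial>M) = (\<integral>s. (step_fun (c n) s)\<^sup>2 \<partial>lborel)" for n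
    using step_isometry[OF c c] by (simp add: power2_eq_square)
  ultimately show "expectation (\<lambda>\<omega>. (Y \<omega>)\<^sup>2) = (\<integral>s. (g s)\<^sup>2 \<partial>lborel)"
    by (simp add: LIMSEQ_unique)
qed

end

text \<open>Stationarity moves the increment over (s, t] to (0, t - s], where it equals
  \<open>Z (t - s)\<close> almost surely.\<close>

lemma levy_orthogonal_increments:
  assumes "prob_space M"
    and levy: "two_sided_levy_process M Z"
    and sq: "\<And>t. integrable M (\<lambda>\<omega>. (Z t \<omega>)\<^sup>2)"
    and mean: "\<And>t. prob_space.expectation M (Z t) = 0"
    and var: "\<And>t. prob_space.variance M (Z t) = \<bar>t\<bar>"
  shows "orthogonal_increments M Z"
proof -
  interpret prob_space M by fact
  have [measurable]: "Z t \<in> borel_measurable M" for t using levy by (simp add: two_sided_levy_process_def)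
  have Z0: "AE \<omega> in M. Z 0 \<omega> = 0" using levy by (simp add: two_sided_levy_process_def)
  show ?thesis
  proof
    show "sq_integrable M (Z t)" for t using sq by (simp add: sq_integrable_def)
    show "expectation (Z t) = 0" for t by (rule mean)
    fix s t :: real assume st: "s < t"
    have "distr M borel (\<lambda>\<omega>. Z (t - s + s) \<omega> - Z (0 + s) \<omega>) = distr M borel (\<lambda>\<omega>. Z (t - s) \<omega> - Z 0 \<omega>)"
      using levy st unfolding two_sided_levy_process_def by (metis diff_gt_0_iff_gt)
    then have D: "distr M borel (\<lambda>\<omega>. Z t \<omega> - Z s \<omega>) = distr M borel (\<lambda>\<omega>. Z (t - s) \<omega> - Z 0 \<omega>)" by simp
    have "expectation (\<lambda>\<omega>. (Z t \<omega> - Z s \<omega>)\<^sup>2) = (\<integral>x. x\<^sup>2 \<partial>distr M borel (\<lambda>\<omega>. Z t \<omega> - Z s \<omega>))"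
      by (subst integral_distr) auto
    also have "\<dots> = expectation (\<lambda>\<omega>. (Z (t - s) \<omega> - Z 0 \<omega>)\<^sup>2)"
      unfolding D by (subst integral_distr) auto
    also have "\<dots> = expectation (\<lambda>\<omega>. (Z (t - s) \<omega>)\<^sup>2)"
      by (rule integral_cong_AE) (use Z0 in auto)
    also have "\<dots> = t - s" using var[of "t - s"] mean[of "t - s"] st by simp
    finally show "expectation (\<lambda>\<omega>. (Z t \<omega> - Z s \<omega>)\<^sup>2) = t - s" .
  qed
qed

section \<open>Square integrability of stationary solutions\<close>

text \<open>Cauchy-Schwarz in time against the constant 1 bounds the squared path integral by the
  integral of the squares, and Fubini reduces the rest to the uniform bound \<open>c\<close>. A
  general finite measure \<open>N\<close> covers both the weighted noise and the plain integral of
  the solution.\<close>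

lemma process_integral:
  fixes Y :: "'b \<Rightarrow> 'a \<Rightarrow> real"
  assumes "finite_measure N" "prob_space M"
    and meas: "(\<lambda>(s, \<omega>). Y s \<omega>) \<in> borel_measurable (N \<Otimes>\<^sub>M M)"
    and sq: "\<And>s. s \<in> space N \<Longrightarrow> integrable M (\<lambda>\<omega>. (Y s \<omega>)\<^sup>2)"
    and bound: "\<And>s. s \<in> space N \<Longrightarrow> (\<integral>\<omega>. (Y s \<omega>)\<^sup>2 \<partial>M) \<le> c"
  shows "AE \<omega> in M. integrable N (\<lambda>s. Y s \<omega>)"
    and "sq_integrable M (\<lambda>\<omega>. \<integral>s. Y s \<omega> \<partial>N)"
    and "(\<integral>\<omega>. (\<integral>s. Y s \<omega> \<partial>N)\<^sup>2 \<partial>M) \<le> c * (measure N (space N))\<^sup>2"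
    and "\<And>G. sq_integrable M G \<Longrightarrow> (\<integral>\<omega>. (\<integral>s. Y s \<omega> \<partial>N) * G \<omega> \<partial>M) = (\<integral>s. (\<integral>\<omega>. Y s \<omega> * G \<omega> \<partial>M) \<partial>N)"
proof -
  interpret N: finite_measure N by fact
  interpret M: prob_space M by fact
  interpret NM: pair_sigma_finite N M ..
  interpret MN: pair_sigma_finite M N ..
  have m[measurable]: "(\<lambda>x. Y (fst x) (snd x)) \<in> borel_measurable (N \<Otimes>\<^sub>M M)"
    using meas by (simp add: case_prod_beta')
  have m1[measurable]: "(\<lambda>x. Y (snd x) (fst x)) \<in> borel_measurable (M \<Otimes>\<^sub>M N)"
    by (rule measurable_compose[OF measurable_pair_swap' , of "\<lambda>x. Y (fst x) (snd x)", simplified case_prod_beta' fst_conv snd_conv]) measurable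
  have mI[measurable]: "(\<lambda>\<omega>. \<integral>s. Y s \<omega> \<partial>N) \<in> borel_measurable M"
    by (rule N.borel_measurable_lebesgue_integral) (simp add: case_prod_beta')
  have iY2: "integrable (N \<Otimes>\<^sub>M M) (\<lambda>x. (Y (fst x) (snd x))\<^sup>2)"
  proof (rule NM.Fubini_integrable)
    show "integrable N (\<lambda>x. \<integral>y. norm ((Y (fst (x, y)) (snd (x, y)))\<^sup>2) \<partial>M)"
    proof (rule N.integrable_const_bound)
      show "AE x in N. norm (\<integral>y. norm ((Y (fst (x, y)) (snd (x, y)))\<^sup>2) \<partial>M) \<le> c"
        using bound by (auto intro!: AE_I2)
      show "(\<lambda>x. \<integral>y. norm ((Y (fst (x, y)) (snd (x, y)))\<^sup>2) \<partial>M) \<in> borel_measurable N"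
        by (rule M.borel_measurable_lebesgue_integral) (simp add: case_prod_beta')
    qed
    show "AE x in N. integrable M (\<lambda>y. (Y (fst (x, y)) (snd (x, y)))\<^sup>2)"
      using sq by (auto intro!: AE_I2)
  qed simp
  then have iY2': "integrable (N \<Otimes>\<^sub>M M) (\<lambda>(s, \<omega>). (Y s \<omega>)\<^sup>2)" by (simp add: case_prod_beta')
  have one: "sq_integrable N (\<lambda>_. 1)" by (simp add: sq_integrable_def)
  have mN: "(\<lambda>s. Y s \<omega>) \<in> borel_measurable N" if "\<omega> \<in> space M" for \<omega>
    using measurable_Pair2[OF m1 that] by simp
  have ae: "AE \<omega> in M. sq_integrable N (\<lambda>s. Y s \<omega>)"
    using NM.AE_integrable_snd[OF iY2'] AE_space
    by eventually_elim (auto simp: sq_integrable_def mN)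
  then show "AE \<omega> in M. integrable N (\<lambda>s. Y s \<omega>)"
  proof eventually_elim
    case (elim \<omega>)
    from sq_integrable_mult[OF elim one] show ?case by simp
  qed
  have le: "AE \<omega> in M. (\<integral>s. Y s \<omega> \<partial>N)\<^sup>2 \<le> (\<integral>s. (Y s \<omega>)\<^sup>2 \<partial>N) * measure N (space N)"
    using ae
  proof eventually_elim
    case (elim \<omega>)
    from Cauchy_Schwarz_integral[OF elim one] show ?case by simp
  qed
  note i2 = NM.integrable_snd[OF iY2']
  have isq: "integrable M (\<lambda>\<omega>. (\<integral>s. Y s \<omega> \<partial>N)\<^sup>2)"
  proof (rule Bochner_Integration.integrable_bound)
    show "integrable M (\<lambda>\<omega>. (\<integral>s. (Y s \<omega>)\<^sup>2 \<partial>N) * measure N (space N))" using i2 by simp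
    show "AE x in M. norm ((\<integral>s. Y s x \<partial>N)\<^sup>2) \<le> norm ((\<integral>s. (Y s x)\<^sup>2 \<partial>N) * measure N (space N))"
      using le by eventually_elim simp
  qed simp
  then show sqI: "sq_integrable M (\<lambda>\<omega>. \<integral>s. Y s \<omega> \<partial>N)" by (simp add: sq_integrable_def)
  have "(\<integral>\<omega>. (\<integral>s. Y s \<omega> \<partial>N)\<^sup>2 \<partial>M) \<le> (\<integral>\<omega>. (\<integral>s. (Y s \<omega>)\<^sup>2 \<partial>N) * measure N (space N) \<partial>M)"
    by (rule integral_mono_AE) (use isq i2 le in auto)
  also have "\<dots> = (\<integral>s. (\<integral>\<omega>. (Y s \<omega>)\<^sup>2 \<partial>M) \<partial>N) * measure N (space N)"
    using NM.Fubini_integral[OF iY2'] by simp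
  also have "\<dots> \<le> (\<integral>s. c \<partial>N) * measure N (space N)"
    using NM.integrable_fst[OF iY2'] bound by (intro mult_right_mono integral_mono) auto
  also have "\<dots> = c * (measure N (space N))\<^sup>2" by (simp add: power2_eq_square mult.assoc)
  finally show "(\<integral>\<omega>. (\<integral>s. Y s \<omega> \<partial>N)\<^sup>2 \<partial>M) \<le> c * (measure N (space N))\<^sup>2" .
  fix G assume G: "sq_integrable M G"
  then have [measurable]: "G \<in> borel_measurable M" by (simp add: sq_integrable_def)
  have sqY: "sq_integrable (N \<Otimes>\<^sub>M M) (\<lambda>x. Y (fst x) (snd x))"
    using iY2 by (simp add: sq_integrable_def)
  have sqG: "sq_integrable (N \<Otimes>\<^sub>M M) (\<lambda>x. G (snd x))"
  proof -
    have "integrable (N \<Otimes>\<^sub>M M) (\<lambda>x. (G (snd x))\<^sup>2)"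
      by (rule NM.Fubini_integrable) (use sq_integrable_square[OF G] in auto)
    then show ?thesis by (simp add: sq_integrable_def)
  qed
  have "integrable (N \<Otimes>\<^sub>M M) (\<lambda>(s, \<omega>). Y s \<omega> * G \<omega>)"
    using sq_integrable_mult[OF sqY sqG] by (simp add: case_prod_beta')
  from NM.Fubini_integral[OF this]
  show "(\<integral>\<omega>. (\<integral>s. Y s \<omega> \<partial>N) * G \<omega> \<partial>M) = (\<integral>s. (\<integral>\<omega>. Y s \<omega> * G \<omega> \<partial>M) \<partial>N)" by simp
qed

lemma integrable_tensor:
  fixes f g :: "_ \<Rightarrow> real"
  assumes "sigma_finite_measure M1" "sigma_finite_measure M2"
    and f: "integrable M1 f" and g: "integrable M2 g"
  shows "integrable (M1 \<Otimes>\<^sub>M M2) (\<lambda>(x, y). f x * g y)"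
proof -
  interpret M1: sigma_finite_measure M1 by fact
  interpret M2: sigma_finite_measure M2 by fact
  interpret pair_sigma_finite M1 M2 ..
  have [measurable]: "f \<in> borel_measurable M1" "g \<in> borel_measurable M2" using f g by auto
  show ?thesis
    by (rule Fubini_integrable) (use f g in \<open>auto simp: abs_mult\<close>)
qed

lemma integral_exp_interval:
  fixes lam a b :: real
  assumes "lam \<noteq> 0" "a \<le> b"
  shows "set_integrable lborel {a<..<b} (\<lambda>s. exp (lam * s))"
    and "(LBINT s:{a<..<b}. exp (lam * s)) = (exp (lam * b) - exp (lam * a)) / lam"
proof -
  have c: "set_integrable lborel {a..b} (\<lambda>s. exp (lam * s))"
    by (rule borel_integrable_atLeastAtMost') (auto intro!: continuous_intros)
  show 1: "set_integrable lborel {a<..<b} (\<lambda>s. exp (lam * s))"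
    by (rule set_integrable_subset[OF c]) auto
  have "((\<lambda>s. exp (lam * s)) has_integral (exp (lam * b) / lam - exp (lam * a) / lam)) {a..b}"
    by (rule fundamental_theorem_of_calculus)
       (use assms in \<open>auto intro!: derivative_eq_intros simp flip: has_real_derivative_iff_has_vector_derivative\<close>)
  then have "((\<lambda>s. exp (lam * s)) has_integral (exp (lam * b) / lam - exp (lam * a) / lam)) {a<..<b}"
    by (simp add: has_integral_Icc_iff_Ioo)
  then show "(LBINT s:{a<..<b}. exp (lam * s)) = (exp (lam * b) - exp (lam * a)) / lam"
    using set_borel_integral_eq_integral(2)[OF 1] by (simp add: integral_unique diff_divide_distrib)
qed

text \<open>
  Integrating the equation against \<open>lam * exp (lam * s)\<close> eliminates the integral of the solution.
\<close>

lemma path_identity: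
  fixes x n :: "real \<Rightarrow> real" and lam T x0 :: real
  assumes lam: "lam > 0" and T: "T > 0"
    and [measurable]: "x \<in> borel_measurable borel"
    and int: "set_integrable lborel {-T<..<0} x"
    and eq: "AE s in lborel. -T < s \<and> s < 0 \<longrightarrow> x s = x0 + lam * (LBINT u:{s<..<0}. x u) + n s"
    and eqT: "x (-T) = x0 + lam * (LBINT u:{-T<..<0}. x u) + nT"
    and nint: "set_integrable lborel {-T<..<0} (\<lambda>s. exp (lam * s) * n s)"
  shows "x0 = exp (- lam * T) * (x (-T) - nT) - lam * (LBINT s:{-T<..<0}. exp (lam * s) * n s)"
proof -
  let ?I = "\<lambda>s. indicator {-T<..<0} s :: real"
  let ?J = "\<lambda>s. LBINT u:{s<..<0}. x u"
  have ix: "integrable lborel (\<lambda>u. ?I u * x u)" using int by (simp add: set_integrable_def)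
  have iI: "integrable lborel ?I" using T by simp
  have e1: "exp (lam * s) * \<bar>y\<bar> \<le> \<bar>y\<bar>" if "s < 0" for s y :: real
    using lam that by (intro mult_left_le_one_le) (auto simp: mult_le_0_iff)
  \<comment> \<open>The integrand \<open>exp (lam * s) * x u\<close> on the triangle -T < s < u < 0.
    Exchanging the integrations replaces an integration by parts and asks of the path no more than
    integrability.\<close>
  define k where "k = (\<lambda>(s, u). ?I s * indicator {s<..<0} u * exp (lam * s) * x u)"
  have k_meas: "k \<in> borel_measurable (lborel \<Otimes>\<^sub>M lborel)"
  proof -
    have "k = (\<lambda>p. ?I (fst p) * (if fst p < snd p \<and> snd p < 0 then 1 else 0) * exp (lam * fst p) * x (snd p))"
      by (auto simp: k_def fun_eq_iff indicator_def)
    also have "\<dots> \<in> borel_measurable (lborel \<Otimes>\<^sub>M lborel)" by measurable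
    finally show ?thesis .
  qed
  have ki: "integrable (lborel \<Otimes>\<^sub>M lborel) k"
  proof (rule Bochner_Integration.integrable_bound)
    show "integrable (lborel \<Otimes>\<^sub>M lborel) (\<lambda>(s, u). ?I s * (?I u * x u))"
      by (rule integrable_tensor[OF _ _ iI ix]) (rule sigma_finite_lborel)+
    have "norm (k (s, u)) \<le> norm (?I s * (?I u * x u))" for s u
      using e1[of s] by (auto simp: k_def indicator_def abs_mult)
    then show "AE p in lborel \<Otimes>\<^sub>M lborel. norm (k p) \<le> norm (case p of (s, u) \<Rightarrow> ?I s * (?I u * x u))"
      by (auto simp: split_beta)
  qed (rule k_meas)
  have inner_u: "(\<integral>u. k (s, u) \<partial>lborel) = ?I s * (exp (lam * s) * ?J s)" for s
    unfolding k_def set_lebesgue_integral_def by (simp add: mult.assoc mult.left_commute[of "indicator {s<..<0} _"])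
  have inner_s: "(\<integral>s. k (s, u) \<partial>lborel) = (?I u * x u) * ((exp (lam * u) - exp (- lam * T)) / lam)" for u
  proof (cases "-T < u \<and> u < 0")
    case True
    have "(\<integral>s. k (s, u) \<partial>lborel) = (\<integral>s. x u * (indicator {-T<..<u} s * exp (lam * s)) \<partial>lborel)"
      by (rule Bochner_Integration.integral_cong) (use True in \<open>auto simp: k_def indicator_def\<close>)
    also have "\<dots> = x u * ((exp (lam * u) - exp (- lam * T)) / lam)"
      using integral_exp_interval(2)[of lam "-T" u] True lam by (simp add: set_lebesgue_integral_def)
    finally show ?thesis using True by simp
  next
    case False
    then have "k (s, u) = 0" for s by (auto simp: k_def indicator_def)
    then show ?thesis using False by auto
  qed
  have F: "(\<integral>s. ?I s * (exp (lam * s) * ?J s) \<partial>lborel)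
       = (\<integral>u. (?I u * x u) * ((exp (lam * u) - exp (- lam * T)) / lam) \<partial>lborel)"
  proof -
    have "integrable (lborel \<Otimes>\<^sub>M lborel) (case_prod (\<lambda>s u. k (s, u)))" using ki by simp
    from lborel_pair.Fubini_integral[OF this] show ?thesis
      unfolding inner_u inner_s by simp
  qed
  have iex: "integrable lborel (\<lambda>u. ?I u * (exp (lam * u) * x u))"
  proof (rule Bochner_Integration.integrable_bound[OF ix])
    show "AE u in lborel. norm (?I u * (exp (lam * u) * x u)) \<le> norm (?I u * x u)"
      using e1 by (auto simp: indicator_def abs_mult)
  qed simp
  have iJ: "integrable lborel (\<lambda>s. ?I s * (exp (lam * s) * ?J s))"
  proof -
    have "integrable (lborel \<Otimes>\<^sub>M lborel) (case_prod (\<lambda>s u. k (s, u)))" using ki by simp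
    from lborel_pair.integrable_fst[OF this] show ?thesis unfolding inner_u .
  qed
  have ie: "integrable lborel (\<lambda>u. ?I u * exp (lam * u))"
    using integral_exp_interval(1)[of lam "-T" 0] lam T by (simp add: set_integrable_def)
  have e0: "(\<integral>u. ?I u * exp (lam * u) \<partial>lborel) = (1 - exp (- lam * T)) / lam"
    using integral_exp_interval(2)[of lam "-T" 0] lam T by (simp add: set_lebesgue_integral_def)
  have "(LBINT s:{-T<..<0}. exp (lam * s) * n s) = (\<integral>s. ?I s * (exp (lam * s) * n s) \<partial>lborel)"
    by (simp add: set_lebesgue_integral_def)
  also have "\<dots> = (\<integral>s. ?I s * (exp (lam * s) * x s) - x0 * (?I s * exp (lam * s))
         - lam * (?I s * (exp (lam * s) * ?J s)) \<partial>lborel)"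
  proof (rule integral_cong_AE)
    show "(\<lambda>s. ?I s * (exp (lam * s) * n s)) \<in> borel_measurable lborel"
      using nint by (auto simp: set_integrable_def dest: borel_measurable_integrable)
    show "(\<lambda>s. ?I s * (exp (lam * s) * x s) - x0 * (?I s * exp (lam * s))
         - lam * (?I s * (exp (lam * s) * ?J s))) \<in> borel_measurable lborel"
      using iJ iex ie by (intro borel_measurable_integrable Bochner_Integration.integrable_diff integrable_mult_right) auto
    show "AE s in lborel. ?I s * (exp (lam * s) * n s) = ?I s * (exp (lam * s) * x s) - x0 * (?I s * exp (lam * s))
         - lam * (?I s * (exp (lam * s) * ?J s))"
      using eq by eventually_elim (auto simp: indicator_def algebra_simps)
  qed
  also have "\<dots> = (\<integral>s. ?I s * (exp (lam * s) * x s) \<partial>lborel) - x0 * ((1 - exp (- lam * T)) / lam)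
      - lam * (\<integral>u. (?I u * x u) * ((exp (lam * u) - exp (- lam * T)) / lam) \<partial>lborel)"
    using iJ iex ie by (simp add: e0 F)
  also have "(\<integral>u. (?I u * x u) * ((exp (lam * u) - exp (- lam * T)) / lam) \<partial>lborel) =
      (\<integral>u. (?I u * (exp (lam * u) * x u) - exp (- lam * T) * (?I u * x u)) / lam \<partial>lborel)"
    by (rule Bochner_Integration.integral_cong) (auto simp: algebra_simps)
  also have "\<dots> = ((\<integral>u. ?I u * (exp (lam * u) * x u) \<partial>lborel) - exp (- lam * T) * ?J (-T)) / lam"
    using iex ix by (simp add: set_lebesgue_integral_def)
  finally have "lam * (LBINT s:{-T<..<0}. exp (lam * s) * n s) =
      lam * ((\<integral>s. ?I s * (exp (lam * s) * x s) \<partial>lborel) - x0 * ((1 - exp (- lam * T)) / lam)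
      - lam * (((\<integral>u. ?I u * (exp (lam * u) * x u) \<partial>lborel) - exp (- lam * T) * ?J (-T)) / lam))"
    by (rule arg_cong)
  \<comment> \<open>The weighted integrals of \<open>x\<close> cancel here. What remains of the path
    is \<open>?J (-T)\<close>, which \<open>eqT\<close> expresses through
    \<open>x (-T)\<close>.\<close>
  also have "\<dots> = - x0 * (1 - exp (- lam * T)) + lam * exp (- lam * T) * ?J (-T)"
  proof -
    have "lam * (A - x0 * ((1 - E) / lam) - lam * ((A - E * J) / lam)) = - x0 * (1 - E) + lam * E * J" for A E J
    proof -
      have l: "lam * (y / lam) = y" for y using lam by simp
      have "lam * (A - x0 * ((1 - E) / lam) - lam * ((A - E * J) / lam))
          = lam * A - x0 * (lam * ((1 - E) / lam)) - lam * (lam * ((A - E * J) / lam))"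
        by (simp only: right_diff_distrib mult.left_commute[of lam x0])
      also have "\<dots> = - x0 * (1 - E) + lam * E * J" unfolding l by (simp add: algebra_simps)
      finally show ?thesis .
    qed
    then show ?thesis .
  qed
  finally have "lam * (LBINT s:{-T<..<0}. exp (lam * s) * n s) =
      - x0 * (1 - exp (- lam * T)) + lam * exp (- lam * T) * ?J (-T)" .
  moreover have "exp (- lam * T) * (x (-T) - nT) = exp (- lam * T) * (x0 + lam * ?J (-T))" using eqT by simp
  ultimately show ?thesis by (simp add: algebra_simps)
qed

lemma einterval_real_zero: "einterval (ereal a) 0 = {a<..<0}" "einterval 0 (ereal a) = {0<..<a}"
  by (auto simp: einterval_def)

text \<open>From exp y \<ge> y^2 / 2 with y = - lam * s. It turns quadratic growth of the noise
  variance into a bound uniform over the past.\<close>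

lemma exp_weight_bound:
  fixes lam s :: real
  assumes "lam > 0" "s \<le> 0"
  shows "exp (lam * s) * (1 + s\<^sup>2) \<le> 1 + 2 / lam\<^sup>2"
proof -
  define y where "y = - (lam * s)"
  have y: "y \<ge> 0" using assms by (simp add: y_def mult_le_0_iff)
  have "1 + y + y\<^sup>2 / 2 \<le> exp y" by (rule exp_lower_Taylor_quadratic[OF y])
  then have "y\<^sup>2 \<le> 2 * exp y" using y by simp
  then have "exp (- y) * y\<^sup>2 \<le> 2" by (simp add: exp_minus field_simps)
  moreover have "s\<^sup>2 = y\<^sup>2 / lam\<^sup>2" using assms by (simp add: y_def power_mult_distrib)
  ultimately have "exp (- y) * s\<^sup>2 \<le> 2 / lam\<^sup>2" using assms by (simp add: divide_right_mono)
  moreover have "exp (- y) \<le> 1" using y by simp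
  ultimately have "exp (- y) * (1 + s\<^sup>2) \<le> 1 + 2 / lam\<^sup>2" unfolding distrib_left by linarith
  then show ?thesis by (simp add: y_def)
qed

text \<open>The noise enters through its mean, its variance function \<open>V\<close> and the growth
  of \<open>V\<close>; no kernel appears. Square integrability of \<open>X\<close> is a result here
  (\<open>X_sq\<close>).\<close>

locale stationary_qou = prob_space M for M :: "'a measure" +
  fixes N X :: "real \<Rightarrow> 'a \<Rightarrow> real" and lam C :: real and V :: "real \<Rightarrow> real"
  assumes lam: "lam > 0"
    and mN: "measurable_process M N"
    and sqN: "\<And>t. sq_integrable M (N t)"
    and meanN: "\<And>t. expectation (N t) = 0"
    and varN: "\<And>t. expectation (\<lambda>\<omega>. (N t \<omega>)\<^sup>2) = V t"
    and growth: "\<And>t. V t \<le> C * (1 + t\<^sup>2)"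
    and qou: "qou_process M N lam X"
begin

lemma X_joint[measurable]: "(\<lambda>p. X (fst p) (snd p)) \<in> borel_measurable (borel \<Otimes>\<^sub>M M)"
  using qou by (simp add: qou_process_def measurable_process_def case_prod_beta')

lemma N_joint[measurable]: "(\<lambda>p. N (fst p) (snd p)) \<in> borel_measurable (borel \<Otimes>\<^sub>M M)"
  using mN by (simp add: measurable_process_def case_prod_beta')

lemma X_meas[measurable]: "X t \<in> borel_measurable M"
  using qou by (simp add: qou_process_def stationary_process_def)

lemma N_meas[measurable]: "N t \<in> borel_measurable M"
  using sqN by (simp add: sq_integrable_def)

lemma X_path[measurable]: "\<omega> \<in> space M \<Longrightarrow> (\<lambda>t. X t \<omega>) \<in> borel_measurable borel"
  using measurable_Pair1[OF X_joint, of \<omega>] by simp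

text \<open>Stationarity tested on functions of two coordinates. \<open>s = t\<close> is allowed,
  the index set then being a singleton.\<close>

lemma shift_invariant:
  assumes [measurable]: "\<phi> \<in> borel_measurable (borel \<Otimes>\<^sub>M borel)"
  shows "expectation (\<lambda>\<omega>. \<phi> (X (s + h) \<omega>, X (t + h) \<omega>)) = (expectation (\<lambda>\<omega>. \<phi> (X s \<omega>, X t \<omega>)) :: real)"
    and "integrable M (\<lambda>\<omega>. \<phi> (X (s + h) \<omega>, X (t + h) \<omega>) :: real) \<longleftrightarrow> integrable M (\<lambda>\<omega>. \<phi> (X s \<omega>, X t \<omega>))"
proof -
  let ?P = "PiM {s, t} (\<lambda>_. borel :: real measure)"
  have D: "distr M ?P (\<lambda>\<omega>. \<lambda>j\<in>{s, t}. X (j + h) \<omega>) = distr M ?P (\<lambda>\<omega>. \<lambda>j\<in>{s, t}. X j \<omega>)"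
    using qou unfolding qou_process_def stationary_process_def by blast
  have m: "(\<lambda>\<omega>. \<lambda>j\<in>{s, t}. X (j + h) \<omega>) \<in> measurable M ?P" for h
    by (rule measurable_restrict) (rule X_meas)
  have m0: "(\<lambda>\<omega>. \<lambda>j\<in>{s, t}. X j \<omega>) \<in> measurable M ?P"
    using m[of 0] by simp
  have g: "(\<lambda>x. \<phi> (x s, x t)) \<in> borel_measurable ?P" by measurable
  show "expectation (\<lambda>\<omega>. \<phi> (X (s + h) \<omega>, X (t + h) \<omega>)) = (expectation (\<lambda>\<omega>. \<phi> (X s \<omega>, X t \<omega>)) :: real)"
    using arg_cong[OF D, of "\<lambda>P. \<integral>x. \<phi> (x s, x t) \<partial>P"]
    unfolding integral_distr[OF m g] integral_distr[OF m0 g] by simp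
  show "integrable M (\<lambda>\<omega>. \<phi> (X (s + h) \<omega>, X (t + h) \<omega>) :: real) \<longleftrightarrow> integrable M (\<lambda>\<omega>. \<phi> (X s \<omega>, X t \<omega>))"
    using arg_cong[OF D, of "\<lambda>P. integrable P (\<lambda>x. \<phi> (x s, x t))"]
    unfolding integrable_distr_eq[OF m g] integrable_distr_eq[OF m0 g] by simp
qed

lemma eq_neg:
  assumes "t < 0"
  shows "AE \<omega> in M. set_integrable lborel {t<..<0} (\<lambda>s. X s \<omega>) \<and>
     X t \<omega> = X 0 \<omega> + lam * (LBINT u:{t<..<0}. X u \<omega>) + N t \<omega>"
proof -
  have "AE \<omega> in M. interval_lebesgue_integrable lborel (ereal 0) (ereal t) (\<lambda>s. X s \<omega>) \<and>
        X t \<omega> = X 0 \<omega> - lam * (LBINT s=ereal 0..ereal t. X s \<omega>) + N t \<omega>"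
    using qou by (simp add: qou_process_def)
  then show ?thesis
    by eventually_elim
       (use assms in \<open>simp add: interval_lebesgue_integrable_def interval_lebesgue_integral_def einterval_real_zero\<close>)
qed

lemma eq_pos:
  assumes "t > 0"
  shows "AE \<omega> in M. N t \<omega> = X t \<omega> - X 0 \<omega> + lam * (LBINT u:{0<..<t}. X u \<omega>)"
proof -
  have "AE \<omega> in M. interval_lebesgue_integrable lborel (ereal 0) (ereal t) (\<lambda>s. X s \<omega>) \<and>
        X t \<omega> = X 0 \<omega> - lam * (LBINT s=ereal 0..ereal t. X s \<omega>) + N t \<omega>"
    using qou by (simp add: qou_process_def)
  then show ?thesis
    by eventually_elim
       (use assms in \<open>simp add: interval_lebesgue_integrable_def interval_lebesgue_integral_def einterval_real_zero\<close>)
qed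

lemma growth_abs: "V t \<le> \<bar>C\<bar> * (1 + t\<^sup>2)"
proof -
  have "C * (1 + t\<^sup>2) \<le> \<bar>C\<bar> * (1 + t\<^sup>2)" by (rule mult_right_mono) auto
  then show ?thesis using growth[of t] by linarith
qed

text \<open>The weight exp (lam * s) is split evenly. One factor exp (lam / 2 * s) becomes a finite
  measure of mass at most 2 / lam for every \<open>T\<close>; the other stays with the noise, where
  its square tames the quadratic growth of \<open>V\<close>. Hence the bound does not depend on
  \<open>T\<close>.\<close>

lemma weighted_noise:
  assumes T: "T > 0"
  shows "AE \<omega> in M. set_integrable lborel {-T<..<0} (\<lambda>s. exp (lam * s) * N s \<omega>)"
    and "sq_integrable M (\<lambda>\<omega>. LBINT s:{-T<..<0}. exp (lam * s) * N s \<omega>)"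
    and "expectation (\<lambda>\<omega>. (LBINT s:{-T<..<0}. exp (lam * s) * N s \<omega>)\<^sup>2) \<le> \<bar>C\<bar> * (1 + 2 / lam\<^sup>2) * (2 / lam)\<^sup>2"
proof -
  define w where "w = (\<lambda>s. indicator {-T<..<0} s * exp (lam / 2 * s))"
  define \<nu> where "\<nu> = density lborel (\<lambda>s. ennreal (w s))"
  \<comment> \<open>Set to 0 for s > 0 because \<open>process_integral\<close> wants its bound at
    every point of the space, not only on the support of the measure.\<close>
  define Y where "Y = (\<lambda>s \<omega>. if s \<le> 0 then exp (lam / 2 * s) * N s \<omega> else 0)"
  have [measurable]: "w \<in> borel_measurable borel" unfolding w_def by measurable
  have w0: "w s \<ge> 0" for s by (simp add: w_def)
  have wi: "integrable lborel w"
    using integral_exp_interval(1)[of "lam/2" "-T" 0] lam T by (simp add: w_def set_integrable_def)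
  have wv: "(\<integral>s. w s \<partial>lborel) \<le> 2 / lam"
    using integral_exp_interval(2)[of "lam/2" "-T" 0] lam T by (simp add: w_def set_lebesgue_integral_def divide_right_mono)
  have em: "emeasure \<nu> (space \<nu>) = ennreal (\<integral>s. w s \<partial>lborel)"
    unfolding \<nu>_def by (subst emeasure_density) (auto simp: nn_integral_eq_integral[OF wi] w0)
  have fin: "finite_measure \<nu>" by (rule finite_measureI) (simp add: em)
  have mv: "measure \<nu> (space \<nu>) \<le> 2 / lam"
    using wv by (simp add: measure_def em w0 integral_nonneg)
  have sets: "sets \<nu> = sets borel" by (simp add: \<nu>_def)
  have Ymeas: "(\<lambda>(s, \<omega>). Y s \<omega>) \<in> borel_measurable (\<nu> \<Otimes>\<^sub>M M)"
  proof -
    have "(\<lambda>(s, \<omega>). Y s \<omega>) \<in> borel_measurable (borel \<Otimes>\<^sub>M M)"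
      unfolding Y_def case_prod_beta' by measurable
    then show ?thesis using sets by (simp cong: measurable_cong_sets sets_pair_measure_cong)
  qed
  have Ysq: "integrable M (\<lambda>\<omega>. (Y s \<omega>)\<^sup>2)" for s
    using sq_integrable_square[OF sqN, of s] by (cases "s \<le> 0") (simp_all add: Y_def power_mult_distrib)
  have Yb: "expectation (\<lambda>\<omega>. (Y s \<omega>)\<^sup>2) \<le> \<bar>C\<bar> * (1 + 2 / lam\<^sup>2)" for s
  proof (cases "s \<le> 0")
    case True
    have "expectation (\<lambda>\<omega>. (Y s \<omega>)\<^sup>2) = exp (lam * s) * V s"
      using True by (simp add: Y_def power_mult_distrib varN flip: exp_double)
    also have "\<dots> \<le> exp (lam * s) * (\<bar>C\<bar> * (1 + s\<^sup>2))"
      by (rule mult_left_mono[OF growth_abs]) simp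
    also have "\<dots> = \<bar>C\<bar> * (exp (lam * s) * (1 + s\<^sup>2))" by simp
    also have "\<dots> \<le> \<bar>C\<bar> * (1 + 2 / lam\<^sup>2)"
      by (intro mult_left_mono exp_weight_bound lam True) auto
    finally show ?thesis .
  qed (simp add: Y_def)
  have conv: "w s * Y s \<omega> = indicator {-T<..<0} s * (exp (lam * s) * N s \<omega>)" for s \<omega>
    by (auto simp: w_def Y_def indicator_def simp flip: exp_add mult.assoc)
  note P = process_integral[OF fin prob_space_axioms Ymeas Ysq Yb]
  have NY: "(\<lambda>s. Y s \<omega>) \<in> borel_measurable lborel" if "\<omega> \<in> space M" for \<omega>
    using measurable_Pair1[OF N_joint that] unfolding Y_def by simp
  have I: "(\<integral>s. Y s \<omega> \<partial>\<nu>) = (LBINT s:{-T<..<0}. exp (lam * s) * N s \<omega>)" if "\<omega> \<in> space M" for \<omega>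
    unfolding \<nu>_def set_lebesgue_integral_def using NY[OF that] by (subst integral_density) (auto simp: w0 conv)
  show "AE \<omega> in M. set_integrable lborel {-T<..<0} (\<lambda>s. exp (lam * s) * N s \<omega>)"
    using P(1) AE_space
  proof eventually_elim
    case (elim \<omega>)
    then show ?case using NY[OF elim(2)] unfolding \<nu>_def set_integrable_def
      by (subst (asm) integrable_density) (auto simp: w0 conv)
  qed
  show "sq_integrable M (\<lambda>\<omega>. LBINT s:{-T<..<0}. exp (lam * s) * N s \<omega>)"
    using P(2) sq_integrable_cong[of M "\<lambda>\<omega>. \<integral>s. Y s \<omega> \<partial>\<nu>", OF I] by simp
  have "expectation (\<lambda>\<omega>. (LBINT s:{-T<..<0}. exp (lam * s) * N s \<omega>)\<^sup>2) = expectation (\<lambda>\<omega>. (\<integral>s. Y s \<omega> \<partial>\<nu>)\<^sup>2)"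
    by (rule Bochner_Integration.integral_cong) (simp_all add: I)
  also have "\<dots> \<le> \<bar>C\<bar> * (1 + 2 / lam\<^sup>2) * (measure \<nu> (space \<nu>))\<^sup>2" by (rule P(3))
  also have "\<dots> \<le> \<bar>C\<bar> * (1 + 2 / lam\<^sup>2) * (2 / lam)\<^sup>2"
    using mv by (intro mult_left_mono power_mono) (auto intro!: mult_nonneg_nonneg add_nonneg_nonneg)
  finally show "expectation (\<lambda>\<omega>. (LBINT s:{-T<..<0}. exp (lam * s) * N s \<omega>)\<^sup>2) \<le> \<bar>C\<bar> * (1 + 2 / lam\<^sup>2) * (2 / lam)\<^sup>2" .
qed

text \<open>The exceptional null set of the equation depends on the time. Fubini for null sets
  gives, for almost every outcome, the equation at almost all times in (-T, 0), which is what
  \<open>path_identity\<close> asks for besides the equation at -T. Most of the work is joint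
  measurability of the exceptional set.\<close>

lemma X0_decomposition:
  assumes T: "T > 0"
  shows "AE \<omega> in M. X 0 \<omega> = exp (- lam * T) * (X (-T) \<omega> - N (-T) \<omega>) - lam * (LBINT s:{-T<..<0}. exp (lam * s) * N s \<omega>)"
proof -
  let ?P = "\<lambda>s \<omega>. -T < s \<and> s < 0 \<longrightarrow> X s \<omega> = X 0 \<omega> + lam * (LBINT u:{s<..<0}. X u \<omega>) + N s \<omega>"
  interpret LM: pair_sigma_finite lborel M ..
  have sets: "sets (lborel \<Otimes>\<^sub>M M) = sets (borel \<Otimes>\<^sub>M M)" by (rule sets_pair_measure_cong) auto
  have mI: "(\<lambda>p. LBINT u:{fst p<..<0}. X u (snd p)) \<in> borel_measurable (borel \<Otimes>\<^sub>M M)"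
  proof -
    have "(\<lambda>p. \<integral>u. (if fst p < u \<and> u < 0 then X u (snd p) else 0) \<partial>lborel) \<in> borel_measurable (borel \<Otimes>\<^sub>M M)"
    proof (rule lborel.borel_measurable_lebesgue_integral)
      have [measurable]: "(\<lambda>x. X (snd x) (snd (fst x))) \<in> borel_measurable ((borel \<Otimes>\<^sub>M M) \<Otimes>\<^sub>M lborel)"
        using measurable_compose[OF _ X_joint, of "\<lambda>x. (snd x, snd (fst x))" "(borel \<Otimes>\<^sub>M M) \<Otimes>\<^sub>M lborel"] by simp
      show "(\<lambda>(p, u). if fst p < u \<and> u < 0 then X u (snd p) else 0) \<in> borel_measurable ((borel \<Otimes>\<^sub>M M) \<Otimes>\<^sub>M lborel)"
        unfolding case_prod_beta' by measurable
    qed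
    also have "(\<lambda>p. \<integral>u. (if fst p < u \<and> u < 0 then X u (snd p) else 0) \<partial>lborel) = (\<lambda>p. LBINT u:{fst p<..<0}. X u (snd p))"
      unfolding set_lebesgue_integral_def
      by (intro ext Bochner_Integration.integral_cong) (auto simp: indicator_def)
    finally show ?thesis .
  qed
  have mX0: "(\<lambda>p. X 0 (snd p)) \<in> borel_measurable (borel \<Otimes>\<^sub>M M)" by measurable
  note [measurable] = mI mX0
  have "{p \<in> space (borel \<Otimes>\<^sub>M M). ?P (fst p) (snd p)} \<in> sets (borel \<Otimes>\<^sub>M M)" by measurable
  then have mP: "{p \<in> space (lborel \<Otimes>\<^sub>M M). ?P (fst p) (snd p)} \<in> sets (lborel \<Otimes>\<^sub>M M)"
    unfolding sets by (simp add: space_pair_measure)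
  have "AE s in lborel. AE \<omega> in M. ?P s \<omega>"
  proof (rule AE_I2)
    fix s :: real
    show "AE \<omega> in M. ?P s \<omega>"
    proof (cases "-T < s \<and> s < 0")
      case True
      then have "s < 0" by simp
      from eq_neg[OF this] show ?thesis by eventually_elim auto
    qed auto
  qed
  then have ae: "AE \<omega> in M. AE s in lborel. ?P s \<omega>"
    using LM.AE_commute[OF mP] by simp
  have "-T < 0" using T by simp
  show ?thesis using ae eq_neg[OF \<open>-T < 0\<close>] weighted_noise(1)[OF T] AE_space
  proof eventually_elim
    case (elim \<omega>)
    show ?case
      by (rule path_identity[OF lam T _ _ elim(1)]) (use elim in auto)
  qed
qed

text \<open>Not centred: \<open>mean_X\<close> later makes it the autocovariance.\<close>

definition r :: "real \<Rightarrow> real" where "r t = expectation (\<lambda>\<omega>. X t \<omega> * X 0 \<omega>)"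

definition I :: "real \<Rightarrow> 'a \<Rightarrow> real" where "I t \<omega> = (LBINT u:{0<..<t}. X u \<omega>)"

text \<open>\<open>X 0\<close> equals \<open>e n * X (- real (Suc n)) + Y n\<close> with
  \<open>Y n\<close> bounded in L2 uniformly in \<open>n\<close>. The second moment of
  \<open>X\<close> may still be infinite at this point, so squares are truncated at
  \<open>K\<close>. Stationarity replaces the past value by \<open>X 0\<close>, dominated
  convergence removes that term as \<open>e n\<close> tends to 0, and 2 * B remains for every
  \<open>K\<close>.\<close>

lemma truncated_second_moment:
  "\<exists>B. \<forall>K\<ge>0. expectation (\<lambda>\<omega>. min ((X 0 \<omega>)\<^sup>2) K) \<le> B"
proof -
  define c where "c = \<bar>C\<bar> * (1 + 2 / lam\<^sup>2)"
  define B where "B = 2 * c + 2 * (lam\<^sup>2 * (c * (2 / lam)\<^sup>2))"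
  define A where "A = (\<lambda>n \<omega>. LBINT s:{- real (Suc n)<..<0}. exp (lam * s) * N s \<omega>)"
  define e where "e = (\<lambda>n. exp (- lam * real (Suc n)))"
  define Y where "Y = (\<lambda>n \<omega>. - e n * N (- real (Suc n)) \<omega> - lam * A n \<omega>)"
  have c0: "c \<ge> 0" by (simp add: c_def add_nonneg_nonneg)
  have sqA: "sq_integrable M (A n)" for n unfolding A_def by (rule weighted_noise) simp
  have EA: "expectation (\<lambda>\<omega>. (A n \<omega>)\<^sup>2) \<le> c * (2 / lam)\<^sup>2" for n
    unfolding A_def c_def by (rule weighted_noise) simp
  have sqY: "sq_integrable M (Y n)" for n
    unfolding Y_def by (intro sq_integrable_diff sq_integrable_cmult sqN sqA)
  have EN: "(e n)\<^sup>2 * V (- real (Suc n)) \<le> c" for n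
  proof -
    have "e n * V (- real (Suc n)) \<le> e n * (\<bar>C\<bar> * (1 + (- real (Suc n))\<^sup>2))"
      by (rule mult_left_mono[OF growth_abs]) (simp add: e_def)
    also have "\<dots> = \<bar>C\<bar> * (exp (lam * (- real (Suc n))) * (1 + (- real (Suc n))\<^sup>2))" by (simp add: e_def del: of_nat_Suc)
    also have "\<dots> \<le> c" unfolding c_def by (intro mult_left_mono exp_weight_bound lam) auto
    finally have "e n * (e n * V (- real (Suc n))) \<le> e n * c"
      by (rule mult_left_mono) (simp add: e_def)
    also have "\<dots> \<le> c" using c0 lam by (intro mult_left_le_one_le) (auto simp: e_def mult_le_0_iff)
    finally show ?thesis by (simp add: power2_eq_square mult.assoc)
  qed
  have EY: "expectation (\<lambda>\<omega>. (Y n \<omega>)\<^sup>2) \<le> B" for n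
  proof -
    have "expectation (\<lambda>\<omega>. (Y n \<omega>)\<^sup>2) \<le> expectation (\<lambda>\<omega>. 2 * ((e n)\<^sup>2 * (N (- real (Suc n)) \<omega>)\<^sup>2) + 2 * (lam\<^sup>2 * (A n \<omega>)\<^sup>2))"
    proof (rule integral_mono)
      show "integrable M (\<lambda>\<omega>. 2 * ((e n)\<^sup>2 * (N (- real (Suc n)) \<omega>)\<^sup>2) + 2 * (lam\<^sup>2 * (A n \<omega>)\<^sup>2))"
        using sq_integrable_square[OF sqA] sq_integrable_square[OF sqN] by simp
      have "(- a - b)\<^sup>2 \<le> 2 * a\<^sup>2 + 2 * b\<^sup>2" for a b :: real
        using zero_le_power2[of "a - b"] by (simp add: power2_eq_square algebra_simps)
      from this[of "e n * N (- real (Suc n)) _" "lam * A n _"]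
      show "(Y n \<omega>)\<^sup>2 \<le> 2 * ((e n)\<^sup>2 * (N (- real (Suc n)) \<omega>)\<^sup>2) + 2 * (lam\<^sup>2 * (A n \<omega>)\<^sup>2)" for \<omega>
        by (simp add: Y_def power_mult_distrib)
    qed (rule sq_integrable_square[OF sqY])
    also have "\<dots> = 2 * ((e n)\<^sup>2 * V (- real (Suc n))) + 2 * (lam\<^sup>2 * expectation (\<lambda>\<omega>. (A n \<omega>)\<^sup>2))"
      using sq_integrable_square[OF sqA] sq_integrable_square[OF sqN] by (simp add: varN)
    also have "\<dots> \<le> B" unfolding B_def using EN[of n] EA[of n]
      by (intro add_mono mult_left_mono) auto
    finally show ?thesis .
  qed
  have dec: "AE \<omega> in M. X 0 \<omega> = e n * X (- real (Suc n)) \<omega> + Y n \<omega>" for n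
    using X0_decomposition[of "real (Suc n)"] unfolding e_def Y_def A_def
    by (simp add: algebra_simps)
  have main: "expectation (\<lambda>\<omega>. min ((X 0 \<omega>)\<^sup>2) K) \<le> 2 * B" if K: "K \<ge> 0" for K
  proof -
    have bi: "integrable M (\<lambda>\<omega>. min ((u * X s \<omega>)\<^sup>2) K)" for u s
      by (rule integrable_const_bound[where B=K]) (use K in auto)
    have step: "expectation (\<lambda>\<omega>. min ((X 0 \<omega>)\<^sup>2) K) \<le> 2 * expectation (\<lambda>\<omega>. min ((e n * X 0 \<omega>)\<^sup>2) K) + 2 * B" for n
    proof -
      have "expectation (\<lambda>\<omega>. min ((X 0 \<omega>)\<^sup>2) K) \<le>
        expectation (\<lambda>\<omega>. 2 * min ((e n * X (- real (Suc n)) \<omega>)\<^sup>2) K + 2 * (Y n \<omega>)\<^sup>2)"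
      proof (rule integral_mono_AE)
        show "integrable M (\<lambda>\<omega>. min ((X 0 \<omega>)\<^sup>2) K)" using bi[of 1 0] by simp
        show "integrable M (\<lambda>\<omega>. 2 * min ((e n * X (- real (Suc n)) \<omega>)\<^sup>2) K + 2 * (Y n \<omega>)\<^sup>2)"
          using bi sq_integrable_square[OF sqY] by simp
        \<comment> \<open>Either the square of \<open>a\<close> is at most \<open>K\<close> and the
          bound for a squared sum applies, or the first term on the right already equals 2 *
          K.\<close>
        have *: "min ((a + b)\<^sup>2) K \<le> 2 * min (a\<^sup>2) K + 2 * b\<^sup>2" for a b :: real
        proof -
          have "(a + b)\<^sup>2 \<le> 2 * a\<^sup>2 + 2 * b\<^sup>2"
            using zero_le_power2[of "a - b"] by (simp add: power2_eq_square algebra_simps)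
          moreover have "min ((a + b)\<^sup>2) K \<le> (a + b)\<^sup>2" "min ((a + b)\<^sup>2) K \<le> K" by simp_all
          ultimately show ?thesis using K zero_le_power2[of b] by (cases "a\<^sup>2 \<le> K") linarith+
        qed
        show "AE \<omega> in M. min ((X 0 \<omega>)\<^sup>2) K \<le> 2 * min ((e n * X (- real (Suc n)) \<omega>)\<^sup>2) K + 2 * (Y n \<omega>)\<^sup>2"
          using dec[of n] by eventually_elim (metis *)
      qed
      also have "\<dots> = 2 * expectation (\<lambda>\<omega>. min ((e n * X (- real (Suc n)) \<omega>)\<^sup>2) K) + 2 * expectation (\<lambda>\<omega>. (Y n \<omega>)\<^sup>2)"
        using bi sq_integrable_square[OF sqY] by simp
      also have "expectation (\<lambda>\<omega>. min ((e n * X (- real (Suc n)) \<omega>)\<^sup>2) K) = expectation (\<lambda>\<omega>. min ((e n * X 0 \<omega>)\<^sup>2) K)"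
        using shift_invariant(1)[of "\<lambda>p. min ((e n * fst p)\<^sup>2) K" 0 "- real (Suc n)" 0] by simp
      finally show ?thesis using EY[of n] by linarith
    qed
    have "(\<lambda>n. expectation (\<lambda>\<omega>. min ((e n * X 0 \<omega>)\<^sup>2) K)) \<longlonglongrightarrow> expectation (\<lambda>\<omega>. 0)"
    proof (rule integral_dominated_convergence[where w="\<lambda>_. K"])
      have e: "e \<longlonglongrightarrow> 0"
      proof -
        have "(\<lambda>n. exp (- lam) ^ Suc n) \<longlonglongrightarrow> 0"
          using lam by (intro LIMSEQ_Suc LIMSEQ_power_zero) auto
        moreover have "e = (\<lambda>n. exp (- lam) ^ Suc n)"
          unfolding e_def by (simp add: fun_eq_iff exp_of_nat_mult[symmetric] mult.commute del: power_Suc of_nat_Suc)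
        ultimately show ?thesis by simp
      qed
      have "(\<lambda>n. min ((e n * X 0 \<omega>)\<^sup>2) K) \<longlonglongrightarrow> min ((0 * X 0 \<omega>)\<^sup>2) K" for \<omega>
        by (intro tendsto_intros e)
      then show "AE \<omega> in M. (\<lambda>n. min ((e n * X 0 \<omega>)\<^sup>2) K) \<longlonglongrightarrow> 0" using K by simp
    qed (use K in auto)
    then have "(\<lambda>n. 2 * expectation (\<lambda>\<omega>. min ((e n * X 0 \<omega>)\<^sup>2) K) + 2 * B) \<longlonglongrightarrow> 2 * 0 + 2 * B"
      by (intro tendsto_intros) simp
    then show ?thesis using step by (intro LIMSEQ_le_const) auto
  qed
  then show ?thesis by blast
qed

text \<open>Fatou's lemma along the truncation levels K = n at time 0, then stationarity.\<close>

lemma X_sq: "sq_integrable M (X t)"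
proof -
  obtain B where B: "\<And>K. K \<ge> 0 \<Longrightarrow> expectation (\<lambda>\<omega>. min ((X 0 \<omega>)\<^sup>2) K) \<le> B"
    using truncated_second_moment by blast
  have B0: "B \<ge> 0" using B[of 0] by simp
  have "(\<integral>\<^sup>+ \<omega>. ennreal ((X 0 \<omega>)\<^sup>2) \<partial>M) = (\<integral>\<^sup>+ \<omega>. liminf (\<lambda>n. ennreal (min ((X 0 \<omega>)\<^sup>2) (real n))) \<partial>M)"
  proof (rule nn_integral_cong)
    fix \<omega>
    obtain m :: nat where m: "(X 0 \<omega>)\<^sup>2 \<le> real m" using real_arch_simple by blast
    have "\<forall>\<^sub>F n in sequentially. ennreal (min ((X 0 \<omega>)\<^sup>2) (real n)) = ennreal ((X 0 \<omega>)\<^sup>2)"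
      using eventually_ge_at_top[of m] by eventually_elim (use m in \<open>auto simp: min_def\<close>)
    then have "(\<lambda>n. ennreal (min ((X 0 \<omega>)\<^sup>2) (real n))) \<longlonglongrightarrow> ennreal ((X 0 \<omega>)\<^sup>2)"
      by (rule tendsto_eventually)
    then show "ennreal ((X 0 \<omega>)\<^sup>2) = liminf (\<lambda>n. ennreal (min ((X 0 \<omega>)\<^sup>2) (real n)))"
      using lim_imp_Liminf[OF sequentially_bot] by metis
  qed
  also have "\<dots> \<le> liminf (\<lambda>n. \<integral>\<^sup>+ \<omega>. ennreal (min ((X 0 \<omega>)\<^sup>2) (real n)) \<partial>M)"
    by (rule nn_integral_liminf) simp
  also have "\<dots> \<le> ennreal B"
  proof (rule Liminf_le)
    show "\<forall>\<^sub>F n in sequentially. (\<integral>\<^sup>+ \<omega>. ennreal (min ((X 0 \<omega>)\<^sup>2) (real n)) \<partial>M) \<le> ennreal B"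
    proof (intro always_eventually allI)
      fix n
      have "integrable M (\<lambda>\<omega>. min ((X 0 \<omega>)\<^sup>2) (real n))"
        by (rule integrable_const_bound[where B="real n"]) auto
      then have "(\<integral>\<^sup>+ \<omega>. ennreal (min ((X 0 \<omega>)\<^sup>2) (real n)) \<partial>M) = ennreal (expectation (\<lambda>\<omega>. min ((X 0 \<omega>)\<^sup>2) (real n)))"
        by (intro nn_integral_eq_integral) auto
      also have "\<dots> \<le> ennreal B" by (intro ennreal_leI B) simp
      finally show "(\<integral>\<^sup>+ \<omega>. ennreal (min ((X 0 \<omega>)\<^sup>2) (real n)) \<partial>M) \<le> ennreal B" .
    qed
  qed simp
  finally have "(\<integral>\<^sup>+ \<omega>. ennreal ((X 0 \<omega>)\<^sup>2) \<partial>M) < \<infinity>"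
    using ennreal_less_top le_less_trans by fastforce
  then have "integrable M (\<lambda>\<omega>. (X 0 \<omega>)\<^sup>2)" by (intro integrableI_nonneg) auto
  then have "integrable M (\<lambda>\<omega>. (X t \<omega>)\<^sup>2)"
    using shift_invariant(2)[of "\<lambda>p. (fst p)\<^sup>2" 0 t 0] by simp
  then show ?thesis by (simp add: sq_integrable_def)
qed

section \<open>The autocovariance and the variogram identity\<close>

lemma expectation_X_mult: "expectation (\<lambda>\<omega>. X s \<omega> * X t \<omega>) = r (s - t)"
  using shift_invariant(1)[of "\<lambda>p. fst p * snd p" "s - t" t 0] by (simp add: r_def)

lemma r_even: "r (- t) = r t"
  using expectation_X_mult[of 0 t] by (simp add: r_def mult.commute)

lemma r_bound: "\<bar>r t\<bar> \<le> r 0"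
proof -
  have "(r t)\<^sup>2 \<le> r 0 * r 0"
    using Cauchy_Schwarz_integral[OF X_sq[of t] X_sq[of 0]] expectation_X_mult[of t t]
      expectation_X_mult[of t 0] expectation_X_mult[of 0 0] by (simp add: power2_eq_square)
  moreover have "r 0 \<ge> 0" by (simp add: r_def flip: power2_eq_square)
  ultimately show ?thesis by (metis abs_le_square_iff abs_of_nonneg power2_eq_square)
qed

lemma r_measurable[measurable]: "r \<in> borel_measurable borel"
proof -
  have [measurable]: "(\<lambda>p. X (fst p) (snd p)) \<in> borel_measurable (borel \<Otimes>\<^sub>M M)" by (rule X_joint)
  show ?thesis unfolding r_def[abs_def]
    by (rule borel_measurable_lebesgue_integral) (simp add: case_prod_beta')
qed

lemma I_props:
  assumes t: "t > 0"
  shows "sq_integrable M (I t)" and "expectation (\<lambda>\<omega>. (I t \<omega>)\<^sup>2) \<le> r 0 * t\<^sup>2"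
    and "\<And>G. sq_integrable M G \<Longrightarrow> expectation (\<lambda>\<omega>. I t \<omega> * G \<omega>) = (LBINT s:{0<..<t}. expectation (\<lambda>\<omega>. X s \<omega> * G \<omega>))"
proof -
  \<comment> \<open>Lebesgue measure on (0, t), in the form of a density so that its sigma-algebra
    is still that of \<open>borel\<close>.\<close>
  define \<nu> where "\<nu> = density lborel (\<lambda>s. ennreal (indicator {0<..<t} s))"
  have em: "emeasure \<nu> (space \<nu>) = ennreal t"
    unfolding \<nu>_def using t by (subst emeasure_density) (auto simp: ennreal_indicator)
  have fin: "finite_measure \<nu>" by (rule finite_measureI) (simp add: em)
  have mv: "measure \<nu> (space \<nu>) = t" using t by (simp add: measure_def em)
  have sets: "sets \<nu> = sets borel" by (simp add: \<nu>_def)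
  have Xm: "(\<lambda>(s, \<omega>). X s \<omega>) \<in> borel_measurable (\<nu> \<Otimes>\<^sub>M M)"
    using X_joint sets by (simp add: case_prod_beta' cong: measurable_cong_sets sets_pair_measure_cong)
  have b: "expectation (\<lambda>\<omega>. (X s \<omega>)\<^sup>2) \<le> r 0" for s
    using expectation_X_mult[of s s] by (simp add: power2_eq_square)
  note P = process_integral[OF fin prob_space_axioms Xm sq_integrable_square[OF X_sq] b]
  have eq: "(\<integral>s. f s \<partial>\<nu>) = (LBINT s:{0<..<t}. f s)" if "f \<in> borel_measurable borel" for f :: "real \<Rightarrow> real"
    unfolding \<nu>_def set_lebesgue_integral_def using that by (subst integral_density) auto
  have Ieq: "(\<integral>s. X s \<omega> \<partial>\<nu>) = I t \<omega>" if "\<omega> \<in> space M" for \<omega>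
    unfolding I_def by (rule eq) (rule X_path[OF that])
  show "sq_integrable M (I t)"
    using P(2) sq_integrable_cong[of M "\<lambda>\<omega>. \<integral>s. X s \<omega> \<partial>\<nu>" "I t"] Ieq by simp
  have "expectation (\<lambda>\<omega>. (I t \<omega>)\<^sup>2) = expectation (\<lambda>\<omega>. (\<integral>s. X s \<omega> \<partial>\<nu>)\<^sup>2)"
    by (rule Bochner_Integration.integral_cong) (simp_all add: Ieq)
  then show "expectation (\<lambda>\<omega>. (I t \<omega>)\<^sup>2) \<le> r 0 * t\<^sup>2" using P(3) mv by simp
  fix G assume G: "sq_integrable M G"
  have [measurable]: "G \<in> borel_measurable M" using G by (simp add: sq_integrable_def)
  have "expectation (\<lambda>\<omega>. I t \<omega> * G \<omega>) = expectation (\<lambda>\<omega>. (\<integral>s. X s \<omega> \<partial>\<nu>) * G \<omega>)"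
    by (rule Bochner_Integration.integral_cong) (simp_all add: Ieq)
  also have "\<dots> = (\<integral>s. expectation (\<lambda>\<omega>. X s \<omega> * G \<omega>) \<partial>\<nu>)" by (rule P(4)[OF G])
  also have "\<dots> = (LBINT s:{0<..<t}. expectation (\<lambda>\<omega>. X s \<omega> * G \<omega>))"
  proof (rule eq)
    show "(\<lambda>s. expectation (\<lambda>\<omega>. X s \<omega> * G \<omega>)) \<in> borel_measurable borel"
      by (rule borel_measurable_lebesgue_integral) (simp add: case_prod_beta')
  qed
  finally show "expectation (\<lambda>\<omega>. I t \<omega> * G \<omega>) = (LBINT s:{0<..<t}. expectation (\<lambda>\<omega>. X s \<omega> * G \<omega>))" .
qed

text \<open>Expectations in the equation at time 1: \<open>X 1\<close>, \<open>X 0\<close> and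
  \<open>I 1\<close> share the mean \<open>m\<close>, whence 0 = lam * m.\<close>

lemma mean_X: "expectation (X t) = 0"
proof -
  define m where "m = expectation (X 0)"
  have st: "expectation (X s) = m" for s
    using shift_invariant(1)[of "\<lambda>p. fst p" 0 s 0] by (simp add: m_def)
  have i: "integrable M f" if "sq_integrable M f" for f
    using square_integrable_imp_integrable that by (auto simp: sq_integrable_def)
  have "expectation (\<lambda>\<omega>. I 1 \<omega> * 1) = (LBINT s:{0<..<1}. expectation (\<lambda>\<omega>. X s \<omega> * 1))"
    by (rule I_props(3)) (auto simp: sq_integrable_def)
  then have EI: "expectation (I 1) = m" by (simp add: st set_lebesgue_integral_def)
  have "0 = expectation (N 1)" by (simp add: meanN)
  also have "\<dots> = expectation (\<lambda>\<omega>. X 1 \<omega> - X 0 \<omega> + lam * I 1 \<omega>)"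
    by (rule integral_cong_AE) (use eq_pos[of 1] I_props(1)[of 1] in \<open>auto simp: I_def[symmetric] sq_integrable_def\<close>)
  also have "\<dots> = lam * m"
    using i[OF X_sq] i[OF I_props(1)[of 1]] by (simp add: st EI)
  finally show ?thesis using lam by (simp add: st)
qed

lemma autocov_eq: "autocov M X t = r t"
  by (simp add: autocov_def covariance_def mean_X r_def)

lemma variogram_identity:
  assumes t: "t > 0"
  shows "V t = 2 * (r 0 - r t) + lam\<^sup>2 * expectation (\<lambda>\<omega>. (I t \<omega>)\<^sup>2)"
proof -
  have m: "integrable M (\<lambda>\<omega>. X s \<omega> * X u \<omega>)" "integrable M (\<lambda>\<omega>. I t \<omega> * X u \<omega>)" "integrable M (\<lambda>\<omega>. I t \<omega> * I t \<omega>)" for s u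
    by (intro sq_integrable_mult X_sq I_props(1)[OF t])+
  \<comment> \<open>The two integrals are those of r (t - s) and r s over (0, t), by evenness of
    \<open>r\<close>; the reflection of the interval exchanges them.\<close>
  have cross: "expectation (\<lambda>\<omega>. I t \<omega> * X t \<omega>) = expectation (\<lambda>\<omega>. I t \<omega> * X 0 \<omega>)"
  proof -
    have "expectation (\<lambda>\<omega>. I t \<omega> * X t \<omega>) = (LBINT s:{0<..<t}. r (s - t))"
      using I_props(3)[OF t X_sq[of t]] by (simp add: expectation_X_mult)
    also have "\<dots> = (\<integral>s. indicator {0<..<t} s * r (t - s) \<partial>lborel)"
      unfolding set_lebesgue_integral_def
      by (rule Bochner_Integration.integral_cong) (simp, metis minus_diff_eq r_even real_scaleR_def)
    also have "\<dots> = (\<integral>s. indicator {0<..<t} s * r s \<partial>lborel)"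
      by (subst lborel_integral_real_affine[where c="-1" and t=t])
         (auto intro!: Bochner_Integration.integral_cong simp: indicator_def)
    also have "\<dots> = expectation (\<lambda>\<omega>. I t \<omega> * X 0 \<omega>)"
      using I_props(3)[OF t X_sq[of 0]] by (simp add: expectation_X_mult set_lebesgue_integral_def)
    finally show ?thesis .
  qed
  have "V t = expectation (\<lambda>\<omega>. (N t \<omega>)\<^sup>2)" by (simp add: varN)
  also have "\<dots> = expectation (\<lambda>\<omega>. X t \<omega> * X t \<omega> - 2 * (X t \<omega> * X 0 \<omega>) + X 0 \<omega> * X 0 \<omega> +
        2 * lam * (I t \<omega> * X t \<omega>) - 2 * lam * (I t \<omega> * X 0 \<omega>) + lam\<^sup>2 * (I t \<omega> * I t \<omega>))"
  proof (rule integral_cong_AE)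
    show "AE \<omega> in M. (N t \<omega>)\<^sup>2 = X t \<omega> * X t \<omega> - 2 * (X t \<omega> * X 0 \<omega>) + X 0 \<omega> * X 0 \<omega> +
        2 * lam * (I t \<omega> * X t \<omega>) - 2 * lam * (I t \<omega> * X 0 \<omega>) + lam\<^sup>2 * (I t \<omega> * I t \<omega>)"
      using eq_pos[OF t] unfolding I_def[symmetric]
      by eventually_elim (erule ssubst, simp add: power2_eq_square algebra_simps)
  qed (use I_props(1)[OF t] in \<open>auto simp: sq_integrable_def\<close>)
  also have "\<dots> = r 0 - 2 * r t + r 0 + 2 * lam * expectation (\<lambda>\<omega>. I t \<omega> * X t \<omega>)
      - 2 * lam * expectation (\<lambda>\<omega>. I t \<omega> * X 0 \<omega>) + lam\<^sup>2 * expectation (\<lambda>\<omega>. I t \<omega> * I t \<omega>)"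
    using m by (simp add: expectation_X_mult)
  finally show ?thesis by (simp add: cross power2_eq_square)
qed

lemma I_second_moment:
  assumes t: "t > 0"
  shows "expectation (\<lambda>\<omega>. (I t \<omega>)\<^sup>2) = (LBINT s:{0<..<t}. LBINT u:{0<..<t}. r (u - s))"
proof -
  have "expectation (\<lambda>\<omega>. I t \<omega> * I t \<omega>) = (LBINT s:{0<..<t}. expectation (\<lambda>\<omega>. X s \<omega> * I t \<omega>))"
    by (rule I_props(3)[OF t I_props(1)[OF t]])
  also have "\<dots> = (LBINT s:{0<..<t}. LBINT u:{0<..<t}. r (u - s))"
    using I_props(3)[OF t X_sq] by (simp add: mult.commute[of _ "I t _"] expectation_X_mult)
  finally show ?thesis by (simp add: power2_eq_square)
qed

end

section \<open>Increments of the kernel\<close>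

lemma incr_var_uminus: "incr_var f (- t) = incr_var f t"
  unfolding incr_var_def
  by (subst lborel_integral_real_affine[where c=1 and t=t]) (auto simp: power2_commute add.commute)

lemma incr_var_cmult: "incr_var (\<lambda>x. c * f x) t = c\<^sup>2 * incr_var f t"
proof -
  have "(c * f (t + x) - c * f x)\<^sup>2 = c\<^sup>2 * (f (t + x) - f x)\<^sup>2" for x
    by (simp add: power_mult_distrib flip: right_diff_distrib)
  then show ?thesis by (simp add: incr_var_def)
qed

lemma incr_var_nonneg: "incr_var f t \<ge> 0"
  by (simp add: incr_var_def)

text \<open>The increment over n * h telescopes into \<open>n\<close> translates of the increment
  over \<open>h\<close>. Cauchy-Schwarz for the sum gives one factor \<open>n\<close>, translation
  invariance the other.\<close>

lemma incr_var_multiple: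
  assumes int: "\<And>t. integrable lborel (\<lambda>x. (f (t + x) - f x)\<^sup>2)"
  shows "incr_var f (real n * h) \<le> (real n)\<^sup>2 * incr_var f h"
proof -
  have tr: "integrable lborel (\<lambda>x. (f (real (Suc i) * h + x) - f (real i * h + x))\<^sup>2)"
    "(\<integral>x. (f (real (Suc i) * h + x) - f (real i * h + x))\<^sup>2 \<partial>lborel) = incr_var f h" for i
  proof -
    have e: "(f (real (Suc i) * h + x) - f (real i * h + x))\<^sup>2 = (f (h + (real i * h + 1 * x)) - f (real i * h + 1 * x))\<^sup>2" for x
      by (simp add: algebra_simps)
    show "integrable lborel (\<lambda>x. (f (real (Suc i) * h + x) - f (real i * h + x))\<^sup>2)"
      unfolding e using int[of h] by (subst lborel_integrable_real_affine_iff) auto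
    show "(\<integral>x. (f (real (Suc i) * h + x) - f (real i * h + x))\<^sup>2 \<partial>lborel) = incr_var f h"
      unfolding e incr_var_def by (subst (2) lborel_integral_real_affine[where c=1 and t="real i * h"]) auto
  qed
  have "incr_var f (real n * h) \<le> (\<integral>x. real n * (\<Sum>i<n. (f (real (Suc i) * h + x) - f (real i * h + x))\<^sup>2) \<partial>lborel)"
    unfolding incr_var_def
  proof (rule integral_mono)
    show "integrable lborel (\<lambda>x. (f (real n * h + x) - f x)\<^sup>2)" by (rule int)
    show "integrable lborel (\<lambda>x. real n * (\<Sum>i<n. (f (real (Suc i) * h + x) - f (real i * h + x))\<^sup>2))"
      by (intro integrable_mult_right Bochner_Integration.integrable_sum tr)
    fix x
    have "f (real n * h + x) - f x = (\<Sum>i<n. f (real (Suc i) * h + x) - f (real i * h + x))"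
      using sum_lessThan_telescope[of "\<lambda>i. f (real i * h + x)" n] by simp
    also have "(\<dots>)\<^sup>2 = (\<Sum>i<n. 1 * (f (real (Suc i) * h + x) - f (real i * h + x)))\<^sup>2" by simp
    also have "\<dots> \<le> (\<Sum>i<n. 1\<^sup>2) * (\<Sum>i<n. (f (real (Suc i) * h + x) - f (real i * h + x))\<^sup>2)"
      by (rule Cauchy_Schwarz_ineq_sum)
    finally show "(f (real n * h + x) - f x)\<^sup>2 \<le> real n * (\<Sum>i<n. (f (real (Suc i) * h + x) - f (real i * h + x))\<^sup>2)"
      by simp
  qed
  also have "\<dots> = real n * (\<Sum>i<n. incr_var f h)"
    using tr by (simp del: of_nat_Suc)
  finally show ?thesis by (simp add: power2_eq_square)
qed

text \<open>A bound near 0 propagates: \<open>t\<close> is reached in about t / e steps shorter than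
  \<open>e\<close>, and the cost is quadratic in the number of steps. This supplies the growth
  hypothesis of \<open>stationary_qou\<close>.\<close>

lemma incr_var_growth:
  assumes int: "\<And>t. integrable lborel (\<lambda>x. (f (t + x) - f x)\<^sup>2)"
    and "e > 0" and small: "\<And>t. 0 < t \<Longrightarrow> t < e \<Longrightarrow> incr_var f t \<le> c"
  shows "\<exists>C. \<forall>t. incr_var f t \<le> C * (1 + t\<^sup>2)"
proof -
  have c0: "c \<ge> 0" using small[of "e/2"] \<open>e > 0\<close> incr_var_nonneg[of f "e/2"] by simp
  define C where "C = max (8 * c / e\<^sup>2) (2 * c)"
  have pos: "incr_var f t \<le> C * (1 + t\<^sup>2)" if t: "t > 0" for t
  proof -
    \<comment> \<open>The successor makes \<open>n\<close> strictly larger than t / e, so the step t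
      / n is strictly below \<open>e\<close>.\<close>
    define n where "n = Suc (nat \<lfloor>t / e\<rfloor>)"
    have "real n = of_int \<lfloor>t / e\<rfloor> + 1" using t \<open>e > 0\<close> by (simp add: n_def)
    then have n: "t / e < real n" "real n \<le> t / e + 1" by linarith+
    have n0: "real n > 0" unfolding n_def by (simp only: of_nat_0_less_iff zero_less_Suc)
    have "incr_var f t = incr_var f (real n * (t / real n))" using n0 by simp
    also have "\<dots> \<le> (real n)\<^sup>2 * incr_var f (t / real n)" by (rule incr_var_multiple[OF int])
    also have "\<dots> \<le> (real n)\<^sup>2 * c"
    proof (rule mult_left_mono[OF small])
      show "0 < t / real n" using t n0 by simp
      show "t / real n < e" using n(1) n0 \<open>e > 0\<close> by (simp add: field_simps)
    qed simp
    also have "\<dots> \<le> (t / e + 1)\<^sup>2 * c" using n(2) c0 by (intro mult_right_mono power_mono) auto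
    also have "\<dots> \<le> (2 * (t / e)\<^sup>2 + 2) * c"
    proof -
      have "(u + 1)\<^sup>2 \<le> 2 * u\<^sup>2 + 2" for u :: real
        using zero_le_power2[of "u - 1"] by (simp add: power2_eq_square algebra_simps)
      then show ?thesis using c0 by (rule mult_right_mono)
    qed
    also have "\<dots> = (2 * c / e\<^sup>2) * t\<^sup>2 + (2 * c) * 1" by (simp add: power_divide algebra_simps)
    also have "\<dots> \<le> C * t\<^sup>2 + C * 1"
    proof (intro add_mono mult_right_mono)
      have "2 * c / e\<^sup>2 \<le> 8 * c / e\<^sup>2" using c0 by (intro divide_right_mono) auto
      then show "2 * c / e\<^sup>2 \<le> C" by (simp add: C_def)
      show "2 * c \<le> C" by (simp add: C_def)
    qed auto
    finally show ?thesis by (simp add: algebra_simps)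
  qed
  have "incr_var f t \<le> C * (1 + t\<^sup>2)" for t
  proof (cases t "0::real" rule: linorder_cases)
    case less then show ?thesis using pos[of "-t"] by (simp add: incr_var_uminus)
  next
    case equal then show ?thesis using c0 by (simp add: incr_var_def C_def)
  qed (rule pos)
  then show ?thesis by blast
qed

lemma ma_kernel_zero: "ma_kernel 1 H 0 = (\<lambda>x. if 0 \<le> x then x powr (H - 1/2) else 0)"
  by (auto simp: ma_kernel_def max_def fun_eq_iff)

lemma ma_kernel_measurable[measurable]: "ma_kernel r H d \<in> borel_measurable borel"
  unfolding ma_kernel_def[abs_def] by measurable

text \<open>The kernel is homogeneous of degree H - 1/2. Rescaling x by \<open>t\<close> produces t
  powr (2 * H - 1) from the square and one more \<open>t\<close> from the Lebesgue measure.\<close>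

lemma incr_var_power_law:
  assumes H: "0 < H" "H < 1" and t: "t > 0"
    and int: "\<And>t. integrable lborel (\<lambda>x. (ma_kernel 1 H 0 (t + x) - ma_kernel 1 H 0 x)\<^sup>2)"
  shows "incr_var (ma_kernel 1 H 0) t = j_const (H - 1/2) * t powr (2 * H)"
proof -
  let ?f = "ma_kernel 1 H 0"
  have sc: "?f (t * x) = t powr (H - 1/2) * ?f x" for x
    using t by (auto simp: ma_kernel_zero powr_mult zero_le_mult_iff)
  have "incr_var ?f t = \<bar>t\<bar> *\<^sub>R (\<integral>x. (?f (t + (0 + t * x)) - ?f (0 + t * x))\<^sup>2 \<partial>lborel)"
    unfolding incr_var_def by (rule lborel_integral_real_affine) (use t in simp)
  also have "(\<lambda>x. (?f (t + (0 + t * x)) - ?f (0 + t * x))\<^sup>2) = (\<lambda>x. (t powr (H - 1/2))\<^sup>2 * (?f (1 + x) - ?f x)\<^sup>2)"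
  proof
    fix x
    have "t + (0 + t * x) = t * (1 + x)" by (simp add: algebra_simps)
    then show "(?f (t + (0 + t * x)) - ?f (0 + t * x))\<^sup>2 = (t powr (H - 1/2))\<^sup>2 * (?f (1 + x) - ?f x)\<^sup>2"
      by (simp only: sc add_0 power_mult_distrib flip: right_diff_distrib)
  qed
  also have "\<bar>t\<bar> *\<^sub>R (\<integral>x. (t powr (H - 1/2))\<^sup>2 * (?f (1 + x) - ?f x)\<^sup>2 \<partial>lborel) = (t * (t powr (H - 1/2))\<^sup>2) * incr_var ?f 1"
    using t by (simp add: incr_var_def)
  also have "t * (t powr (H - 1/2))\<^sup>2 = t powr (1 + 2 * (H - 1/2))"
    using t by (simp only: powr_add powr_double powr_one)
  also have "1 + 2 * (H - 1/2) = 2 * H" by simp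
  also have "incr_var ?f 1 = j_const (H - 1/2)"
    unfolding j_const_altdef[of "H - 1/2"] ma_kernel_zero
    using H int[of 1] by (subst incr_var_pos_power) (auto simp: ma_kernel_zero j_const_altdef)
  finally show ?thesis by simp
qed

section \<open>The jump of the truncated kernel at 0\<close>

lemma powr_diff_bound:
  fixes a m m' :: real
  assumes "0 < m" "m \<le> m'" "a < 1"
  shows "\<bar>m' powr a - m powr a\<bar> \<le> \<bar>a\<bar> * m powr (a - 1) * (m' - m)"
proof (cases "m = m'")
  case False
  then have "m < m'" using assms by simp
  then have "\<exists>z. m < z \<and> z < m' \<and> m' powr a - m powr a = (m' - m) * (a * z powr (a - 1))"
    using assms by (intro MVT2) (auto intro!: derivative_eq_intros)
  then obtain z where z: "m < z" "z < m'" "m' powr a - m powr a = (m' - m) * (a * z powr (a - 1))" by blast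
  have "z powr (a - 1) \<le> m powr (a - 1)" using z assms by (intro powr_mono2') auto
  then have "\<bar>a\<bar> * z powr (a - 1) * (m' - m) \<le> \<bar>a\<bar> * m powr (a - 1) * (m' - m)"
    using assms by (intro mult_right_mono mult_left_mono) auto
  moreover have "\<bar>m' powr a - m powr a\<bar> = \<bar>a\<bar> * z powr (a - 1) * (m' - m)"
    unfolding z(3) using assms by (simp add: abs_mult)
  ultimately show ?thesis by simp
qed simp

lemma integrable_max_powr:
  fixes b d :: real
  assumes "d > 0" "b < -1"
  shows "integrable lborel (\<lambda>x. indicator {0<..} x * (max d x) powr b)"
proof -
  \<comment> \<open>Chosen so that k * (1 + x) \<le> max d x for all x > 0: compare with
    \<open>d\<close> when x \<le> 1 and with \<open>x\<close> afterwards.\<close>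
  define k where "k = min d 1 / 2"
  have k: "k > 0" "2 * k \<le> d" "2 * k \<le> 1" using assms by (auto simp: k_def)
  \<comment> \<open>Beta parameters 1 and - 1 - b, the latter positive because b < -1; the integrand
    is (1 + s) powr b.\<close>
  have "set_integrable lborel {0<..} (\<lambda>s. s powr (1 - 1) * (1 + s) powr (- 1 - (- 1 - b)))"
    by (rule Beta_half_line) (use assms in auto)
  then have i: "integrable lborel (\<lambda>s. indicator {0<..} s * (s powr (1 - 1) * (1 + s) powr (- 1 - (- 1 - b))))"
    by (simp add: set_integrable_def)
  show ?thesis
  proof (rule Bochner_Integration.integrable_bound)
    show "integrable lborel (\<lambda>s. k powr b * (indicator {0<..} s * (s powr (1 - 1) * (1 + s) powr (- 1 - (- 1 - b)))))"
      using i by (rule integrable_mult_right)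
    have "max d x powr b \<le> k powr b * (1 + x) powr b" if "x > 0" for x
    proof -
      have "k * (1 + x) \<le> max d x"
      proof (cases "x \<le> 1")
        case True
        then have "k * (1 + x) \<le> k * 2" using k by (intro mult_left_mono) auto
        then have "k * (1 + x) \<le> d" using k by linarith
        then show ?thesis by (rule max.coboundedI1)
      next
        case False
        then have "k * (1 + x) \<le> k * (2 * x)" using k by (intro mult_left_mono) auto
        also have "\<dots> = (2 * k) * x" by simp
        also have "\<dots> \<le> 1 * x" using k that by (intro mult_right_mono) auto
        finally have "k * (1 + x) \<le> x" by simp
        then show ?thesis by (rule max.coboundedI2)
      qed
      then have "max d x powr b \<le> (k * (1 + x)) powr b" using that k assms by (intro powr_mono2') auto
      then show ?thesis using k that by (simp add: powr_mult)
    qed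
    then show "AE x in lborel. norm (indicator {0<..} x * max d x powr b) \<le>
      norm (k powr b * (indicator {0<..} x * (x powr (1 - 1) * (1 + x) powr (- 1 - (- 1 - b)))))"
      by (auto simp: indicator_def)
  qed measurable
qed

text \<open>On [-t, 0) the kernel increment is exactly the jump d powr (H - 1/2), since t < d keeps
  t + x on the flat part; this yields the linear term. For x > 0 the increment is at most
  \<open>t\<close> times \<bar>a\<bar> * max d x powr (a - 1), which is square integrable as a <
  1/2, and so contributes order t^2.\<close>

lemma incr_var_jump:
  assumes H: "0 < H" "H < 1" and d: "d > 0"
    and int: "\<And>t. integrable lborel (\<lambda>x. (ma_kernel 1 H d (t + x) - ma_kernel 1 H d x)\<^sup>2)"
  shows "\<exists>c\<ge>0. \<forall>t. 0 < t \<and> t < d \<longrightarrow> \<bar>incr_var (ma_kernel 1 H d) t - d powr (2 * H - 1) * t\<bar> \<le> c * t\<^sup>2"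
proof -
  let ?f = "ma_kernel 1 H d"
  define a where "a = H - 1/2"
  have dd: "d powr (2 * H - 1) = (d powr (H - 1/2))\<^sup>2"
    using powr_double[of d "H - 1/2"] by simp
  define g where "g = (\<lambda>x::real. indicator {0<..} x * (max d x) powr (2 * a - 2))"
  have gi: "integrable lborel g" unfolding g_def using integrable_max_powr[OF d, of "2*a-2"] H by (simp add: a_def)
  define c where "c = a\<^sup>2 * (\<integral>x. g x \<partial>lborel)"
  have c0: "c \<ge> 0" unfolding c_def by (intro mult_nonneg_nonneg Bochner_Integration.integral_nonneg) (auto simp: g_def)
  have "\<bar>incr_var ?f t - d powr (2 * H - 1) * t\<bar> \<le> c * t\<^sup>2" if t: "0 < t" "t < d" for t
  proof -
    let ?D = "\<lambda>x. (?f (t + x) - ?f x)\<^sup>2"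
    define h where "h = (\<lambda>x. indicator {0<..} x * ?D x)"
    have hi: "integrable lborel h" unfolding h_def
      using integrable_mult_indicator[OF _ int[of t], of "{0<..}"] by simp
    have hb: "h x \<le> t\<^sup>2 * (a\<^sup>2 * g x)" for x
    proof (cases "x > 0")
      case True
      have "\<bar>?f (t + x) - ?f x\<bar> \<le> \<bar>a\<bar> * (max d x) powr (a - 1) * (max d (t + x) - max d x)"
        using True t d H powr_diff_bound[of "max d x" "max d (t + x)" a]
        by (simp add: ma_kernel_def a_def)
      also have "\<dots> \<le> \<bar>a\<bar> * (max d x) powr (a - 1) * t"
        using t by (intro mult_left_mono) auto
      finally have "?D x \<le> (\<bar>a\<bar> * (max d x) powr (a - 1) * t)\<^sup>2"
        by (subst power2_abs[symmetric]) (intro power_mono, auto)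
      also have "\<dots> = t\<^sup>2 * (a\<^sup>2 * max d x powr (2 * (a - 1)))"
        by (simp only: powr_double power_mult_distrib power2_abs) (simp only: mult_ac)
      finally show ?thesis using True by (simp add: h_def g_def algebra_simps)
    qed (simp add: h_def g_def)
    have "incr_var ?f t = (\<integral>x. d powr (2 * a) * indicator {-t..<0} x + h x \<partial>lborel)"
      unfolding incr_var_def
    proof (rule integral_cong_AE)
      have "AE x in lborel. x \<noteq> (0::real)" by (rule AE_lborel_singleton)
      then show "AE x in lborel. ?D x = d powr (2 * a) * indicator {-t..<0} x + h x"
      proof eventually_elim
        case (elim x)
        then show ?case using t d
          by (cases "x > 0"; cases "x < -t") (auto simp: h_def ma_kernel_def a_def dd max_def)
      qed
    qed (use hi in auto)
    also have "\<dots> = d powr (2 * a) * t + (\<integral>x. h x \<partial>lborel)"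
      using hi t by simp
    finally have e: "incr_var ?f t - d powr (2 * H - 1) * t = (\<integral>x. h x \<partial>lborel)"
      by (simp add: a_def algebra_simps)
    have "(\<integral>x. h x \<partial>lborel) \<le> (\<integral>x. t\<^sup>2 * (a\<^sup>2 * g x) \<partial>lborel)"
      by (rule integral_mono) (use hi gi hb in auto)
    also have "\<dots> = c * t\<^sup>2" by (simp add: c_def)
    finally have "(\<integral>x. h x \<partial>lborel) \<le> c * t\<^sup>2" .
    moreover have "(\<integral>x. h x \<partial>lborel) \<ge> 0" by (intro Bochner_Integration.integral_nonneg) (auto simp: h_def)
    ultimately show ?thesis unfolding e by simp
  qed
  with c0 show ?thesis by blast
qed

text \<open>The error K * t^2 is of smaller order than t powr p because p < 2; evenness carries the
  one-sided estimate to the other side of 0.\<close>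

lemma asymp_equiv_at_0I:
  fixes g :: "real \<Rightarrow> real"
  assumes "c \<noteq> 0" "p < 2" "e > 0"
    and even: "\<And>t. g (- t) = g t"
    and bound: "\<And>t. 0 < t \<Longrightarrow> t < e \<Longrightarrow> \<bar>g t - c * t powr p\<bar> \<le> K * t\<^sup>2"
  shows "g \<sim>[at 0] (\<lambda>t. c * \<bar>t\<bar> powr p)"
proof (rule asymp_equivI')
  have bd: "\<bar>g t / (c * \<bar>t\<bar> powr p) - 1\<bar> \<le> K / \<bar>c\<bar> * \<bar>t\<bar> powr (2 - p)" if "t \<noteq> 0" "\<bar>t\<bar> < e" for t
  proof -
    have g: "g \<bar>t\<bar> = g t" using even[of t] by (auto simp: abs_if)
    have P: "\<bar>t\<bar> powr p > 0" using that by simp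
    have "g t / (c * \<bar>t\<bar> powr p) - 1 = (g t - c * \<bar>t\<bar> powr p) / (c * \<bar>t\<bar> powr p)"
      using P assms(1) by (simp add: diff_divide_distrib)
    then have "\<bar>g t / (c * \<bar>t\<bar> powr p) - 1\<bar> = \<bar>g \<bar>t\<bar> - c * \<bar>t\<bar> powr p\<bar> / (\<bar>c\<bar> * \<bar>t\<bar> powr p)"
      by (simp add: g abs_mult)
    also have "\<dots> \<le> K * \<bar>t\<bar>\<^sup>2 / (\<bar>c\<bar> * \<bar>t\<bar> powr p)"
      by (intro divide_right_mono bound) (use that in auto)
    also have "\<dots> = K / \<bar>c\<bar> * (\<bar>t\<bar>\<^sup>2 / \<bar>t\<bar> powr p)" by simp
    also have "\<bar>t\<bar>\<^sup>2 / \<bar>t\<bar> powr p = \<bar>t\<bar> powr (2 - p)"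
      using that by (simp add: powr_diff powr_numeral)
    finally show ?thesis .
  qed
  have "((\<lambda>t. K / \<bar>c\<bar> * \<bar>t\<bar> powr (2 - p)) \<longlongrightarrow> K / \<bar>c\<bar> * 0) (at 0)"
  proof (intro tendsto_mult tendsto_const)
    have "((\<lambda>t::real. \<bar>t\<bar> powr (2 - p)) \<longlongrightarrow> \<bar>0\<bar> powr (2 - p)) (at 0)"
      using assms(2) by (intro tendsto_powr2 tendsto_intros) auto
    then show "((\<lambda>t::real. \<bar>t\<bar> powr (2 - p)) \<longlongrightarrow> 0) (at 0)" by simp
  qed
  then have "((\<lambda>t. K / \<bar>c\<bar> * \<bar>t\<bar> powr (2 - p)) \<longlongrightarrow> 0) (at 0)" by simp
  moreover have "\<forall>\<^sub>F t in at 0. norm (g t / (c * \<bar>t\<bar> powr p) - 1) \<le> K / \<bar>c\<bar> * \<bar>t\<bar> powr (2 - p)"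
    unfolding eventually_at using assms(3) bd by (auto intro!: exI[of _ e] simp: dist_real_def)
  ultimately have "((\<lambda>t. g t / (c * \<bar>t\<bar> powr p) - 1) \<longlongrightarrow> 0) (at 0)"
    by (rule Lim_null_comparison[rotated])
  then show "((\<lambda>t. g t / (c * \<bar>t\<bar> powr p)) \<longlongrightarrow> 1) (at 0)"
    by (simp add: LIM_zero_iff)
qed

section \<open>Bounded solutions of the Volterra equation\<close>

text \<open>The change of variable x to 1 / x reduces the form 0/0 at infinity to the one-sided rule
  at 0; the factors - 1 / x^2 cancel in the quotient of derivatives.\<close>

lemma lhopital_at_top_0:
  fixes f g f' g' :: "real \<Rightarrow> real"
  assumes f: "(f \<longlongrightarrow> 0) at_top" and g: "(g \<longlongrightarrow> 0) at_top"
    and "\<forall>\<^sub>F x in at_top. g x \<noteq> 0" "\<forall>\<^sub>F x in at_top. g' x \<noteq> 0"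
    and df: "\<forall>\<^sub>F x in at_top. (f has_real_derivative f' x) (at x)"
    and dg: "\<forall>\<^sub>F x in at_top. (g has_real_derivative g' x) (at x)"
    and lim: "((\<lambda>x. f' x / g' x) \<longlongrightarrow> L) at_top"
  shows "((\<lambda>x. f x / g x) \<longlongrightarrow> L) at_top"
  unfolding filterlim_at_top_to_right
proof (rule lhopital_right_0)
  show "((\<lambda>x. f (inverse x)) \<longlongrightarrow> 0) (at_right 0)" "((\<lambda>x. g (inverse x)) \<longlongrightarrow> 0) (at_right 0)"
    using f g by (simp_all add: filterlim_at_top_to_right)
  have ev: "\<forall>\<^sub>F x in at_right 0. P (inverse x)" if "\<forall>\<^sub>F x in at_top. P x" for P :: "real \<Rightarrow> bool"
    using that by (simp add: at_top_to_right eventually_filtermap)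
  show "\<forall>\<^sub>F x in at_right 0. g (inverse x) \<noteq> 0" by (rule ev) fact
  have pos: "\<forall>\<^sub>F x::real in at_right 0. x > 0" by (simp add: eventually_at_right_less)
  show "\<forall>\<^sub>F x in at_right 0. - (g' (inverse x) / x\<^sup>2) \<noteq> 0"
    using ev[OF assms(4)] pos by eventually_elim simp
  have chain: "((\<lambda>x. h (inverse x)) has_real_derivative - (D / x\<^sup>2)) (at x)"
    if "(h has_real_derivative D) (at (inverse x))" "x > 0" for h :: "real \<Rightarrow> real" and D x
  proof -
    have "(inverse has_real_derivative - (inverse x ^ Suc (Suc 0))) (at x)"
      using that by (intro DERIV_inverse) auto
    from DERIV_chain2[where f=h and g=inverse, OF that(1) this] show ?thesis
      using that by (simp add: power2_eq_square divide_inverse)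
  qed
  show "\<forall>\<^sub>F x in at_right 0. ((\<lambda>x. f (inverse x)) has_real_derivative - (f' (inverse x) / x\<^sup>2)) (at x)"
    using ev[OF df] pos
    by eventually_elim (rule chain)
  show "\<forall>\<^sub>F x in at_right 0. ((\<lambda>x. g (inverse x)) has_real_derivative - (g' (inverse x) / x\<^sup>2)) (at x)"
    using ev[OF dg] pos
    by eventually_elim (rule chain)
  have "((\<lambda>x. f' (inverse x) / g' (inverse x)) \<longlongrightarrow> L) (at_right 0)"
    using lim by (simp add: filterlim_at_top_to_right)
  moreover have "\<forall>\<^sub>F x in at_right 0. f' (inverse x) / g' (inverse x) = - (f' (inverse x) / x\<^sup>2) / - (g' (inverse x) / x\<^sup>2)"
    using pos by eventually_elim simp
  ultimately show "((\<lambda>x. - (f' (inverse x) / x\<^sup>2) / - (g' (inverse x) / x\<^sup>2)) \<longlongrightarrow> L) (at_right 0)"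
    by (rule Lim_transform_eventually)
qed

text \<open>
  With \<open>s\<close> playing the role of \<open>r'\<close>, the combination \<open>s + lam * r\<close> solves a first-order equation whose
  homogeneous solutions grow exponentially, and \<open>r\<close> is recovered from it by a stable first-order equation.
\<close>

lemma bounded_solution_asymptotics:
  fixes r s \<rho> :: "real \<Rightarrow> real" and lam b K t0 R :: real
  assumes lam: "lam > 0" and b: "-1 \<le> b" "b < 0"
    and dr: "\<And>t. t > t0 \<Longrightarrow> (r has_real_derivative s t) (at t)"
    and ds: "\<And>t. t > t0 \<Longrightarrow> (s has_real_derivative lam\<^sup>2 * r t - \<rho> t) (at t)"
    and R: "\<And>t. t > t0 \<Longrightarrow> \<bar>r t\<bar> \<le> R"
    and \<rho>: "((\<lambda>t. \<rho> t / t powr b) \<longlongrightarrow> K) at_top"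
  shows "((\<lambda>t. r t / t powr b) \<longlongrightarrow> K / lam\<^sup>2) at_top"
proof -
  define w where "w = (\<lambda>t. s t + lam * r t)"
  have dw: "(w has_real_derivative lam * w t - \<rho> t) (at t)" if "t > t0" for t
    unfolding w_def using dr[OF that] ds[OF that]
    by (auto intro!: derivative_eq_intros simp: power2_eq_square algebra_simps)
  have tb: "((\<lambda>t. t powr b) \<longlongrightarrow> 0) at_top"
    by (rule tendsto_neg_powr[OF b(2) filterlim_ident])
  have tb1: "((\<lambda>t. b / t) \<longlongrightarrow> 0) at_top" by real_asymp
  have \<rho>0: "(\<rho> \<longlongrightarrow> 0) at_top"
  proof -
    have "((\<lambda>t. \<rho> t / t powr b * t powr b) \<longlongrightarrow> K * 0) at_top" by (intro tendsto_mult \<rho> tb)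
    then have "((\<lambda>t. \<rho> t / t powr b * t powr b) \<longlongrightarrow> 0) at_top" by simp
    then show ?thesis
      by (rule Lim_transform_eventually) (use eventually_gt_at_top[of 0] in \<open>eventually_elim, simp\<close>)
  qed
  then have "\<forall>\<^sub>F t in at_top. \<bar>\<rho> t\<bar> < 1"
    using order_tendstoD(2)[OF tendsto_rabs[OF \<rho>0]] by simp
  then obtain t1 where t1: "\<And>t. t \<ge> t1 \<Longrightarrow> \<bar>\<rho> t\<bar> < 1" by (auto simp: eventually_at_top_linorder)
  define t2 where "t2 = max t1 (max (t0 + 1) 1)"
  have t2: "t2 \<ge> t1" "t2 > t0" "t2 > 0" by (auto simp: t2_def)
  define c where "c = lam\<^sup>2 * R + 1"
  \<comment> \<open>The hypotheses bound \<open>r\<close> but not \<open>s\<close>. Since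
    \<open>r\<close> and \<rho> are bounded beyond \<open>t2\<close>, so is the derivative of
    \<open>s\<close>; hence \<open>s\<close> grows at most linearly, which a decaying exponential
    absorbs.\<close>
  have sb: "\<bar>s t\<bar> \<le> \<bar>s t2\<bar> + c * (t - t2)" if "t \<ge> t2" for t
  proof (cases "t = t2")
    case False
    then have "t2 < t" using that by simp
    then obtain z where z: "t2 < z" "z < t" "s t - s t2 = (t - t2) * (lam\<^sup>2 * r z - \<rho> z)"
      using MVT2[of t2 t s "\<lambda>t. lam\<^sup>2 * r t - \<rho> t"] ds t2 by force
    have "\<bar>lam\<^sup>2 * r z - \<rho> z\<bar> \<le> lam\<^sup>2 * \<bar>r z\<bar> + \<bar>\<rho> z\<bar>"
      using abs_triangle_ineq4[of "lam\<^sup>2 * r z" "\<rho> z"] by (simp add: abs_mult)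
    also have "\<dots> \<le> c" unfolding c_def using R[of z] t1[of z] z t2
      by (intro add_mono mult_left_mono) auto
    finally have "\<bar>s t - s t2\<bar> \<le> (t - t2) * c" unfolding z(3) abs_mult using that by (intro mult_mono) auto
    then show ?thesis by (simp add: algebra_simps)
  qed simp
  have u0: "((\<lambda>t. exp (- lam * t) * w t) \<longlongrightarrow> 0) at_top"
  proof (rule Lim_null_comparison)
    show "\<forall>\<^sub>F t in at_top. norm (exp (- lam * t) * w t) \<le> exp (- lam * t) * (\<bar>s t2\<bar> + c * (t - t2) + lam * R)"
      using eventually_ge_at_top[of t2]
    proof eventually_elim
      case (elim t)
      have "\<bar>w t\<bar> \<le> \<bar>s t\<bar> + lam * \<bar>r t\<bar>"
        unfolding w_def using lam abs_triangle_ineq[of "s t" "lam * r t"] by (simp add: abs_mult)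
      also have "\<dots> \<le> (\<bar>s t2\<bar> + c * (t - t2)) + lam * R"
        using R[of t] lam elim t2 by (intro add_mono sb mult_left_mono) auto
      finally show ?case by (simp add: abs_mult)
    qed
    show "((\<lambda>t. exp (- lam * t) * (\<bar>s t2\<bar> + c * (t - t2) + lam * R)) \<longlongrightarrow> 0) at_top"
    proof -
      have l: "((\<lambda>t. exp (- lam * t)) \<longlongrightarrow> 0) at_top" using lam by real_asymp
      have l1: "((\<lambda>t. exp (- lam * t) * t) \<longlongrightarrow> 0) at_top" using lam by real_asymp
      have "((\<lambda>t. exp (- lam * t) * (\<bar>s t2\<bar> - c * t2 + lam * R) + c * (exp (- lam * t) * t)) \<longlongrightarrow> 0 * (\<bar>s t2\<bar> - c * t2 + lam * R) + c * 0) at_top"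
        by (intro tendsto_intros l l1)
      then show ?thesis by (simp add: algebra_simps)
    qed
  qed
  have dpow: "((\<lambda>t. t powr b) has_real_derivative t powr b * (b / t)) (at t)" if "t > 0" for t
    using that by (auto intro!: derivative_eq_intros simp: powr_diff)
  have dexp: "((\<lambda>t. exp (k * t)) has_real_derivative k * exp (k * t)) (at t)" for k t :: real
    by (auto intro!: derivative_eq_intros)
  have ratio: "((\<lambda>t. k + b / t) \<longlongrightarrow> k) at_top" for k
    using tendsto_add[OF tendsto_const tb1, of k] by simp
  \<comment> \<open>With the integrating factor, the derivative of the numerator is - exp (- lam *
    t) * \<rho> t, free of \<open>w\<close>. The form 0/0 rests on \<open>u0\<close>, the place
    where boundedness excludes the growing homogeneous solution.\<close>
  have wlim: "((\<lambda>t. w t / t powr b) \<longlongrightarrow> K / lam) at_top"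
  proof -
    have "((\<lambda>t. (exp (- lam * t) * w t) / (exp (- lam * t) * t powr b)) \<longlongrightarrow> K / lam) at_top"
    proof (rule lhopital_at_top_0[OF u0])
      have "((\<lambda>t. exp (- lam * t)) \<longlongrightarrow> 0) at_top" using lam by real_asymp
      from tendsto_mult[OF this tb] show "((\<lambda>t. exp (- lam * t) * t powr b) \<longlongrightarrow> 0) at_top" by simp
      show "\<forall>\<^sub>F t in at_top. exp (- lam * t) * t powr b \<noteq> 0"
        using eventually_gt_at_top[of 0] by eventually_elim simp
      have "\<forall>\<^sub>F t in at_top. - lam + b / t < 0"
        using order_tendstoD(2)[OF ratio[of "-lam"], of 0] lam by simp
      then show "\<forall>\<^sub>F t in at_top. exp (- lam * t) * t powr b * (- lam + b / t) \<noteq> 0"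
        using eventually_gt_at_top[of 0] by eventually_elim simp
      show "\<forall>\<^sub>F t in at_top. ((\<lambda>t. exp (- lam * t) * w t) has_real_derivative - exp (- lam * t) * \<rho> t) (at t)"
        using eventually_gt_at_top[of t0]
        by eventually_elim (rule DERIV_cong[OF DERIV_mult[OF dexp dw]], auto simp: algebra_simps)
      show "\<forall>\<^sub>F t in at_top. ((\<lambda>t. exp (- lam * t) * t powr b) has_real_derivative exp (- lam * t) * t powr b * (- lam + b / t)) (at t)"
        using eventually_gt_at_top[of 0]
        by eventually_elim (rule DERIV_cong[OF DERIV_mult[OF dexp dpow]], auto simp: algebra_simps)
      have "((\<lambda>t. - (\<rho> t / t powr b) / (- lam + b / t)) \<longlongrightarrow> - K / (- lam)) at_top"
        by (intro tendsto_intros \<rho> ratio) (use lam in auto)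
      then have "((\<lambda>t. - (\<rho> t / t powr b) / (- lam + b / t)) \<longlongrightarrow> K / lam) at_top" by simp
      then show "((\<lambda>t. - exp (- lam * t) * \<rho> t / (exp (- lam * t) * t powr b * (- lam + b / t))) \<longlongrightarrow> K / lam) at_top"
        by (rule Lim_transform_eventually) (simp add: eventually_mono[OF eventually_gt_at_top[of 0]] mult.assoc)
    qed
    then show ?thesis by simp
  qed
  \<comment> \<open>The stable factor: the rule for a denominator tending to infinity asks for no
    limit of the numerator. The lower bound on \<open>b\<close> lets exp (lam * t) / t minorise the
    denominator.\<close>
  have "((\<lambda>t. (exp (lam * t) * r t) / (exp (lam * t) * t powr b)) \<longlongrightarrow> (K / lam) / lam) at_top"
  proof (rule lhospital_at_top_at_top)
    show "filterlim (\<lambda>t. exp (lam * t) * t powr b) at_top at_top"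
    proof (rule filterlim_at_top_mono)
      show "filterlim (\<lambda>t. exp (lam * t) / t) at_top at_top" using lam by real_asymp
      show "\<forall>\<^sub>F t in at_top. exp (lam * t) / t \<le> exp (lam * t) * t powr b"
        using eventually_ge_at_top[of 1]
      proof eventually_elim
        case (elim t)
        have "1 / t = t powr (-1)" using elim by (simp add: powr_minus_divide)
        also have "\<dots> \<le> t powr b" using elim b by (intro powr_mono) auto
        finally show ?case using mult_left_mono[of "1 / t" "t powr b" "exp (lam * t)"] by simp
      qed
    qed
    have "\<forall>\<^sub>F t in at_top. lam + b / t > 0"
      using order_tendstoD(1)[OF ratio[of "lam"], of 0] lam by simp
    then show "\<forall>\<^sub>F t in at_top. exp (lam * t) * t powr b * (lam + b / t) \<noteq> 0"
      using eventually_gt_at_top[of 0] by eventually_elim simp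
    show "\<forall>\<^sub>F t in at_top. ((\<lambda>t. exp (lam * t) * r t) has_real_derivative exp (lam * t) * w t) (at t)"
      using eventually_gt_at_top[of t0]
      by eventually_elim (rule DERIV_cong[OF DERIV_mult[OF dexp dr]], auto simp: w_def algebra_simps)
    show "\<forall>\<^sub>F t in at_top. ((\<lambda>t. exp (lam * t) * t powr b) has_real_derivative exp (lam * t) * t powr b * (lam + b / t)) (at t)"
      using eventually_gt_at_top[of 0]
      by eventually_elim (rule DERIV_cong[OF DERIV_mult[OF dexp dpow]], auto simp: algebra_simps)
    have "((\<lambda>t. (w t / t powr b) / (lam + b / t)) \<longlongrightarrow> (K / lam) / lam) at_top"
      by (intro tendsto_intros wlim ratio) (use lam in auto)
    then show "((\<lambda>t. exp (lam * t) * w t / (exp (lam * t) * t powr b * (lam + b / t))) \<longlongrightarrow> (K / lam) / lam) at_top"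
      by (simp add: mult.assoc)
  qed
  then show ?thesis by (simp add: power2_eq_square)
qed

text \<open>The kernel t - h depends on \<open>t\<close>, so the integral is split as
  \<open>t * Q0 t - Q1 t\<close>; the boundary terms cancel on differentiation. \<open>q\<close> may
  be singular at 0 and involves \<open>r\<close> in the application. Hence a bootstrap:
  integrability makes \<open>r\<close> continuous, \<open>cont\<close> then makes \<open>q\<close>
  continuous on [t0, \<infinity>), and only there is the fundamental theorem applied.\<close>

lemma volterra_derivatives:
  fixes r q :: "real \<Rightarrow> real" and A B t0 :: real
  assumes t0: "t0 > 0"
    and int: "\<And>T. T > 0 \<Longrightarrow> set_integrable lborel {0<..<T} q"
    and eq: "\<And>t. t > 0 \<Longrightarrow> r t = A + B * t + (LBINT h:{0<..<t}. (t - h) * q h)"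
    and cont: "continuous_on {t0..} r \<Longrightarrow> continuous_on {t0..} q"
    and t: "t > t0"
  shows "(r has_real_derivative B + (LBINT h:{0<..<t}. q h)) (at t)"
    and "((\<lambda>t. B + (LBINT h:{0<..<t}. q h)) has_real_derivative q t) (at t)"
proof -
  define Q0 where "Q0 = (\<lambda>t. integral {0..t} q)"
  define Q1 where "Q1 = (\<lambda>t. integral {0..t} (\<lambda>h. h * q h))"
  have int1: "set_integrable lborel {0<..<T} (\<lambda>h. h * q h)" if "T > 0" for T
  proof -
    have "integrable lborel (\<lambda>h. T * (indicator {0<..<T} h * q h))"
      using int[OF that] by (simp add: set_integrable_def)
    then show ?thesis unfolding set_integrable_def
    proof (rule Bochner_Integration.integrable_bound)
      have [measurable]: "(\<lambda>h. indicator {0<..<T} h *\<^sub>R q h) \<in> borel_measurable lborel"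
        using int[OF that] unfolding set_integrable_def by (rule borel_measurable_integrable)
      have "(\<lambda>h. indicator {0<..<T} h *\<^sub>R (h * q h)) = (\<lambda>h. h * (indicator {0<..<T} h *\<^sub>R q h))"
        by (simp add: fun_eq_iff)
      also have "\<dots> \<in> borel_measurable lborel" by measurable
      finally show "(\<lambda>h. indicator {0<..<T} h *\<^sub>R (h * q h)) \<in> borel_measurable lborel" .
      show "AE h in lborel. norm (indicator {0<..<T} h *\<^sub>R (h * q h)) \<le> norm (T * (indicator {0<..<T} h * q h))"
        by (auto simp: indicator_def abs_mult intro!: mult_right_mono)
    qed
  qed
  have HK: "(LBINT h:{0<..<T}. g h) = integral {0..T} g" "g integrable_on {0..T}"
    if "set_integrable lborel {0<..<T} g" for g :: "real \<Rightarrow> real" and T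
    using set_borel_integral_eq_integral[OF that]
    by (simp_all add: integrable_on_Icc_iff_Ioo integral_open_interval_real)
  have r_eq: "r x = A + B * x + x * Q0 x - Q1 x" if "x > 0" for x
  proof -
    have "(LBINT h:{0<..<x}. (x - h) * q h) = (LBINT h:{0<..<x}. x * q h - h * q h)"
      by (simp add: left_diff_distrib)
    also have "\<dots> = x * Q0 x - Q1 x"
      unfolding Q0_def Q1_def HK(1)[OF int[OF that], symmetric] HK(1)[OF int1[OF that], symmetric]
      using int[OF that] int1[OF that] by (subst set_integral_diff(2)) auto
    finally show ?thesis using eq[OF that] by simp
  qed
  have cQ: "continuous_on {0..T} Q0" "continuous_on {0..T} Q1" if "T > 0" for T
    unfolding Q0_def Q1_def using HK(2)[OF int[OF that]] HK(2)[OF int1[OF that]]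
    by (auto intro: indefinite_integral_continuous_1)
  have "continuous_on {t0..} r"
  proof (rule continuous_on_subset[of "{0<..}"])
    show "continuous_on {0<..} r"
    proof (rule continuous_at_imp_continuous_on, intro ballI)
      fix x :: real assume "x \<in> {0<..}"
      then have x: "x > 0" by simp
      have "continuous_on {0<..<x + 1} (\<lambda>x. A + B * x + x * Q0 x - Q1 x)"
        by (intro continuous_intros continuous_on_subset[OF cQ(1)[of "x+1"]] continuous_on_subset[OF cQ(2)[of "x+1"]])
           (use x in auto)
      then have "continuous_on {0<..<x + 1} r"
        by (rule continuous_on_cong[THEN iffD1, rotated -1]) (auto simp: r_eq)
      then show "isCont r x" using x by (simp add: continuous_on_eq_continuous_at)
    qed
  qed (use t0 in auto)
  then have cq: "continuous_on {t0..} q" by (rule cont)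
  \<comment> \<open>Splitting the integral at \<open>t0\<close> leaves a constant and an integral
    over the range where \<open>g\<close> is continuous.\<close>
  have dQ: "((\<lambda>x. integral {0..x} g) has_real_derivative g t) (at t)"
    if "continuous_on {t0..} g" "g integrable_on {0..t + 1}" for g :: "real \<Rightarrow> real"
  proof -
    have "((\<lambda>x. integral {t0..x} g) has_real_derivative g t) (at t within {t0..t + 1})"
      by (rule integral_has_real_derivative) (use that t in \<open>auto intro: continuous_on_subset\<close>)
    then have "((\<lambda>x. integral {t0..x} g) has_real_derivative g t) (at t)"
      using t by (simp add: at_within_Icc_at)
    then have D: "((\<lambda>x. integral {0..t0} g + integral {t0..x} g) has_real_derivative g t) (at t)"
      by (auto intro!: derivative_eq_intros)
    have "\<forall>\<^sub>F x in nhds t. integral {0..t0} g + integral {t0..x} g = integral {0..x} g"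
    proof (rule eventually_nhds_in_open[of "{t0<..<t + 1}", THEN eventually_mono])
      fix x assume "x \<in> {t0<..<t + 1}"
      then show "integral {0..t0} g + integral {t0..x} g = integral {0..x} g"
        using t0 by (intro Henstock_Kurzweil_Integration.integral_combine integrable_on_subinterval[OF that(2)]) auto
    qed (use t in auto)
    from DERIV_cong_ev[OF refl this refl] D show ?thesis by simp
  qed
  have "t + 1 > 0" using t t0 by simp
  note D0 = dQ[OF cq HK(2)[OF int[OF this]]]
  have D1: "(Q1 has_real_derivative t * q t) (at t)" unfolding Q1_def
    by (rule dQ[OF _ HK(2)[OF int1]]) (use cq \<open>t + 1 > 0\<close> in \<open>auto intro!: continuous_intros\<close>)
  have D0': "(Q0 has_real_derivative q t) (at t)" unfolding Q0_def by (rule D0)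
  have near: "\<forall>\<^sub>F x in nhds t. x > 0"
    using t t0 by (intro eventually_nhds_in_open[of "{0<..}", THEN eventually_mono]) auto
  have "((\<lambda>x. A + B * x + x * Q0 x - Q1 x) has_real_derivative B + Q0 t) (at t)"
    by (rule derivative_eq_intros D0' D1 refl)+ simp
  moreover have "\<forall>\<^sub>F x in nhds t. A + B * x + x * Q0 x - Q1 x = r x"
    using near by eventually_elim (simp add: r_eq)
  ultimately have "(r has_real_derivative B + Q0 t) (at t)"
    using DERIV_cong_ev[OF refl _ refl] by fast
  moreover have Q0_eq: "(LBINT h:{0<..<x}. q h) = Q0 x" if "x > 0" for x
    unfolding Q0_def by (rule HK(1)[OF int[OF that]])
  ultimately show "(r has_real_derivative B + (LBINT h:{0<..<t}. q h)) (at t)"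
    using t t0 by simp
  have "((\<lambda>x. B + Q0 x) has_real_derivative q t) (at t)"
    using D0' by (auto intro!: derivative_eq_intros)
  moreover have "\<forall>\<^sub>F x in nhds t. B + Q0 x = B + (LBINT h:{0<..<x}. q h)"
    using near by eventually_elim (simp add: Q0_eq)
  ultimately show "((\<lambda>t. B + (LBINT h:{0<..<t}. q h)) has_real_derivative q t) (at t)"
    using DERIV_cong_ev[OF refl _ refl] by fast
qed

section \<open>Kernels with long memory\<close>

text \<open>The length of the overlap of (0, t) with its translate by \<open>h\<close>: the weight
  of the lag \<open>h\<close> when a function of u - v is integrated over the square.\<close>

definition tent :: "real \<Rightarrow> real \<Rightarrow> real" where "tent t h = max 0 (t - \<bar>h\<bar>)"

lemma tent_measurable[measurable]: "tent t \<in> borel_measurable borel"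
  unfolding tent_def[abs_def] by measurable

lemma integrable_indicator_Ioo: "integrable lborel (\<lambda>x. indicator {u<..<v::real} x :: real)"
  by (cases "u \<le> v") auto

lemma overlap_eq:
  fixes t :: real
  shows "(indicator {0<..<t} v * indicator {0<..<t} (v + h) :: 'b::comm_semiring_1) = indicator {max 0 (- h)<..<min t (t - h)} v"
  by (auto simp: indicator_def)

lemma overlap_nn: "(\<integral>\<^sup>+v. indicator {0<..<t} v * indicator {0<..<t} (v + h) \<partial>lborel) = ennreal (tent t h)"
proof (cases "\<bar>h\<bar> \<le> t")
  case True
  then have "max 0 (- h) \<le> min t (t - h)" by auto
  then show ?thesis unfolding overlap_eq using True by (simp add: tent_def max_def min_def abs_if)
next
  case False
  then have "{max 0 (- h)<..<min t (t - h)} = {}" by auto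
  then show ?thesis unfolding overlap_eq using False by (simp add: tent_def)
qed

lemma overlap_integral: "(\<integral>v. indicator {0<..<t} v * indicator {0<..<t} (v + h) \<partial>lborel) = tent t h"
proof (cases "\<bar>h\<bar> \<le> t")
  case True
  then have "max 0 (- h) \<le> min t (t - h)" by auto
  then show ?thesis unfolding overlap_eq using True by (simp add: tent_def max_def min_def abs_if)
next
  case False
  then have "{max 0 (- h)<..<min t (t - h)} = {}" by auto
  then show ?thesis unfolding overlap_eq using False by (simp add: tent_def)
qed

lemma double_nn_integral_difference:
  fixes g :: "real \<Rightarrow> ennreal"
  assumes [measurable]: "g \<in> borel_measurable borel"
  shows "(\<integral>\<^sup>+v. indicator {0<..<t} v * (\<integral>\<^sup>+u. indicator {0<..<t} u * g (u - v) \<partial>lborel) \<partial>lborel)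
       = (\<integral>\<^sup>+h. g h * ennreal (tent t h) \<partial>lborel)"
proof -
  have "(\<integral>\<^sup>+u. indicator {0<..<t} u * g (u - v) \<partial>lborel) = (\<integral>\<^sup>+h. indicator {0<..<t} (v + h) * g h \<partial>lborel)" for v
    by (subst nn_integral_real_affine[where c=1 and t=v]) auto
  then have "(\<integral>\<^sup>+v. indicator {0<..<t} v * (\<integral>\<^sup>+u. indicator {0<..<t} u * g (u - v) \<partial>lborel) \<partial>lborel)
     = (\<integral>\<^sup>+v. (\<integral>\<^sup>+h. g h * (indicator {0<..<t} v * indicator {0<..<t} (v + h)) \<partial>lborel) \<partial>lborel)"
    by (simp add: nn_integral_cmult[symmetric] mult_ac)
  also have "\<dots> = (\<integral>\<^sup>+h. (\<integral>\<^sup>+v. g h * (indicator {0<..<t} v * indicator {0<..<t} (v + h)) \<partial>lborel) \<partial>lborel)"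
    by (rule lborel_pair.Fubini'[symmetric]) measurable
  also have "\<dots> = (\<integral>\<^sup>+h. g h * ennreal (tent t h) \<partial>lborel)"
    by (simp add: nn_integral_cmult overlap_nn)
  finally show ?thesis .
qed

text \<open>The counterpart for bounded functions of either sign, meant for the autocovariance of
  the solution.\<close>

lemma double_integral_difference:
  fixes g :: "real \<Rightarrow> real"
  assumes [measurable]: "g \<in> borel_measurable borel" and R: "\<And>h. \<bar>g h\<bar> \<le> R"
  shows "(LBINT v:{0<..<t}. LBINT u:{0<..<t}. g (u - v)) = (\<integral>h. g h * tent t h \<partial>lborel)"
proof -
  define k where "k = (\<lambda>(v, h). g h * (indicator {0<..<t} v * indicator {0<..<t} (v + h)))"
  have ki: "integrable (lborel \<Otimes>\<^sub>M lborel) k"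
  proof (rule Bochner_Integration.integrable_bound)
    show "integrable (lborel \<Otimes>\<^sub>M lborel) (\<lambda>(v::real, h). indicator {0<..<t} v * (R * indicator {-t<..<t} h))"
      by (intro integrable_tensor integrable_mult_right integrable_indicator_Ioo sigma_finite_lborel)
    show "k \<in> borel_measurable (lborel \<Otimes>\<^sub>M lborel)" unfolding k_def by measurable
    have "norm (k (v, h)) \<le> norm (indicator {0<..<t} v * (R * indicator {-t<..<t} h))" for v h
      using R[of h] by (auto simp: k_def indicator_def)
    then show "AE p in lborel \<Otimes>\<^sub>M lborel. norm (k p) \<le> norm (case p of (v, h) \<Rightarrow> indicator {0<..<t} v * (R * indicator {-t<..<t} h))"
      by (auto simp: split_beta)
  qed
  have "(LBINT u:{0<..<t}. g (u - v)) = (\<integral>h. indicator {0<..<t} (v + h) * g h \<partial>lborel)" for v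
    unfolding set_lebesgue_integral_def
    by (subst lborel_integral_real_affine[where c=1 and t=v]) auto
  then have "(LBINT v:{0<..<t}. LBINT u:{0<..<t}. g (u - v)) = (\<integral>v. (\<integral>h. k (v, h) \<partial>lborel) \<partial>lborel)"
    by (simp add: set_lebesgue_integral_def k_def mult_ac flip: integral_mult_right_zero)
  also have "\<dots> = (\<integral>h. (\<integral>v. k (v, h) \<partial>lborel) \<partial>lborel)"
  proof -
    have "integrable (lborel \<Otimes>\<^sub>M lborel) (case_prod (\<lambda>v h. k (v, h)))" using ki by simp
    from lborel_pair.Fubini_integral[OF this] show ?thesis by simp
  qed
  also have "\<dots> = (\<integral>h. g h * tent t h \<partial>lborel)"
    by (simp add: k_def overlap_integral)
  finally show ?thesis .
qed

lemma tent_integral_even: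
  fixes g :: "real \<Rightarrow> real"
  assumes [measurable]: "g \<in> borel_measurable borel" and R: "\<And>h. \<bar>g h\<bar> \<le> R" and even: "\<And>h. g (- h) = g h"
  shows "(\<integral>h. g h * tent t h \<partial>lborel) = 2 * (LBINT h:{0<..<t}. (t - h) * g h)"
proof -
  let ?k = "\<lambda>h. indicator {0<..<t} h * ((t - h) * g h)"
  have i: "integrable lborel ?k"
  proof (rule Bochner_Integration.integrable_bound)
    show "integrable lborel (\<lambda>h. (t * R) * indicator {0<..<t} h)"
      by (intro integrable_mult_right integrable_indicator_Ioo)
    have "norm (?k h) \<le> norm ((t * R) * indicator {0<..<t} h)" for h
      using R[of h] by (auto simp: indicator_def abs_mult intro!: mult_mono order_trans[OF R[of h]])
    then show "AE h in lborel. norm (?k h) \<le> norm ((t * R) * indicator {0<..<t} h)" by simp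
  qed simp
  have i': "integrable lborel (\<lambda>h. ?k (- h))"
    using lborel_integrable_real_affine[OF i, of "-1" 0] by simp
  have "(\<integral>h. g h * tent t h \<partial>lborel) = (\<integral>h. ?k h + ?k (- h) \<partial>lborel)"
  proof (rule integral_cong_AE)
    have "AE h in lborel. h \<noteq> (0::real)" by (rule AE_lborel_singleton)
    then show "AE h in lborel. g h * tent t h = ?k h + ?k (- h)"
      by eventually_elim (auto simp: tent_def indicator_def even max_def abs_if mult.commute)
  qed measurable
  also have "\<dots> = (\<integral>h. ?k h \<partial>lborel) + (\<integral>h. ?k (- h) \<partial>lborel)" using i i' by (rule Bochner_Integration.integral_add)
  also have "(\<integral>h. ?k (- h) \<partial>lborel) = (\<integral>h. ?k h \<partial>lborel)"
    using lborel_integral_real_affine[where c="-1" and t=0 and f="?k"] by simp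
  finally show ?thesis by (simp add: set_lebesgue_integral_def)
qed

text \<open>\<open>a\<close> is H - 1/2 and \<open>d\<close> is \<delta>, so 0 < a < 1/2 is the
  range 1/2 < H < 1.\<close>

locale long_memory_kernel =
  fixes a d :: real
  assumes a: "0 < a" "a < 1/2" and d: "0 \<le> d"
begin

text \<open>The derivative of the kernel away from 0 and \<open>d\<close>; the jump at 0 is treated
  apart.\<close>

definition p :: "real \<Rightarrow> real" where "p x = (if x > d then a * x powr (a - 1) else 0)"
text \<open>The kernel without its jump: on all of the line the kernel is d powr a times the
  indicator of [0, \<infinity>), plus \<open>prim\<close>.\<close>

definition prim :: "real \<Rightarrow> real" where "prim x = max d x powr a - d powr a"
text \<open>The autocorrelation of \<open>p\<close> at lag \<open>h\<close> after rescaling by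
  \<open>h\<close>, with e = d / h; see \<open>\<Gamma>_pos\<close>. The lower limit
  \<open>max e 0\<close> extends it to all real \<open>e\<close> as a continuous function.\<close>

definition \<beta> :: "real \<Rightarrow> real" where "\<beta> e = (LBINT z:{max e 0<..}. z powr (a - 1) * (1 + z) powr (a - 1))"
text \<open>The density, at lags h > 0, of half the second derivative of the increment variance:
  jump times slope of the kernel, plus the autocorrelation of the slope. The squared jump sits at
  lag 0 and shows up as a linear term instead.\<close>

definition \<rho> :: "real \<Rightarrow> real" where
  "\<rho> h = (if h > d then d powr a * (a * h powr (a - 1)) else 0) + a\<^sup>2 * h powr (2 * a - 1) * \<beta> (d / h)"

lemma p_measurable[measurable]: "p \<in> borel_measurable borel"
  unfolding p_def[abs_def] by measurable

lemma p_nonneg: "p x \<ge> 0"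
  using a by (simp add: p_def)

lemma prim_integral:
  assumes "x \<le> y"
  shows "(\<integral>\<^sup>+u. indicator {x<..<y} u * ennreal (p u) \<partial>lborel) = ennreal (prim y - prim x)"
proof -
  have "(p has_integral (prim y - prim x)) {x..y}"
  \<comment> \<open>At \<open>d\<close> the primitive has a kink, or an infinite one-sided slope
    when d = 0.\<close>
  proof (rule fundamental_theorem_of_calculus_interior_strong[where S="{d}"])
    show "continuous_on {x..y} prim"
      unfolding prim_def using a d by (intro continuous_intros continuous_on_powr') auto
    fix z assume z: "z \<in> {x<..<y} - {d}"
    show "(prim has_vector_derivative p z) (at z)"
    proof (cases "z > d")
      case True
      have "((\<lambda>x. x powr a - d powr a) has_real_derivative p z) (at z)"
        using True d by (auto intro!: derivative_eq_intros simp: p_def)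
      then have "(prim has_real_derivative p z) (at z)"
        by (rule has_field_derivative_transform_within_open[of _ _ _ "{d<..}"])
           (use True in \<open>auto simp: prim_def max_def\<close>)
      then show ?thesis by (simp only: has_real_derivative_iff_has_vector_derivative)
    next
      case False
      then have "z < d" using z by auto
      have "((\<lambda>x. 0) has_real_derivative p z) (at z)"
        using False by (simp add: p_def)
      then have "(prim has_real_derivative p z) (at z)"
        by (rule has_field_derivative_transform_within_open[of _ _ _ "{..<d}"])
           (use \<open>z < d\<close> in \<open>auto simp: prim_def max_def\<close>)
      then show ?thesis by (simp only: has_real_derivative_iff_has_vector_derivative)
    qed
  qed (use assms in auto)
  then have "(p has_integral (prim y - prim x)) {x<..<y}" by (simp add: has_integral_Icc_iff_Ioo)
  from nn_integral_has_integral_lebesgue[OF p_nonneg this]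
  show ?thesis by (simp add: ennreal_mult' ennreal_indicator)
qed

lemma prim_mono: "x \<le> y \<Longrightarrow> prim x \<le> prim y"
  unfolding prim_def using a d by (auto intro!: powr_mono2)

text \<open>The increment of \<open>prim\<close> over a step \<open>t\<close> (see
  \<open>B_eq\<close>), kept as an integral of \<open>p\<close> so that Tonelli applies to its
  products.\<close>

definition B :: "real \<Rightarrow> real \<Rightarrow> ennreal" where
  "B t x = (\<integral>\<^sup>+u. indicator {0<..<t} u * ennreal (p (x + u)) \<partial>lborel)"

lemma B_measurable[measurable]: "B t \<in> borel_measurable borel"
  unfolding B_def[abs_def] by measurable

lemma B_eq:
  assumes "t > 0"
  shows "B t x = ennreal (prim (x + t) - prim x)"
proof -
  have "(\<integral>\<^sup>+u. indicator {x<..<x+t} u * ennreal (p u) \<partial>lborel) = (\<integral>\<^sup>+u. indicator {x<..<x+t} (x + 1 * u) * ennreal (p (x + 1 * u)) \<partial>lborel)"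
    by (subst nn_integral_real_affine[where c=1 and t=x]) auto
  also have "\<dots> = B t x" unfolding B_def
    by (rule nn_integral_cong) (auto simp: indicator_def)
  finally show ?thesis using prim_integral[of x "x+t"] assms by simp
qed

lemma kernel_increment:
  assumes t: "t > 0"
  shows "ennreal ((ma_kernel 1 (a + 1/2) d (t + x) - ma_kernel 1 (a + 1/2) d x)\<^sup>2)
     = (ennreal (d powr a) * indicator {-t..<0} x + B t x)\<^sup>2"
proof -
  have e: "ma_kernel 1 (a + 1/2) d (t + x) - ma_kernel 1 (a + 1/2) d x = d powr a * indicator {-t..<0} x + (prim (x + t) - prim x)"
    using t d by (auto simp: ma_kernel_def prim_def indicator_def max_def add.commute)
  have "prim x \<le> prim (x + t)" using t by (intro prim_mono) simp
  then show ?thesis unfolding e B_eq[OF t]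
    by (simp add: ennreal_power[symmetric] ennreal_mult' flip: ennreal_indicator)
qed

text \<open>The autocorrelation of the slope. It takes extended values since it is infinite at h = 0
  when d = 0.\<close>

definition \<Gamma> :: "real \<Rightarrow> ennreal" where
  "\<Gamma> h = (\<integral>\<^sup>+y. ennreal (p (y + h)) * ennreal (p y) \<partial>lborel)"

lemma \<Gamma>_measurable[measurable]: "\<Gamma> \<in> borel_measurable borel"
  unfolding \<Gamma>_def[abs_def] by measurable

lemma B_cross:
  "(\<integral>\<^sup>+x. indicator {-t..<0} x * B t x \<partial>lborel) = (\<integral>\<^sup>+h. ennreal (p h) * ennreal (tent t h) \<partial>lborel)"
proof -
  have "(\<integral>\<^sup>+x. indicator {-t..<0} x * B t x \<partial>lborel) = (\<integral>\<^sup>+v. indicator {-t..<0} (0 + (-1) * v) * B t (0 + (-1) * v) \<partial>lborel)"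
    by (subst nn_integral_real_affine[where c="-1" and t=0]) auto
  also have "\<dots> = (\<integral>\<^sup>+v. indicator {0<..<t} v * (\<integral>\<^sup>+u. indicator {0<..<t} u * ennreal (p (u - v)) \<partial>lborel) \<partial>lborel)"
  proof (rule nn_integral_cong_AE)
    \<comment> \<open>Reflection turns [-t, 0) into (0, t], which differs from the open interval at
      \<open>t\<close>.\<close>
    have "AE v in lborel. v \<noteq> t" by (rule AE_lborel_singleton)
    then show "AE v in lborel. indicator {-t..<0} (0 + (-1) * v) * B t (0 + (-1) * v)
       = indicator {0<..<t} v * (\<integral>\<^sup>+u. indicator {0<..<t} u * ennreal (p (u - v)) \<partial>lborel)"
      by eventually_elim (auto simp: B_def indicator_def)
  qed
  also have "\<dots> = (\<integral>\<^sup>+h. ennreal (p h) * ennreal (tent t h) \<partial>lborel)"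
    by (rule double_nn_integral_difference) measurable
  finally show ?thesis .
qed

lemma \<Gamma>_shift: "(\<integral>\<^sup>+x. ennreal (p (x + u)) * ennreal (p (x + v)) \<partial>lborel) = \<Gamma> (u - v)"
  unfolding \<Gamma>_def
  by (subst nn_integral_real_affine[where c=1 and t="-v"]) (auto simp: algebra_simps)

lemma \<Gamma>_even: "\<Gamma> (- h) = \<Gamma> h"
  using \<Gamma>_shift[of 0 h] by (simp add: \<Gamma>_def mult.commute)

lemma B_square:
  "(\<integral>\<^sup>+x. B t x * B t x \<partial>lborel) = (\<integral>\<^sup>+h. \<Gamma> h * ennreal (tent t h) \<partial>lborel)"
proof -
  have "(\<integral>\<^sup>+x. B t x * B t x \<partial>lborel) = (\<integral>\<^sup>+x. (\<integral>\<^sup>+v. indicator {0<..<t} v * ennreal (p (x + v)) * B t x \<partial>lborel) \<partial>lborel)"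
    by (subst (1) B_def) (simp add: nn_integral_multc)
  also have "\<dots> = (\<integral>\<^sup>+v. (\<integral>\<^sup>+x. indicator {0<..<t} v * ennreal (p (x + v)) * B t x \<partial>lborel) \<partial>lborel)"
    by (rule lborel_pair.Fubini'[symmetric]) measurable
  also have "\<dots> = (\<integral>\<^sup>+v. indicator {0<..<t} v * (\<integral>\<^sup>+x. ennreal (p (x + v)) * B t x \<partial>lborel) \<partial>lborel)"
    by (simp add: nn_integral_cmult mult.assoc)
  also have "\<dots> = (\<integral>\<^sup>+v. indicator {0<..<t} v * (\<integral>\<^sup>+u. indicator {0<..<t} u * \<Gamma> (u - v) \<partial>lborel) \<partial>lborel)"
  proof -
    have "(\<integral>\<^sup>+x. ennreal (p (x + v)) * B t x \<partial>lborel) = (\<integral>\<^sup>+u. indicator {0<..<t} u * \<Gamma> (u - v) \<partial>lborel)" for v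
    proof -
      have "(\<integral>\<^sup>+x. ennreal (p (x + v)) * B t x \<partial>lborel) =
         (\<integral>\<^sup>+x. (\<integral>\<^sup>+u. indicator {0<..<t} u * (ennreal (p (x + u)) * ennreal (p (x + v))) \<partial>lborel) \<partial>lborel)"
        unfolding B_def by (simp add: nn_integral_cmult[symmetric] mult_ac)
      also have "\<dots> = (\<integral>\<^sup>+u. (\<integral>\<^sup>+x. indicator {0<..<t} u * (ennreal (p (x + u)) * ennreal (p (x + v))) \<partial>lborel) \<partial>lborel)"
        by (rule lborel_pair.Fubini'[symmetric]) measurable
      also have "\<dots> = (\<integral>\<^sup>+u. indicator {0<..<t} u * \<Gamma> (u - v) \<partial>lborel)"
        by (simp add: nn_integral_cmult \<Gamma>_shift)
      finally show ?thesis .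
    qed
    then show ?thesis by simp
  qed
  also have "\<dots> = (\<integral>\<^sup>+h. \<Gamma> h * ennreal (tent t h) \<partial>lborel)"
    by (rule double_nn_integral_difference) measurable
  finally show ?thesis .
qed

text \<open>Expanding the square of jump plus continuous part: the squared jump gives the linear
  term, the mixed term gives \<open>p\<close> (\<open>B_cross\<close>), and the square of the
  continuous part gives \<Gamma> (\<open>B_square\<close>). Nonnegativity of all terms lets this
  hold before any finiteness is known.\<close>

lemma incr_var_nn:
  assumes t: "t > 0"
  shows "(\<integral>\<^sup>+x. ennreal ((ma_kernel 1 (a + 1/2) d (t + x) - ma_kernel 1 (a + 1/2) d x)\<^sup>2) \<partial>lborel)
     = ennreal ((d powr a)\<^sup>2 * t) + (\<integral>\<^sup>+h. (2 * ennreal (d powr a) * ennreal (p h) + \<Gamma> h) * ennreal (tent t h) \<partial>lborel)"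
proof -
  define F where "F = ennreal (d powr a)"
  let ?i = "\<lambda>x. indicator {-t..<0} x :: ennreal"
  have "(F * ?i x + B t x)\<^sup>2 = F\<^sup>2 * ?i x + 2 * F * (?i x * B t x) + B t x * B t x" for x
    by (auto simp: indicator_def power2_eq_square algebra_simps mult_2)
  then have "(\<integral>\<^sup>+x. ennreal ((ma_kernel 1 (a + 1/2) d (t + x) - ma_kernel 1 (a + 1/2) d x)\<^sup>2) \<partial>lborel)
      = (\<integral>\<^sup>+x. F\<^sup>2 * ?i x + 2 * F * (?i x * B t x) + B t x * B t x \<partial>lborel)"
    unfolding kernel_increment[OF t] F_def by simp
  also have "\<dots> = F\<^sup>2 * ennreal t + 2 * F * (\<integral>\<^sup>+h. ennreal (p h) * ennreal (tent t h) \<partial>lborel) + (\<integral>\<^sup>+h. \<Gamma> h * ennreal (tent t h) \<partial>lborel)"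
    using t by (simp add: nn_integral_add nn_integral_cmult B_cross B_square)
  also have "\<dots> = F\<^sup>2 * ennreal t + (\<integral>\<^sup>+h. 2 * F * (ennreal (p h) * ennreal (tent t h)) + \<Gamma> h * ennreal (tent t h) \<partial>lborel)"
    by (simp add: nn_integral_add nn_integral_cmult add.assoc)
  also have "F\<^sup>2 * ennreal t = ennreal ((d powr a)\<^sup>2 * t)"
    using t by (simp add: F_def ennreal_power ennreal_mult')
  finally show ?thesis by (simp add: F_def distrib_right mult.assoc)
qed

text \<open>\<open>Beta_half_line\<close> with parameters \<open>a\<close> and 1 - 2 * a, both
  positive in the present range. Written out in Gamma functions, this Beta value is the origin of
  \<open>k_const\<close>.\<close>

lemma b_integrable: "integrable lborel (\<lambda>z. indicator {0<..} z * (z powr (a - 1) * (1 + z) powr (a - 1)))"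
  and b_integral: "(\<integral>z. indicator {0<..} z * (z powr (a - 1) * (1 + z) powr (a - 1)) \<partial>lborel) = k_const (a - 1)"
proof -
  have e: "- a - (1 - 2 * a) = a - 1" by simp
  show "integrable lborel (\<lambda>z. indicator {0<..} z * (z powr (a - 1) * (1 + z) powr (a - 1)))"
    using Beta_half_line(1)[of a "1 - 2 * a"] a by (simp add: set_integrable_def e)
  have "(\<integral>z. indicator {0<..} z * (z powr (a - 1) * (1 + z) powr (a - 1)) \<partial>lborel) = Beta a (1 - 2 * a)"
    using Beta_half_line(2)[of a "1 - 2 * a"] a by (simp add: set_lebesgue_integral_def e)
  also have "\<dots> = k_const (a - 1)" by (simp add: Beta_def k_const_def algebra_simps)
  finally show "(\<integral>z. indicator {0<..} z * (z powr (a - 1) * (1 + z) powr (a - 1)) \<partial>lborel) = k_const (a - 1)" .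
qed

lemma \<beta>_eq: "\<beta> e = (\<integral>z. indicator {e<..} z * (indicator {0<..} z * (z powr (a - 1) * (1 + z) powr (a - 1))) \<partial>lborel)"
  unfolding \<beta>_def set_lebesgue_integral_def
  by (rule Bochner_Integration.integral_cong) (auto simp: indicator_def)

lemma \<beta>_nonneg: "\<beta> e \<ge> 0"
  unfolding \<beta>_eq by (intro Bochner_Integration.integral_nonneg) auto

lemma \<beta>_0: "\<beta> 0 = k_const (a - 1)"
  unfolding b_integral[symmetric] \<beta>_eq
  by (rule Bochner_Integration.integral_cong) (auto simp: indicator_def)

text \<open>Dominated convergence with the untruncated integrand as bound. The value at 0 gives the
  limit of \<rho> at infinity, the other values give continuity of \<rho>.\<close>

lemma isCont_\<beta>: "isCont \<beta> e"
  unfolding continuous_at_sequentially comp_def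
proof (intro allI impI)
  fix u assume u: "u \<longlonglongrightarrow> e"
  let ?b = "\<lambda>z. indicator {0<..} z * (z powr (a - 1) * (1 + z) powr (a - 1)) :: real"
  show "(\<lambda>n. \<beta> (u n)) \<longlonglongrightarrow> \<beta> e"
    unfolding \<beta>_eq
  proof (rule integral_dominated_convergence[where w="?b"])
    have "AE z in lborel. z \<noteq> e" by (rule AE_lborel_singleton)
    then show "AE z in lborel. (\<lambda>n. indicator {u n<..} z * ?b z) \<longlonglongrightarrow> indicator {e<..} z * ?b z"
    proof eventually_elim
      case (elim z)
      have "\<forall>\<^sub>F n in sequentially. indicator {u n<..} z * ?b z = indicator {e<..} z * ?b z"
      proof (cases "z > e")
        case True
        show ?thesis using order_tendstoD(2)[OF u True] by eventually_elim (use True in auto)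
      next
        case False
        then have "z < e" using elim by simp
        show ?thesis using order_tendstoD(1)[OF u \<open>z < e\<close>] by eventually_elim (use \<open>z < e\<close> in auto)
      qed
      then show ?case by (rule tendsto_eventually)
    qed
    show "integrable lborel ?b" by (rule b_integrable)
    show "AE z in lborel. norm (indicator {u n<..} z * ?b z) \<le> ?b z" for n
      by (auto simp: indicator_def)
  qed measurable
qed

lemma continuous_on_\<beta>: "continuous_on A \<beta>"
  using isCont_\<beta> by (simp add: continuous_at_imp_continuous_on)

lemma \<beta>_measurable[measurable]: "\<beta> \<in> borel_measurable borel"
  using continuous_on_\<beta> by (rule borel_measurable_continuous_onI)

lemma \<rho>_measurable[measurable]: "\<rho> \<in> borel_measurable borel"
  unfolding \<rho>_def[abs_def] by measurable

lemma \<rho>_nonneg: "\<rho> h \<ge> 0"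
  using a by (simp add: \<rho>_def \<beta>_nonneg)

text \<open>Substituting y = h * z extracts the power of \<open>h\<close> and moves the cut-off from
  \<open>d\<close> to d / h.\<close>

lemma \<Gamma>_pos:
  assumes h: "h > 0"
  shows "\<Gamma> h = ennreal (a\<^sup>2 * h powr (2 * a - 1) * \<beta> (d / h))"
proof -
  let ?b = "\<lambda>z. indicator {d/h<..} z * (indicator {0<..} z * (z powr (a - 1) * (1 + z) powr (a - 1))) :: real"
  define c where "c = a\<^sup>2 * (h powr (a - 1))\<^sup>2"
  have c: "c \<ge> 0" by (simp add: c_def)
  have e: "ennreal (p (h * z + h)) * ennreal (p (h * z)) = ennreal (c * ?b z)" for z
  proof (cases "h * z > d")
    case True
    then have z: "z > d / h" "z > 0" using h d by (auto simp: field_simps) (metis le_less_trans mult_pos_neg not_less order_less_le zero_less_mult_pos)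
    have "h * z + h = h * (1 + z)" by (simp add: algebra_simps)
    moreover have "h * z + h > d" using True h by simp
    ultimately have "p (h * z + h) * p (h * z) = c * ?b z"
      using True z h by (simp add: p_def c_def powr_mult power2_eq_square)
    then show ?thesis using p_nonneg by (simp flip: ennreal_mult)
  next
    case False
    then have "\<not> z > d / h" using h by (simp add: field_simps)
    then show ?thesis using False by (simp add: p_def)
  qed
  have i: "integrable lborel ?b"
    using integrable_mult_indicator[OF _ b_integrable, of "{d/h<..}"] by simp
  have "\<Gamma> h = ennreal \<bar>h\<bar> * (\<integral>\<^sup>+z. ennreal (p (0 + h * z + h)) * ennreal (p (0 + h * z)) \<partial>lborel)"
    unfolding \<Gamma>_def by (rule nn_integral_real_affine) (use h in auto)
  also have "\<dots> = ennreal h * (\<integral>\<^sup>+z. ennreal (c * ?b z) \<partial>lborel)" using h by (simp add: e)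
  also have "(\<integral>\<^sup>+z. ennreal (c * ?b z) \<partial>lborel) = ennreal (\<integral>z. c * ?b z \<partial>lborel)"
    by (rule nn_integral_eq_integral) (use i c in auto)
  also have "(\<integral>z. c * ?b z \<partial>lborel) = c * \<beta> (d / h)" by (simp add: \<beta>_eq)
  also have "ennreal h * ennreal (c * \<beta> (d / h)) = ennreal ((h * c) * \<beta> (d / h))"
    using h c \<beta>_nonneg by (simp add: mult.assoc flip: ennreal_mult)
  also have "h * c = a\<^sup>2 * h powr (2 * a - 1)"
  proof -
    have "h * h powr (2 * (a - 1)) = h powr (1 + 2 * (a - 1))" using h by (simp only: powr_add powr_one)
    also have "1 + 2 * (a - 1) = 2 * a - 1" by simp
    finally show ?thesis by (simp only: c_def powr_double mult.left_commute[of h])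
  qed
  finally show ?thesis .
qed

text \<open>The line is folded at lag 0. \<open>p\<close> vanishes on negative lags while \<Gamma>
  is even, so folding doubles \<Gamma> only, and the sum becomes 2 * \<rho>.\<close>

lemma folded_density:
  fixes t :: real
  shows "(\<integral>\<^sup>+h. (2 * ennreal (d powr a) * ennreal (p h) + \<Gamma> h) * ennreal (tent t h) \<partial>lborel)
       = (\<integral>\<^sup>+h. ennreal (2 * (indicator {0<..<t} h * ((t - h) * \<rho> h))) \<partial>lborel)"
proof -
  let ?W = "\<lambda>h. 2 * ennreal (d powr a) * ennreal (p h) + \<Gamma> h"
  let ?k = "\<lambda>h. ?W h * ennreal (tent t h)"
  have "(\<integral>\<^sup>+h. ?k h \<partial>lborel) = (\<integral>\<^sup>+h. indicator {0<..} h * ?k h + indicator {..<0} h * ?k h \<partial>lborel)"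
  proof (rule nn_integral_cong_AE)
    have "AE h in lborel. h \<noteq> (0::real)" by (rule AE_lborel_singleton)
    then show "AE h in lborel. ?k h = indicator {0<..} h * ?k h + indicator {..<0} h * ?k h"
      by eventually_elim (auto simp: indicator_def)
  qed
  also have "\<dots> = (\<integral>\<^sup>+h. indicator {0<..} h * ?k h \<partial>lborel) + (\<integral>\<^sup>+h. indicator {..<0} h * ?k h \<partial>lborel)"
    by (rule nn_integral_add) measurable
  also have "(\<integral>\<^sup>+h. indicator {..<0} h * ?k h \<partial>lborel) = (\<integral>\<^sup>+h. indicator {0<..} h * ?k (- h) \<partial>lborel)"
    by (subst nn_integral_real_affine[where c="-1" and t=0]) (auto simp: indicator_def intro!: nn_integral_cong)
  also have "(\<integral>\<^sup>+h. indicator {0<..} h * ?k h \<partial>lborel) + \<dots> = (\<integral>\<^sup>+h. indicator {0<..} h * ?k h + indicator {0<..} h * ?k (- h) \<partial>lborel)"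
    by (rule nn_integral_add[symmetric]) measurable
  also have "\<dots> = (\<integral>\<^sup>+h. ennreal (2 * (indicator {0<..<t} h * ((t - h) * \<rho> h))) \<partial>lborel)"
  proof (rule nn_integral_cong)
    fix h :: real
    show "indicator {0<..} h * ?k h + indicator {0<..} h * ?k (- h) = ennreal (2 * (indicator {0<..<t} h * ((t - h) * \<rho> h)))"
    proof (cases "0 < h \<and> h < t")
      case True
      have pm: "p (- h) = 0" using True d by (simp add: p_def)
      define u where "u = d powr a * p h"
      define v where "v = a\<^sup>2 * h powr (2 * a - 1) * \<beta> (d / h)"
      have uv: "u \<ge> 0" "v \<ge> 0" using p_nonneg by (simp_all add: u_def v_def \<beta>_nonneg)
      have \<rho>: "\<rho> h = u + v" by (simp add: \<rho>_def u_def v_def p_def)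
      have tent: "tent t h = t - h" "tent t (- h) = t - h" using True by (auto simp: tent_def)
      have W: "?W h = ennreal (2 * u + v)" "?W (- h) = ennreal v"
      proof -
        have G: "\<Gamma> h = ennreal v" unfolding v_def using True by (intro \<Gamma>_pos) simp
        have U: "2 * ennreal (d powr a) * ennreal (p h) = ennreal (2 * u)"
          unfolding u_def using p_nonneg by (simp add: ennreal_mult mult.assoc)
        show "?W h = ennreal (2 * u + v)" unfolding G U using uv by (simp add: ennreal_plus)
        show "?W (- h) = ennreal v" by (simp add: pm \<Gamma>_even G)
      qed
      show ?thesis unfolding W tent using True uv
        by (simp add: \<rho> ennreal_mult[symmetric] ennreal_plus[symmetric] del: ennreal_plus) (simp add: algebra_simps)
    next
      case False
      then have "h \<le> 0 \<or> tent t h = 0 \<and> tent t (- h) = 0" by (auto simp: tent_def)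
      then show ?thesis using False by (auto simp: indicator_def)
    qed
  qed
  finally show ?thesis .
qed

text \<open>By \<open>int\<close> the left side of \<open>incr_var_nn\<close> is finite, so
  integrability of the weighted density comes out of the identity instead of being
  estimated.\<close>

lemma incr_var_representation:
  assumes t: "t > 0"
    and int: "integrable lborel (\<lambda>x. (ma_kernel 1 (a + 1/2) d (t + x) - ma_kernel 1 (a + 1/2) d x)\<^sup>2)"
  shows "set_integrable lborel {0<..<t} (\<lambda>h. (t - h) * \<rho> h)"
    and "incr_var (ma_kernel 1 (a + 1/2) d) t = (d powr a)\<^sup>2 * t + 2 * (LBINT h:{0<..<t}. (t - h) * \<rho> h)"
proof -
  let ?g = "\<lambda>h. 2 * (indicator {0<..<t} h * ((t - h) * \<rho> h))"
  have g0: "?g h \<ge> 0" for h using \<rho>_nonneg[of h] by (auto simp: indicator_def)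
  have E: "ennreal (incr_var (ma_kernel 1 (a + 1/2) d) t) = ennreal ((d powr a)\<^sup>2 * t) + (\<integral>\<^sup>+h. ennreal (?g h) \<partial>lborel)"
    using incr_var_nn[OF t] unfolding folded_density incr_var_def by (subst nn_integral_eq_integral[OF int, symmetric]) auto
  have fin: "(\<integral>\<^sup>+h. ennreal (?g h) \<partial>lborel) < \<infinity>"
  proof (rule ccontr)
    assume "\<not> ?thesis"
    then have "(\<integral>\<^sup>+h. ennreal (?g h) \<partial>lborel) = top" by (simp only: infinity_ennreal_def not_less top_unique)
    with E have "ennreal (incr_var (ma_kernel 1 (a + 1/2) d) t) = top" by (simp only: add_top_right_ennreal)
    then show False by simp
  qed
  have gi: "integrable lborel ?g"
    by (rule integrableI_nonneg) (use fin g0 in auto)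
  then show si: "set_integrable lborel {0<..<t} (\<lambda>h. (t - h) * \<rho> h)"
    by (simp add: set_integrable_def)
  have "(\<integral>\<^sup>+h. ennreal (?g h) \<partial>lborel) = ennreal (\<integral>h. ?g h \<partial>lborel)"
    by (rule nn_integral_eq_integral[OF gi]) (use g0 in auto)
  moreover have "(\<integral>h. ?g h \<partial>lborel) \<ge> 0" by (intro Bochner_Integration.integral_nonneg g0)
  ultimately have "ennreal (incr_var (ma_kernel 1 (a + 1/2) d) t) = ennreal ((d powr a)\<^sup>2 * t + (\<integral>h. ?g h \<partial>lborel))"
    using E t by (simp add: ennreal_plus)
  then have "incr_var (ma_kernel 1 (a + 1/2) d) t = (d powr a)\<^sup>2 * t + (\<integral>h. ?g h \<partial>lborel)"
    using t \<open>(\<integral>h. ?g h \<partial>lborel) \<ge> 0\<close> by (subst (asm) ennreal_inj) (auto simp: incr_var_nonneg)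
  then show "incr_var (ma_kernel 1 (a + 1/2) d) t = (d powr a)\<^sup>2 * t + 2 * (LBINT h:{0<..<t}. (t - h) * \<rho> h)"
    by (simp add: set_lebesgue_integral_def)
qed

lemma \<rho>_eq: "h > d \<Longrightarrow> \<rho> h = d powr a * (a * h powr (a - 1)) + a\<^sup>2 * h powr (2 * a - 1) * \<beta> (d / h)"
  by (simp add: \<rho>_def)

lemma continuous_on_\<rho>: "continuous_on {d + 1..} \<rho>"
proof -
  have "continuous_on {d + 1..} (\<lambda>h. d powr a * (a * h powr (a - 1)) + a\<^sup>2 * h powr (2 * a - 1) * \<beta> (d / h))"
    using d by (intro continuous_intros continuous_on_compose2[OF continuous_on_\<beta>[of UNIV]]) auto
  then show ?thesis
    by (rule continuous_on_cong[THEN iffD1, rotated -1]) (auto simp: \<rho>_eq)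
qed

text \<open>Relative to h powr (2 * a - 1) the mixed term is of order h powr (- a) and vanishes,
  while the cut-off d / h of the other term tends to 0.\<close>

lemma \<rho>_asymp: "((\<lambda>h. \<rho> h / h powr (2 * a - 1)) \<longlongrightarrow> a\<^sup>2 * k_const (a - 1)) at_top"
proof -
  have 1: "((\<lambda>h. h powr (- a)) \<longlongrightarrow> 0) at_top"
    using a by (intro tendsto_neg_powr filterlim_ident) auto
  have "((\<lambda>h. d / h) \<longlongrightarrow> 0) at_top" by real_asymp
  from isCont_tendsto_compose[OF isCont_\<beta> this]
  have 2: "((\<lambda>h. \<beta> (d / h)) \<longlongrightarrow> k_const (a - 1)) at_top" by (simp add: \<beta>_0)
  have "((\<lambda>h. d powr a * a * h powr (- a) + a\<^sup>2 * \<beta> (d / h)) \<longlongrightarrow> d powr a * a * 0 + a\<^sup>2 * k_const (a - 1)) at_top"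
    by (intro tendsto_intros 1 2)
  then have "((\<lambda>h. d powr a * a * h powr (- a) + a\<^sup>2 * \<beta> (d / h)) \<longlongrightarrow> a\<^sup>2 * k_const (a - 1)) at_top" by simp
  then show ?thesis
  proof (rule Lim_transform_eventually)
    show "\<forall>\<^sub>F h in at_top. d powr a * a * h powr (- a) + a\<^sup>2 * \<beta> (d / h) = \<rho> h / h powr (2 * a - 1)"
      using eventually_gt_at_top[of d]
    proof eventually_elim
      case (elim h)
      then have h: "h > 0" using d by simp
      have "h powr (a - 1) / h powr (2 * a - 1) = h powr (- a)"
        using h by (simp flip: powr_diff)
      moreover have "\<rho> h / h powr (2 * a - 1) = d powr a * a * (h powr (a - 1) / h powr (2 * a - 1))
          + a\<^sup>2 * \<beta> (d / h) * (h powr (2 * a - 1) / h powr (2 * a - 1))"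
        unfolding \<rho>_eq[OF elim] add_divide_distrib by (simp only: times_divide_eq_right mult_ac)
      ultimately show ?case using h by simp
    qed
  qed
qed

text \<open>The weight T + 1 - h exceeds 1 on (0, T), so the representation at time T + 1 dominates
  \<rho> itself.\<close>

lemma \<rho>_set_integrable:
  assumes T: "T > 0"
    and int: "integrable lborel (\<lambda>x. (ma_kernel 1 (a + 1/2) d (T + 1 + x) - ma_kernel 1 (a + 1/2) d x)\<^sup>2)"
  shows "set_integrable lborel {0<..<T} \<rho>"
proof -
  have "set_integrable lborel {0<..<T + 1} (\<lambda>h. (T + 1 - h) * \<rho> h)"
    by (rule incr_var_representation) (use T int in auto)
  then have "integrable lborel (\<lambda>h. indicator {0<..<T + 1} h *\<^sub>R ((T + 1 - h) * \<rho> h))" by (simp add: set_integrable_def)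
  then show ?thesis unfolding set_integrable_def
  proof (rule Bochner_Integration.integrable_bound)
    have "\<rho> h \<le> (T + 1 - h) * \<rho> h" if "h < T" for h
      using mult_right_mono[of 1 "T + 1 - h" "\<rho> h"] \<rho>_nonneg[of h] that by simp
    then show "AE h in lborel. norm (indicator {0<..<T} h *\<^sub>R \<rho> h) \<le> norm (indicator {0<..<T + 1} h *\<^sub>R ((T + 1 - h) * \<rho> h))"
      using \<rho>_nonneg by (auto simp: indicator_def)
  qed measurable
qed

end

section \<open>The autocovariance\<close>

text \<open>Square integrability of the kernel increments is part of the hypothesis that
  \<open>Y\<close> is an integral; reflecting s and dividing by \<open>r\<close> brings it to the
  normalised kernel.\<close>

lemma kernel_square_integrable:
  assumes "is_levy_integral M Z (\<lambda>s. ma_kernel r H d (t - s) - ma_kernel r H d (- s)) Y" and "r \<noteq> 0"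
  shows "integrable lborel (\<lambda>x. (ma_kernel 1 H d (t + x) - ma_kernel 1 H d x)\<^sup>2)"
    and "(\<integral>s. (ma_kernel r H d (t - s) - ma_kernel r H d (- s))\<^sup>2 \<partial>lborel) = r\<^sup>2 * incr_var (ma_kernel 1 H d) t"
proof -
  let ?f = "ma_kernel r H d"
  have f: "?f = (\<lambda>x. r * ma_kernel 1 H d x)" by (auto simp: ma_kernel_def fun_eq_iff)
  have "integrable lborel (\<lambda>s. (?f (t - s) - ?f (- s))\<^sup>2)"
    using assms by (simp add: is_levy_integral_def)
  from lborel_integrable_real_affine[OF this, of "-1" 0]
  have "integrable lborel (\<lambda>x. (?f (t + x) - ?f x)\<^sup>2)" by simp
  moreover have e: "(?f (t + x) - ?f x)\<^sup>2 = r\<^sup>2 * (ma_kernel 1 H d (t + x) - ma_kernel 1 H d x)\<^sup>2" for x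
    unfolding f by (simp add: power_mult_distrib flip: right_diff_distrib)
  ultimately show "integrable lborel (\<lambda>x. (ma_kernel 1 H d (t + x) - ma_kernel 1 H d x)\<^sup>2)"
    using assms(2) by simp
  have "(\<integral>s. (?f (t - s) - ?f (- s))\<^sup>2 \<partial>lborel) = incr_var ?f t"
    unfolding incr_var_def by (subst lborel_integral_real_affine[where c="-1" and t=0]) auto
  then show "(\<integral>s. (?f (t - s) - ?f (- s))\<^sup>2 \<partial>lborel) = r\<^sup>2 * incr_var (ma_kernel 1 H d) t"
    by (simp only: f incr_var_cmult)
qed

text \<open>The starting bound for \<open>incr_var_growth\<close>, from the power law if d = 0 and
  from the jump estimate if d > 0.\<close>

lemma incr_var_kernel_small:
  assumes H: "0 < H" "H < 1" and d: "d \<ge> 0"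
    and int: "\<And>t. integrable lborel (\<lambda>x. (ma_kernel 1 H d (t + x) - ma_kernel 1 H d x)\<^sup>2)"
  shows "\<exists>e>0. \<exists>c. \<forall>t. 0 < t \<and> t < e \<longrightarrow> incr_var (ma_kernel 1 H d) t \<le> c"
proof (cases "d = 0")
  case True
  have "incr_var (ma_kernel 1 H d) t \<le> j_const (H - 1/2)" if "0 < t" "t < 1" for t
  proof -
    have "t powr (2 * H) \<le> 1 powr (2 * H)" using that H by (intro powr_mono2) auto
    then show ?thesis
      using incr_var_power_law[OF H that(1)] int j_const_pos[of "H - 1/2"] H True
      by (simp add: mult_left_le)
  qed
  then show ?thesis by (intro exI[of _ 1]) auto
next
  case False
  then have "d > 0" using d by simp
  from incr_var_jump[OF H this int] obtain c where c: "c \<ge> 0"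
    and b: "\<And>t. 0 < t \<Longrightarrow> t < d \<Longrightarrow> \<bar>incr_var (ma_kernel 1 H d) t - d powr (2 * H - 1) * t\<bar> \<le> c * t\<^sup>2" by blast
  have "incr_var (ma_kernel 1 H d) t \<le> d powr (2 * H - 1) * d + c * d\<^sup>2" if "0 < t" "t < d" for t
  proof -
    have "d powr (2 * H - 1) * t \<le> d powr (2 * H - 1) * d" using that by (intro mult_left_mono) auto
    moreover have "c * t\<^sup>2 \<le> c * d\<^sup>2" using that c by (intro mult_left_mono power_mono) auto
    ultimately show ?thesis using b[OF that] by linarith
  qed
  then show ?thesis using \<open>d > 0\<close> by blast
qed

lemma k_const_pos: "-1 < \<alpha> \<Longrightarrow> \<alpha> < -1/2 \<Longrightarrow> k_const \<alpha> > 0"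
  unfolding k_const_def by (intro divide_pos_pos mult_pos_pos Gamma_real_pos) auto

section \<open>From the noise variance to the autocovariance\<close>

context stationary_qou
begin

lemma autocov_bar_approx:
  assumes "t > 0"
  shows "\<bar>autocov_bar M X t - V t / 2\<bar> \<le> (lam\<^sup>2 * r 0 / 2) * t\<^sup>2"
proof -
  have "autocov_bar M X t - V t / 2 = - (lam\<^sup>2 * expectation (\<lambda>\<omega>. (I t \<omega>)\<^sup>2) / 2)"
    using variogram_identity[OF assms] by (simp add: autocov_bar_def autocov_eq field_simps)
  moreover have "lam\<^sup>2 * expectation (\<lambda>\<omega>. (I t \<omega>)\<^sup>2) \<le> lam\<^sup>2 * (r 0 * t\<^sup>2)"
    by (intro mult_left_mono I_props(2) assms) simp
  ultimately show ?thesis by simp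
qed

lemma autocov_bar_even: "autocov_bar M X (- t) = autocov_bar M X t"
  by (simp add: autocov_bar_def autocov_eq r_even)

lemma autocov_bar_asymp:
  assumes "c \<noteq> 0" "p < 2" "e > 0" "\<And>t. 0 < t \<Longrightarrow> t < e \<Longrightarrow> \<bar>V t - 2 * c * t powr p\<bar> \<le> K * t\<^sup>2"
  shows "autocov_bar M X \<sim>[at 0] (\<lambda>t. c * \<bar>t\<bar> powr p)"
proof (rule asymp_equiv_at_0I[where g="autocov_bar M X", OF assms(1-3) autocov_bar_even])
  fix t :: real assume t: "0 < t" "t < e"
  have "\<bar>autocov_bar M X t - c * t powr p\<bar> \<le> (lam\<^sup>2 * r 0 / 2) * t\<^sup>2 + (K * t\<^sup>2) / 2"
    using autocov_bar_approx[OF t(1)] assms(4)[OF t] by linarith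
  then show "\<bar>autocov_bar M X t - c * t powr p\<bar> \<le> (lam\<^sup>2 * r 0 / 2 + K / 2) * t\<^sup>2"
    by (simp add: algebra_simps)
qed

lemma autocov_volterra:
  assumes V: "V t = 2 * (m * t + J)" and t: "t > 0"
  shows "r t = r 0 - m * t + lam\<^sup>2 * (LBINT h:{0<..<t}. (t - h) * r h) - J"
proof -
  have "expectation (\<lambda>\<omega>. (I t \<omega>)\<^sup>2) = 2 * (LBINT h:{0<..<t}. (t - h) * r h)"
    unfolding I_second_moment[OF t] double_integral_difference[OF r_measurable r_bound]
    by (rule tent_integral_even[OF r_measurable r_bound r_even])
  then show ?thesis using variogram_identity[OF t] V by (simp add: field_simps)
qed

lemma autocov_tail:
  assumes V: "\<And>t. t > 0 \<Longrightarrow> V t = 2 * (m * t + (LBINT h:{0<..<t}. (t - h) * \<rho> h))"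
    and int: "\<And>t. t > 0 \<Longrightarrow> set_integrable lborel {0<..<t} \<rho>"
    and int': "\<And>t. t > 0 \<Longrightarrow> set_integrable lborel {0<..<t} (\<lambda>h. (t - h) * \<rho> h)"
    and cont: "continuous_on {T\<^sub>0..} \<rho>" and T\<^sub>0: "T\<^sub>0 > 0"
    and b: "-1 \<le> b" "b < 0"
    and lim: "((\<lambda>t. \<rho> t / t powr b) \<longlongrightarrow> K) at_top" and K: "K \<noteq> 0"
  shows "autocov M X \<sim>[at_top] (\<lambda>t. K / lam\<^sup>2 * t powr b)"
proof -
  \<comment> \<open>The prospective second derivative of \<open>r\<close>;
    \<open>autocov_volterra\<close> states this in twice integrated form.\<close>
  define q where "q h = lam\<^sup>2 * r h - \<rho> h" for h
  have bounded: "set_integrable lborel {0<..<t} g"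
    if "g \<in> borel_measurable borel" "\<And>h. 0 < h \<Longrightarrow> h < t \<Longrightarrow> \<bar>g h\<bar> \<le> D" for g :: "real \<Rightarrow> real" and t D
    unfolding set_integrable_def
  proof (rule Bochner_Integration.integrable_bound)
    show "integrable lborel (\<lambda>h. D * indicator {0<..<t} h)"
      by (intro integrable_mult_right integrable_indicator_Ioo)
    have "norm (indicator {0<..<t} h *\<^sub>R g h) \<le> norm (D * indicator {0<..<t} h)" for h
      using that(2)[of h] by (auto simp: indicator_def)
    then show "AE h in lborel. norm (indicator {0<..<t} h *\<^sub>R g h) \<le> norm (D * indicator {0<..<t} h)" by simp
  qed (use that(1) in measurable)
  have ir: "set_integrable lborel {0<..<t} (\<lambda>h. lam\<^sup>2 * r h)" for t
    by (intro set_integrable_mult_right bounded[of _ _ "r 0"]) (auto simp: r_bound)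
  have ir': "set_integrable lborel {0<..<t} (\<lambda>h. lam\<^sup>2 * ((t - h) * r h))" for t
  proof (intro set_integrable_mult_right bounded[of _ _ "t * r 0"])
    show "\<bar>(t - h) * r h\<bar> \<le> t * r 0" if "0 < h" "h < t" for h
      unfolding abs_mult using that r_bound[of h] by (intro mult_mono) auto
  qed auto
  have iq: "set_integrable lborel {0<..<t} q" if "t > 0" for t
    unfolding q_def[abs_def] by (rule set_integral_diff(1)[OF ir int[OF that]])
  have eq: "r t = r 0 + (- m) * t + (LBINT h:{0<..<t}. (t - h) * q h)" if t: "t > 0" for t
  proof -
    have "(LBINT h:{0<..<t}. (t - h) * q h) = (LBINT h:{0<..<t}. lam\<^sup>2 * ((t - h) * r h) - (t - h) * \<rho> h)"
      by (simp add: q_def algebra_simps)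
    also have "\<dots> = lam\<^sup>2 * (LBINT h:{0<..<t}. (t - h) * r h) - (LBINT h:{0<..<t}. (t - h) * \<rho> h)"
      using set_integral_diff(2)[OF ir' int'[OF t]] by simp
    finally show ?thesis using autocov_volterra[OF V[OF t] t] by simp
  qed
  have cq: "continuous_on {T\<^sub>0..} q" if "continuous_on {T\<^sub>0..} r"
    unfolding q_def[abs_def] by (intro continuous_intros that cont)
  have D1: "(r has_real_derivative - m + (LBINT h:{0<..<t}. q h)) (at t)" if "t > T\<^sub>0" for t
    by (rule volterra_derivatives(1)[OF T\<^sub>0 _ _ _ that]) (fact iq eq cq)+
  have D2: "((\<lambda>t. - m + (LBINT h:{0<..<t}. q h)) has_real_derivative lam\<^sup>2 * r t - \<rho> t) (at t)" if "t > T\<^sub>0" for t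
    unfolding q_def[of t, symmetric] by (rule volterra_derivatives(2)[OF T\<^sub>0 _ _ _ that]) (fact iq eq cq)+
  have "((\<lambda>t. r t / t powr b) \<longlongrightarrow> K / lam\<^sup>2) at_top"
    by (rule bounded_solution_asymptotics[OF lam b D1 D2 r_bound lim])
  then have "((\<lambda>t. r t / t powr b / (K / lam\<^sup>2)) \<longlongrightarrow> K / lam\<^sup>2 / (K / lam\<^sup>2)) at_top"
    by (rule tendsto_divide[OF _ tendsto_const]) (use K lam in auto)
  then have "((\<lambda>t. r t / (K / lam\<^sup>2 * t powr b)) \<longlongrightarrow> 1) at_top"
    using K lam by (simp add: mult.commute)
  then show ?thesis by (intro asymp_equivI') (simp add: autocov_eq)
qed

end

theorem corollary4p10:
  fixes M :: "'a measure"
    and Z N X :: "real \<Rightarrow> 'a \<Rightarrow> real"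
    and H r\<^sub>0 \<delta> lam :: real
  assumes "prob_space M"
    and "two_sided_levy_process M Z"
    and "\<And>t. integrable M (\<lambda>\<omega>. (Z t \<omega>)\<^sup>2)"
    and "\<And>t. prob_space.expectation M (Z t) = 0"
    and "\<And>t. prob_space.variance M (Z t) = \<bar>t\<bar>"
    and "0 < H" and "H < 1" and "r\<^sub>0 \<noteq> 0" and "\<delta> \<ge> 0" and "lam > 0"
    and "measurable_process M N"
    and "\<And>t. is_levy_integral M Z
               (\<lambda>s. ma_kernel r\<^sub>0 H \<delta> (t - s) - ma_kernel r\<^sub>0 H \<delta> (- s)) (N t)"
    and "qou_process M N lam X"
  shows "(1/2 < H \<longrightarrow>
            autocov M X \<sim>[at_top]
              (\<lambda>t. (r\<^sub>0\<^sup>2 * k_const (H - 3/2) * (H - 1/2)\<^sup>2 / lam\<^sup>2) * t powr (2 * H - 2))) \<and>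
         (\<delta> > 0 \<longrightarrow>
            autocov_bar M X \<sim>[at 0] (\<lambda>t. (r\<^sub>0\<^sup>2 * \<delta> powr (2 * H - 1) / 2) * \<bar>t\<bar>)) \<and>
         (\<delta> = 0 \<longrightarrow>
            autocov_bar M X \<sim>[at 0] (\<lambda>t. (r\<^sub>0\<^sup>2 * j_const (H - 1/2) / 2) * \<bar>t\<bar> powr (2 * H)))"
proof -
  let ?V = "incr_var (ma_kernel 1 H \<delta>)"
  interpret Z: orthogonal_increments M Z
    using assms(1-5) by (rule levy_orthogonal_increments)
  note int = kernel_square_integrable(1)[OF assms(12,8)]
  obtain e c where e: "e > 0" "\<And>t. 0 < t \<Longrightarrow> t < e \<Longrightarrow> ?V t \<le> c"
    using incr_var_kernel_small[OF assms(6,7,9) int] by blast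
  then obtain C where C: "\<And>t. ?V t \<le> C * (1 + t\<^sup>2)"
    using incr_var_growth[OF int e] by blast
  interpret stationary_qou M N X lam "r\<^sub>0\<^sup>2 * C" "\<lambda>t. r\<^sub>0\<^sup>2 * ?V t"
  proof
    show "sq_integrable M (N t)" "Z.expectation (N t) = 0"
      "Z.expectation (\<lambda>\<omega>. (N t \<omega>)\<^sup>2) = r\<^sub>0\<^sup>2 * ?V t" for t
      using Z.levy_integral_moments[OF assms(12)] kernel_square_integrable(2)[OF assms(12,8)] by auto
    show "r\<^sub>0\<^sup>2 * ?V t \<le> r\<^sub>0\<^sup>2 * C * (1 + t\<^sup>2)" for t
      using mult_left_mono[OF C[of t], of "r\<^sub>0\<^sup>2"] by (simp add: mult.assoc)
  qed (use assms in auto)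
  have "autocov M X \<sim>[at_top] (\<lambda>t. (r\<^sub>0\<^sup>2 * k_const (H - 3/2) * (H - 1/2)\<^sup>2 / lam\<^sup>2) * t powr (2 * H - 2))"
    if H: "1/2 < H"
  proof -
    interpret K: long_memory_kernel "H - 1/2" \<delta>
      by unfold_locales (use H assms in auto)
    have Hs: "H - 1/2 + 1/2 = H" by simp
    note rep = K.incr_var_representation[unfolded Hs, OF _ int]
    let ?K = "r\<^sub>0\<^sup>2 * ((H - 1/2)\<^sup>2 * k_const (H - 1/2 - 1))"
    have "autocov M X \<sim>[at_top] (\<lambda>t. ?K / lam\<^sup>2 * t powr (2 * (H - 1/2) - 1))"
    \<comment> \<open>\<open>m\<close> is half the squared jump of the kernel of \<open>N\<close>;
      it is 0 for \<delta> = 0 because 0 powr a = 0.\<close>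
    proof (rule autocov_tail[where \<rho>="\<lambda>h. r\<^sub>0\<^sup>2 * K.\<rho> h" and T\<^sub>0="\<delta> + 1" and m="r\<^sub>0\<^sup>2 * (\<delta> powr (H - 1/2))\<^sup>2 / 2"])
      fix t :: real assume t: "t > 0"
      have e: "(t - h) * (r\<^sub>0\<^sup>2 * K.\<rho> h) = r\<^sub>0\<^sup>2 * ((t - h) * K.\<rho> h)" for h by simp
      show "r\<^sub>0\<^sup>2 * ?V t = 2 * (r\<^sub>0\<^sup>2 * (\<delta> powr (H - 1/2))\<^sup>2 / 2 * t + (LBINT h:{0<..<t}. (t - h) * (r\<^sub>0\<^sup>2 * K.\<rho> h)))"
        unfolding e rep(2)[OF t] set_integral_mult_right by (simp only: distrib_left) simp
      show "set_integrable lborel {0<..<t} (\<lambda>h. r\<^sub>0\<^sup>2 * K.\<rho> h)"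
        using K.\<rho>_set_integrable[unfolded Hs, OF t int] by (rule set_integrable_mult_right)
      show "set_integrable lborel {0<..<t} (\<lambda>h. (t - h) * (r\<^sub>0\<^sup>2 * K.\<rho> h))"
        unfolding e using rep(1)[OF t] by (rule set_integrable_mult_right)
    next
      show "((\<lambda>t. r\<^sub>0\<^sup>2 * K.\<rho> t / t powr (2 * (H - 1/2) - 1)) \<longlongrightarrow> ?K) at_top"
        using tendsto_mult[OF tendsto_const K.\<rho>_asymp] by simp
      show "?K \<noteq> 0" using k_const_pos[of "H - 1/2 - 1"] H assms by auto
    qed (use H assms in \<open>auto intro!: continuous_intros K.continuous_on_\<rho>\<close>)
    moreover have "H - 1/2 - 1 = H - 3/2" "2 * (H - 1/2) - 1 = 2 * H - 2" by auto
    ultimately show ?thesis by (simp only: mult.assoc mult.commute[of "k_const _"])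
  qed
  moreover have "autocov_bar M X \<sim>[at 0] (\<lambda>t. (r\<^sub>0\<^sup>2 * \<delta> powr (2 * H - 1) / 2) * \<bar>t\<bar>)" if \<delta>: "\<delta> > 0"
  proof -
    obtain c where c: "\<And>t. 0 < t \<Longrightarrow> t < \<delta> \<Longrightarrow> \<bar>?V t - \<delta> powr (2 * H - 1) * t\<bar> \<le> c * t\<^sup>2"
      using incr_var_jump[OF assms(6,7) \<delta> int] by blast
    have "autocov_bar M X \<sim>[at 0] (\<lambda>t. (r\<^sub>0\<^sup>2 * \<delta> powr (2 * H - 1) / 2) * \<bar>t\<bar> powr 1)"
    proof (rule autocov_bar_asymp[where e=\<delta> and K="r\<^sub>0\<^sup>2 * c"])
      fix t :: real assume t: "0 < t" "t < \<delta>"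
      have "r\<^sub>0\<^sup>2 * ?V t - 2 * (r\<^sub>0\<^sup>2 * \<delta> powr (2 * H - 1) / 2) * t powr 1 = r\<^sub>0\<^sup>2 * (?V t - \<delta> powr (2 * H - 1) * t)"
        using t by (simp add: algebra_simps)
      then show "\<bar>r\<^sub>0\<^sup>2 * ?V t - 2 * (r\<^sub>0\<^sup>2 * \<delta> powr (2 * H - 1) / 2) * t powr 1\<bar> \<le> r\<^sub>0\<^sup>2 * c * t\<^sup>2"
        using mult_left_mono[OF c[OF t], of "r\<^sub>0\<^sup>2"] by (simp add: abs_mult mult.assoc)
    qed (use assms \<delta> in auto)
    then show ?thesis by simp
  qed
  moreover have "autocov_bar M X \<sim>[at 0] (\<lambda>t. (r\<^sub>0\<^sup>2 * j_const (H - 1/2) / 2) * \<bar>t\<bar> powr (2 * H))" if \<delta>: "\<delta> = 0"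
  \<comment> \<open>\<open>V\<close> is an exact power here, hence no error term, and the range
    \<open>e\<close> is arbitrary.\<close>
  proof (rule autocov_bar_asymp[where e=1 and K=0])
    show "r\<^sub>0\<^sup>2 * j_const (H - 1/2) / 2 \<noteq> 0"
      using j_const_pos[of "H - 1/2"] assms by auto
    show "\<bar>r\<^sub>0\<^sup>2 * ?V t - 2 * (r\<^sub>0\<^sup>2 * j_const (H - 1/2) / 2) * t powr (2 * H)\<bar> \<le> 0 * t\<^sup>2" if "0 < t" "t < 1" for t
      using incr_var_power_law[OF assms(6,7) that(1)] int unfolding \<delta> by simp
  qed (use assms in auto)
  ultimately show ?thesis by blast
qed

end
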